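(* Let $n\ge2$ and $k\in\{2,\ldots,n\}$, let $\mathbb{B}^n$ be the unit ball in $\mathbb{R}^n$, and let $s\in(0,1)$ with $s>\frac{k}{k+1}$. Then there exists no map $u:\mathbb{B}^n\to\mathbb{R}^n$ of class $C^s$ which is a homeomorphism onto its image, satisfies $\nabla u\in L^1(\mathbb{B}^n)$, and satisfies \[ \operatorname{rank}Du<k\quad\text{in distributional sense in }\mathbb{B}^n . \]
   Context: $C^s$ denotes the space of Hölder continuous maps with exponent $s$. Sobolev spaces: for $\sigma\in(0,1)$ and $p\in(1,\infty)$, $W^{\sigma,p}(\mathbb{B}^n)$ is the fractional Sobolev space of $f\in L^p(\mathbb{B}^n)$ with finite Gagliardo seminorm \[ [f]_{W^{\sigma,p}(\mathbb{B}^n)} := \left(\int_{\mathbb{B}^n} \int_{\mathbb{B}^n} \frac{|f(x)-f(y)|^{p}}{|x-y|^{n+\sigma p}}\, dx\, dy\right)^{\frac{1}{p}}, \] with norm $\|f\|_{W^{\sigma,p}}=\|f\|_{L^p}+[f]_{W^{\sigma,p}}$. Pullback: for a smooth map $g=(g^1,\ldots,g^N)$ from $\mathbb{B}^n$ to $\mathbb{R}^N$ and $1\le i_1<\ldots<i_k\le N$, \[ g^\ast(dp^{i_1} \wedge \ldots \wedge dp^{i_k}) = \sum_{\alpha_1,\ldots,\alpha_k=1}^n\partial_{\alpha_1} g^{i_1}\cdots \partial_{\alpha_k} g^{i_k}\ dx^{\alpha_1} \wedge \ldots \wedge dx^{\alpha_k}, \] a $k$-form whose components are the $k\times k$ minors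 of $(\nabla g^{i_1},\ldots,\nabla g^{i_k})\in\mathbb{R}^{n\times k}$. Vanishing of the pullback in distributional sense: $f\in W^{\sigma,p}(\mathbb{B}^n,\mathbb{R}^N)$ satisfies $f^\ast(dp^{i_1}\wedge\ldots\wedge dp^{i_k})=0$ in ($W^{\sigma,p}$-)distributional sense if for any $\varphi\in C_c^\infty(\mathbb{B}^n)$ and any $f_\varepsilon\in C^\infty(\overline{\mathbb{B}^n},\mathbb{R}^N)$ with $\|f_\varepsilon-f\|_{W^{\sigma,p}}\to 0$ as $\varepsilon\to0$ one has \[ \lim_{\varepsilon\to0}\int_{\mathbb{B}^n} f_\varepsilon^\ast(dp^{i_1}\wedge\ldots\wedge dp^{i_k})\,\varphi=0, \] where, if $k<n$, the integral is understood componentwise (each component of the $k$-form is integrated against $\varphi\,dx$). $f$ satisfies $\operatorname{rank}Df<k$ in ($W^{\sigma,p}$-)distributional sense if this holds for all $1\le i_1<\ldots<i_k\le N$. For a $C^s$ map with $s>1-\frac1k$, the distributional rank condition is understood through the embedding of $C^s$ into $W^{\sigma,p}$ for all $\sigma<s$ and $p\in(1,\infty)$: it means that $\operatorname{rank}Df<k$ in $W^{\sigma,p}$-distributional sense with $1-\frac1k<\sigma<s$ and $p>k$; by independence of the limit functional of the choice of $(\sigma,p)$ in this range, the choice does not matter. *)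

theory Defs
  imports "HOL-Analysis.Analysis"
begin

text \<open>
  The unit ball of \<open>n\<close>-space is \<^term>\<open>ball (0::real^'n) 1\<close> with \<open>n = CARD('n)\<close>. The index types
  carry a linear order (every finite linear order is a well-order), so that increasing
  multi-indices \<open>i\<^sub>1 < \<dots> < i\<^sub>k\<close> can be written as maps \<open>i\<close> that are strictly increasing on
  \<open>{..<k}\<close>. A map on the ball is a total function of which only the values on the ball matter.
\<close>

subsection \<open>Smooth functions\<close>

definition partial :: "'n::finite \<Rightarrow> (real^'n \<Rightarrow> 'b::real_normed_vector) \<Rightarrow> real^'n \<Rightarrow> 'b" where
  "partial \<alpha> f x = frechet_derivative f (at x) (axis \<alpha> 1)"

primrec Ck :: "nat \<Rightarrow> (real^'n::finite \<Rightarrow> 'b::real_normed_vector) \<Rightarrow> bool" where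
  "Ck 0 f \<longleftrightarrow> continuous_on UNIV f"
| "Ck (Suc m) f \<longleftrightarrow> f differentiable_on UNIV \<and> (\<forall>\<alpha>. Ck m (partial \<alpha> f))"

definition smooth :: "(real^'n::finite \<Rightarrow> 'b::real_normed_vector) \<Rightarrow> bool" where
  "smooth f \<longleftrightarrow> (\<forall>m. Ck m f)"

text \<open>Smoothness up to the boundary: restrictions of smooth functions on the whole space.\<close>

definition smooth_on_cball :: "(real^'n::finite \<Rightarrow> 'b::real_normed_vector) \<Rightarrow> bool" where
  "smooth_on_cball f \<longleftrightarrow> (\<exists>g. smooth g \<and> (\<forall>x\<in>cball 0 1. f x = g x))"

text \<open>Functions with compact support in the open unit ball, extended by zero.\<close>

definition test_function :: "(real^'n::finite \<Rightarrow> real) \<Rightarrow> bool" where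
  "test_function \<phi> \<longleftrightarrow> smooth \<phi> \<and> compact (closure {x. \<phi> x \<noteq> 0}) \<and> closure {x. \<phi> x \<noteq> 0} \<subseteq> ball 0 1"

subsection \<open>Function spaces on the unit ball\<close>

definition holder_on :: "real \<Rightarrow> 'a::metric_space set \<Rightarrow> ('a \<Rightarrow> 'b::metric_space) \<Rightarrow> bool" where
  "holder_on s S f \<longleftrightarrow> (\<exists>C. \<forall>x\<in>S. \<forall>y\<in>S. dist (f x) (f y) \<le> C * dist x y powr s)"

text \<open>
  The \<open>p\<close>-th root on \<^typ>\<open>ennreal\<close>. Norms are computed in \<^typ>\<open>ennreal\<close>, so that
  convergence in norm never refers to default values of divergent integrals.
\<close>

definition ennroot :: "real \<Rightarrow> ennreal \<Rightarrow> ennreal" where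
  "ennroot p a = (if a = \<infinity> then \<infinity> else ennreal (enn2real a powr (1 / p)))"

definition Lp_norm :: "real \<Rightarrow> (real^'n::finite \<Rightarrow> real^'m::finite) \<Rightarrow> ennreal" where
  "Lp_norm p f = ennroot p (\<integral>\<^sup>+x. ennreal (norm (f x) powr p) \<partial>lebesgue_on (ball 0 1))"

definition gagliardo_seminorm ::
  "real \<Rightarrow> real \<Rightarrow> (real^'n::finite \<Rightarrow> real^'m::finite) \<Rightarrow> ennreal" where
  "gagliardo_seminorm \<sigma> p f = ennroot p
     (\<integral>\<^sup>+y. (\<integral>\<^sup>+x. ennreal (norm (f x - f y) powr p / norm (x - y) powr (real CARD('n) + \<sigma> * p))
        \<partial>lebesgue_on (ball 0 1)) \<partial>lebesgue_on (ball 0 1))"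

definition sobolev_norm :: "real \<Rightarrow> real \<Rightarrow> (real^'n::finite \<Rightarrow> real^'m::finite) \<Rightarrow> ennreal" where
  "sobolev_norm \<sigma> p f = Lp_norm p f + gagliardo_seminorm \<sigma> p f"

definition sobolev_space :: "real \<Rightarrow> real \<Rightarrow> (real^'n::finite \<Rightarrow> real^'m::finite) set" where
  "sobolev_space \<sigma> p =
     {f. f \<in> borel_measurable (lebesgue_on (ball 0 1)) \<and> sobolev_norm \<sigma> p f < \<infinity>}"

text \<open>\<open>G\<close> is the distributional gradient, with \<open>G x $ j $ \<alpha>\<close> the derivative of \<open>u\<^sup>j\<close> along \<open>x\<^sup>\<alpha>\<close>.\<close>

definition integrable_weak_gradient :: "(real^'n::finite \<Rightarrow> real^'m::finite) \<Rightarrow> bool" where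
  "integrable_weak_gradient u \<longleftrightarrow>
     (\<exists>G :: real^'n \<Rightarrow> real^'n^'m. integrable (lebesgue_on (ball 0 1)) G \<and>
        (\<forall>\<phi> j \<alpha>. test_function \<phi> \<longrightarrow>
           (LINT x|lebesgue_on (ball 0 1). u x $ j * partial \<alpha> \<phi> x) =
           - (LINT x|lebesgue_on (ball 0 1). G x $ j $ \<alpha> * \<phi> x)))"

subsection \<open>Pullbacks and the distributional rank condition\<close>

text \<open>
  The coefficient of \<open>dx\<^bsup>\<alpha> 0\<^esup> \<and> \<dots> \<and> dx\<^bsup>\<alpha> (k-1)\<^esup>\<close>, for increasing \<open>\<alpha>\<close>, in
  \<open>g\<^sup>*(dp\<^bsup>i 0\<^esup> \<and> \<dots> \<and> dp\<^bsup>i (k-1)\<^esup>)\<close>: among the products of partial derivatives in the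
  expansion of the pullback, those belonging to rearrangements \<open>\<alpha> \<circ> \<pi>\<close> of \<open>\<alpha>\<close> contribute,
  with the sign of \<open>\<pi>\<close>. This is the \<open>k \<times> k\<close> minor with rows \<open>\<alpha>\<close> of
  the matrix with columns \<open>\<nabla>g\<^bsup>i 0\<^esup>, \<dots>, \<nabla>g\<^bsup>i (k-1)\<^esup>\<close>.
\<close>

definition pullback_component ::
  "nat \<Rightarrow> (nat \<Rightarrow> 'm) \<Rightarrow> (nat \<Rightarrow> 'n) \<Rightarrow> (real^'n::finite \<Rightarrow> real^'m::finite) \<Rightarrow> real^'n \<Rightarrow> real" where
  "pullback_component k i \<alpha> g x =
     (\<Sum>\<pi> | \<pi> permutes {..<k}. of_int (sign \<pi>) * (\<Prod>j<k. partial (\<alpha> (\<pi> j)) g x $ i j))"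

definition pullback_vanishes ::
  "real \<Rightarrow> real \<Rightarrow> nat \<Rightarrow> (nat \<Rightarrow> 'm) \<Rightarrow> (real^'n::{finite,wellorder} \<Rightarrow> real^'m::finite) \<Rightarrow> bool" where
  "pullback_vanishes \<sigma> p k i f \<longleftrightarrow> f \<in> sobolev_space \<sigma> p \<and>
     (\<forall>\<phi> (F :: real \<Rightarrow> real^'n::_ \<Rightarrow> real^'m::_).
        test_function \<phi> \<longrightarrow> (\<forall>\<epsilon>>0. smooth_on_cball (F \<epsilon>)) \<longrightarrow>
        ((\<lambda>\<epsilon>. sobolev_norm \<sigma> p (\<lambda>x. F \<epsilon> x - f x)) \<longlongrightarrow> 0) (at_right 0) \<longrightarrow>
        (\<forall>\<alpha>. strict_mono_on {..<k} \<alpha> \<longrightarrow>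
           ((\<lambda>\<epsilon>. LINT x|lebesgue_on (ball 0 1). pullback_component k i \<alpha> (F \<epsilon>) x * \<phi> x) \<longlongrightarrow> 0)
             (at_right 0)))"

definition rank_less_sobolev ::
  "real \<Rightarrow> real \<Rightarrow> nat \<Rightarrow> (real^'n::{finite,wellorder} \<Rightarrow> real^'m::{finite,wellorder}) \<Rightarrow> bool" where
  "rank_less_sobolev \<sigma> p k f \<longleftrightarrow>
     (\<forall>i. strict_mono_on {..<k} i \<longrightarrow> pullback_vanishes \<sigma> p k i f)"

text \<open>
  The rank condition for a map of class \<open>C\<^sup>s\<close>, \<open>s > 1 - 1/k\<close>. All admissible \<open>(\<sigma>, p)\<close> yield the
  same condition for such maps; requiring it for some pair is formally the weakest choice.
\<close>

definition rank_less_holder ::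
  "real \<Rightarrow> nat \<Rightarrow> (real^'n::{finite,wellorder} \<Rightarrow> real^'m::{finite,wellorder}) \<Rightarrow> bool" where
  "rank_less_holder s k f \<longleftrightarrow>
     (\<exists>\<sigma> p. 1 - 1 / real k < \<sigma> \<and> \<sigma> < s \<and> real k < p \<and> rank_less_sobolev \<sigma> p k f)"

end

theory Submission
  imports Defs
begin

text \<open>
  Why the theorem is true. Suppose that \<open>u\<close> is of class \<open>C\<^sup>s\<close> with \<open>s > k / (k + 1)\<close>, that all pullbacks
  \<open>u\<^sup>*(dp\<^bsup>i 0\<^esup> \<and> \<dots> \<and> dp\<^bsup>i (k-1)\<^esup>)\<close> vanish as distributions, and that \<open>u\<close> has a continuous left inverse on its
  image. Choose a smooth function \<open>Q\<close> on the target, with \<open>k\<close> components, such that \<open>Q \<circ> u\<close> is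
  uniformly close to \<open>k\<close> of the coordinates, each composed with a smooth step from \<open>0\<close> to \<open>1\<close>. Formally

    \<open>(Q \<circ> u)\<^sup>*(dy\<^sup>0 \<and> \<dots> \<and> dy\<^bsup>k-1\<^esup>) = \<Sum>\<^sub>i (\<Prod>\<^sub>j \<partial>\<^bsub>i j\<^esub>Q\<^sup>j \<circ> u) u\<^sup>*(dp\<^bsup>i 0\<^esup> \<and> \<dots> \<and> dp\<^bsup>i (k-1)\<^esup>) = 0\<close>,

  whereas the left-hand side, integrated against a suitable bump, does not notice the small error and equals
  its value for the steps of the coordinates themselves, which is positive.

  The analytic point is the product on the right: its coefficients are only of class \<open>C\<^sup>s\<close>, while the
  distribution is known to vanish on smooth test functions. The pairing involves \<open>k + 1\<close> functions of class
  \<open>C\<^sup>s\<close> and \<open>k\<close> derivatives, and it is continuous for \<open>(k + 1) s > k\<close>. This is made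
  quantitative with mollifications \<open>V m\<close> of \<open>u\<close> at the scales \<open>2\<^bsup>-m\<^esup>\<close> in \<open>minor_pairing_tendsto_0\<close>: for
  the test function \<open>\<psi> \<circ> V m\<close>, the changes of the pairing between consecutive scales form a
  geometric series. The mollifications are admissible in the definition of the rank condition, since they
  converge to \<open>u\<close> in every \<open>W\<^bsup>\<sigma>,p\<^esup>\<close> with \<open>\<sigma> < s\<close> (\<open>sobolev_norm_tendsto_0\<close>).

  Both this estimate and the evaluation of the left-hand side rest on one fact, \<open>integral_minor_by_parts\<close>:
  minors of gradients are null Lagrangians, so that a function in any slot can be exchanged
  with the test function. For the evaluation, each component of \<open>Q \<circ> u\<close> coincides, on the support of the
  bump, with the step of its coordinate outside of a thin slab around the coordinate hyperplane; integrating by parts, slot after slot, all error terms live on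
  the intersection of the slabs, where the bump is constant in the directions concerned
  (\<open>integral_minor_eq_coordinates\<close>). The function \<open>Q\<close> is a step applied to a polynomial
  approximation of the left inverse.
\<close>

section \<open>Calculus of smooth functions\<close>

lemma partial_eqI:
  assumes "(f has_derivative f') (at x)"
  shows "partial a f x = f' (axis a 1)"
  using frechet_derivative_at[OF assms] by (simp add: partial_def)

lemma has_derivative_frechet_derivative:
  "f differentiable (at x) \<Longrightarrow> (f has_derivative frechet_derivative f (at x)) (at x)"
  by (simp add: frechet_derivative_works)

lemma partial_add:
  assumes "f differentiable (at x)" "g differentiable (at x)"
  shows "partial a (\<lambda>x. f x + g x) x = partial a f x + partial a g x"
  by (subst partial_eqI, rule has_derivative_add)
     (use assms in \<open>auto intro: has_derivative_frechet_derivative simp: partial_def\<close>)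

lemma partial_diff:
  assumes "f differentiable (at x)" "g differentiable (at x)"
  shows "partial a (\<lambda>x. f x - g x) x = partial a f x - partial a g x"
  by (subst partial_eqI, rule has_derivative_diff)
     (use assms in \<open>auto intro: has_derivative_frechet_derivative simp: partial_def\<close>)

lemma partial_mult:
  fixes f g :: "real^'n::finite \<Rightarrow> real"
  assumes "f differentiable (at x)" "g differentiable (at x)"
  shows "partial a (\<lambda>x. f x * g x) x = f x * partial a g x + partial a f x * g x"
  by (subst partial_eqI, rule has_derivative_mult)
     (use assms in \<open>auto intro: has_derivative_frechet_derivative simp: partial_def\<close>)

lemma partial_const [simp]: "partial a (\<lambda>x. c) x = 0"
  by (subst partial_eqI, rule has_derivative_const) simp

lemma partial_prod:
  fixes f :: "'i \<Rightarrow> real^'n::finite \<Rightarrow> real"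
  assumes "finite I" "\<And>i. i \<in> I \<Longrightarrow> f i differentiable (at x)"
  shows "partial a (\<lambda>x. \<Prod>i\<in>I. f i x) x = (\<Sum>i\<in>I. partial a (f i) x * (\<Prod>j\<in>I - {i}. f j x))"
  by (subst partial_eqI, rule has_derivative_prod)
     (use assms in \<open>auto intro: has_derivative_frechet_derivative simp: partial_def\<close>)

lemma partial_bounded_linear:
  "bounded_linear f \<Longrightarrow> partial a f x = f (axis a 1)"
  by (rule partial_eqI, rule bounded_linear_imp_has_derivative)

lemma partial_component:
  fixes f :: "real^'n::finite \<Rightarrow> real^'m::finite"
  assumes "f differentiable (at x)"
  shows "partial a (\<lambda>x. f x $ i) x = partial a f x $ i"
  by (subst partial_eqI, rule bounded_linear.has_derivative[OF bounded_linear_vec_nth])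
     (use assms in \<open>auto intro: has_derivative_frechet_derivative simp: partial_def\<close>)

lemma partial_chain_real:
  fixes g :: "real^'n::finite \<Rightarrow> real"
  assumes "(f has_real_derivative d) (at (g x))" "g differentiable (at x)"
  shows "partial a (\<lambda>x. f (g x)) x = d * partial a g x"
proof -
  have "((\<lambda>x. f (g x)) has_derivative (\<lambda>h. d * frechet_derivative g (at x) h)) (at x)"
    using has_derivative_compose[OF has_derivative_frechet_derivative[OF assms(2)]
        assms(1)[unfolded has_field_derivative_def]] by simp
  then show ?thesis by (subst partial_eqI, assumption) (simp add: partial_def)
qed

lemma derivative_eq_sum_partial:
  fixes f :: "real^'n::finite \<Rightarrow> 'b::real_normed_vector"
  assumes "f differentiable (at x)"
  shows "frechet_derivative f (at x) h = (\<Sum>i\<in>UNIV. (h $ i) *\<^sub>R partial i f x)"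
proof -
  interpret bounded_linear "frechet_derivative f (at x)"
    using has_derivative_frechet_derivative[OF assms] has_derivative_bounded_linear by blast
  have "h = (\<Sum>i\<in>UNIV. (h $ i) *\<^sub>R axis i 1)"
    using basis_expansion[of h] by (simp add: scalar_mult_eq_scaleR)
  then have "frechet_derivative f (at x) h =
      frechet_derivative f (at x) (\<Sum>i\<in>UNIV. (h $ i) *\<^sub>R axis i 1)" by simp
  also have "\<dots> = (\<Sum>i\<in>UNIV. (h $ i) *\<^sub>R frechet_derivative f (at x) (axis i 1))"
    by (simp add: sum scaleR)
  finally show ?thesis by (simp add: partial_def)
qed

lemma partial_chain:
  fixes f :: "real^'m::finite \<Rightarrow> real" and U :: "real^'n::finite \<Rightarrow> real^'m"
  assumes "f differentiable (at (U x))" "U differentiable (at x)"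
  shows "partial a (\<lambda>x. f (U x)) x = (\<Sum>i\<in>UNIV. partial i f (U x) * partial a (\<lambda>x. U x $ i) x)"
proof -
  have "partial a (\<lambda>x. f (U x)) x = frechet_derivative f (at (U x)) (partial a U x)"
    by (subst partial_eqI, rule has_derivative_compose)
       (use assms in \<open>auto intro: has_derivative_frechet_derivative simp: partial_def\<close>)
  also have "\<dots> = (\<Sum>i\<in>UNIV. partial i f (U x) * partial a (\<lambda>x. U x $ i) x)"
    by (subst derivative_eq_sum_partial[OF assms(1)]) (simp add: partial_component[OF assms(2)] mult.commute)
  finally show ?thesis .
qed

subsection \<open>Closure properties\<close>

lemma Ck_differentiable: "Ck (Suc m) f \<Longrightarrow> f differentiable (at x)"
  by (simp add: differentiable_on_def)

lemma Ck_continuous: "Ck m f \<Longrightarrow> continuous_on S f"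
  by (cases m) (auto intro: differentiable_imp_continuous_on continuous_on_subset)

lemma Ck_decrease: "Ck (Suc m) f \<Longrightarrow> Ck m f"
proof (induction m arbitrary: f)
  case 0
  then show ?case using Ck_continuous[of "Suc 0" f UNIV] by simp
next
  case (Suc m)
  then have "f differentiable_on UNIV" "\<And>a. Ck (Suc m) (partial a f)"
    using Ck.simps(2)[of "Suc m" f] by blast+
  then show ?case using Suc.IH unfolding Ck.simps(2)[of m f] by blast
qed

lemma Ck_SucI:
  assumes "\<And>x. f differentiable (at x)" "\<And>a. Ck m (g a)" "\<And>a x. partial a f x = g a x"
  shows "Ck (Suc m) f"
proof -
  have "partial a f = g a" for a using assms(3) by (simp add: fun_eq_iff)
  then show ?thesis using assms(1,2) by (simp add: differentiable_on_def differentiable_at_withinI)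
qed

lemma Ck_const [simp]: "Ck m (\<lambda>x. c)"
proof (induction m arbitrary: c)
  case (Suc m) show ?case by (rule Ck_SucI[where g="\<lambda>a x. 0"]) (use Suc in auto)
qed simp

lemma Ck_add: "Ck m f \<Longrightarrow> Ck m g \<Longrightarrow> Ck m (\<lambda>x. f x + g x)"
proof (induction m arbitrary: f g)
  case (Suc m)
  note d = Ck_differentiable[OF Suc.prems(1)] Ck_differentiable[OF Suc.prems(2)]
  show ?case
    by (rule Ck_SucI[where g="\<lambda>a x. partial a f x + partial a g x"])
       (use Suc in \<open>auto intro!: differentiable_add d simp: partial_add d\<close>)
qed (auto intro: continuous_on_add)

lemma Ck_mult:
  fixes f g :: "real^'n::finite \<Rightarrow> real"
  shows "Ck m f \<Longrightarrow> Ck m g \<Longrightarrow> Ck m (\<lambda>x. f x * g x)"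
proof (induction m arbitrary: f g)
  case (Suc m)
  note d = Ck_differentiable[OF Suc.prems(1)] Ck_differentiable[OF Suc.prems(2)]
  show ?case
  proof (rule Ck_SucI[where g="\<lambda>a x. f x * partial a g x + partial a f x * g x"])
    show "Ck m (\<lambda>x. f x * partial a g x + partial a f x * g x)" for a
      using Suc.prems Ck_decrease by (intro Ck_add Suc.IH) auto
  qed (auto intro!: differentiable_mult d simp: partial_mult d)
qed (auto intro: continuous_on_mult)

lemma Ck_bounded_linear:
  assumes "bounded_linear f" shows "Ck m f"
proof (cases m)
  case 0 then show ?thesis using assms by (simp add: linear_continuous_on)
next
  case (Suc m)
  show ?thesis unfolding Suc
    by (rule Ck_SucI[where g="\<lambda>a x. f (axis a 1)"])
       (auto simp: partial_bounded_linear assms bounded_linear_imp_differentiable)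
qed

lemma Ck_sum: "(\<And>i. i \<in> I \<Longrightarrow> Ck m (f i)) \<Longrightarrow> Ck m (\<lambda>x. \<Sum>i\<in>I. f i x)"
  by (induction I rule: infinite_finite_induct) (auto intro: Ck_add simp del: Ck.simps)

lemma Ck_prod:
  fixes f :: "'i \<Rightarrow> real^'n::finite \<Rightarrow> real"
  shows "(\<And>i. i \<in> I \<Longrightarrow> Ck m (f i)) \<Longrightarrow> Ck m (\<lambda>x. \<Prod>i\<in>I. f i x)"
  by (induction I rule: infinite_finite_induct) (auto intro: Ck_mult simp del: Ck.simps)

lemma Ck_component:
  fixes f :: "real^'n::finite \<Rightarrow> real^'m::finite"
  shows "Ck m f \<Longrightarrow> Ck m (\<lambda>x. f x $ i)"
proof (induction m arbitrary: f)
  case (Suc m)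
  note d = Ck_differentiable[OF Suc.prems]
  have "(\<lambda>x. f x $ i) differentiable (at x)" for x
    using bounded_linear.has_derivative[OF bounded_linear_vec_nth has_derivative_frechet_derivative[OF d]]
    by (auto simp: differentiable_def)
  then show ?case
    by (intro Ck_SucI[where g="\<lambda>a x. partial a f x $ i"]) (use Suc in \<open>auto simp: partial_component d\<close>)
qed (auto intro: continuous_intros)

lemma Ck_vector:
  fixes f :: "'m::finite \<Rightarrow> real^'n::finite \<Rightarrow> real"
  shows "(\<And>i. Ck m (f i)) \<Longrightarrow> Ck m (\<lambda>x. \<chi> i. f i x)"
proof (induction m arbitrary: f)
  case (Suc m)
  note d = Ck_differentiable[OF Suc.prems]
  have *: "((\<lambda>x. \<chi> i. f i x) has_derivative (\<lambda>h. \<chi> i. frechet_derivative (f i) (at x) h)) (at x)" for x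
    by (auto simp: has_derivative_componentwise_within[where f="\<lambda>x. \<chi> i. f i x"] Basis_vec_def inner_axis
        intro: has_derivative_frechet_derivative[OF d])
  show ?case
    by (rule Ck_SucI[where g="\<lambda>a x. \<chi> i. partial a (f i) x"])
       (use Suc in \<open>auto simp: partial_eqI[OF *] intro: differentiableI[OF *]\<close>, simp add: partial_def)
qed (auto intro: continuous_intros)

lemma Ck_compose:
  fixes f :: "real^'m::finite \<Rightarrow> real" and U :: "real^'n::finite \<Rightarrow> real^'m"
  shows "Ck m f \<Longrightarrow> Ck m U \<Longrightarrow> Ck m (\<lambda>x. f (U x))"
proof (induction m arbitrary: f)
  case 0
  then show ?case by (auto intro: continuous_on_compose2)
next
  case (Suc m)
  note d = Ck_differentiable[OF Suc.prems(1)] Ck_differentiable[OF Suc.prems(2)]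
  have c: "Ck m (partial a (\<lambda>x. U x $ i))" for a i
    using Ck_component[OF Suc.prems(2), of i] by simp
  show ?case
    by (rule Ck_SucI[where g="\<lambda>a x. \<Sum>i\<in>UNIV. partial i f (U x) * partial a (\<lambda>x. U x $ i) x"])
       (use Suc c Ck_decrease[of m U] in \<open>auto intro!: Ck_sum Ck_mult Suc.IH differentiable_compose[of f U] d
          simp: partial_chain[OF d] simp del: Ck.simps(1)\<close>)
qed

text \<open>A class of functions of one real variable that is closed under derivatives consists of
  smooth functions. Since the notion of smoothness is about functions on \<open>\<real>\<^sup>n\<close>, this is expressed
  through composition.\<close>

lemma Ck_compose_real:
  fixes g :: "real^'n::finite \<Rightarrow> real"
  assumes E: "\<And>f. f \<in> E \<Longrightarrow> \<exists>f'\<in>E. \<forall>t. (f has_real_derivative f' t) (at t)"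
  shows "f \<in> E \<Longrightarrow> Ck m g \<Longrightarrow> Ck m (\<lambda>x. f (g x))"
proof (induction m arbitrary: f)
  case 0
  obtain f' where "\<forall>t. (f has_real_derivative f' t) (at t)" using E[OF 0(1)] by blast
  then have "continuous_on UNIV f"
    by (meson DERIV_continuous continuous_at_imp_continuous_on)
  then show ?case using 0(2) by (auto intro: continuous_on_compose2)
next
  case (Suc m)
  obtain f' where f': "f' \<in> E" "\<And>t. (f has_real_derivative f' t) (at t)" using E[OF Suc.prems(1)] by blast
  note d = Ck_differentiable[OF Suc.prems(2)]
  have "f differentiable (at t)" for t
    using f'(2) by (auto simp: differentiable_def has_field_derivative_def)
  then show ?case
    by (intro Ck_SucI[where g="\<lambda>a x. f' (g x) * partial a g x"])
       (use Suc f' Ck_decrease[of m g] in \<open>auto intro!: Ck_mult Suc.IH differentiable_compose[of f g] d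
          simp: partial_chain_real[OF f'(2) d]\<close>)
qed

lemma Ck_inverse:
  fixes g :: "real^'n::finite \<Rightarrow> real"
  assumes "\<And>x. g x \<noteq> 0"
  shows "Ck m g \<Longrightarrow> Ck m (\<lambda>x. inverse (g x))"
proof (induction m)
  case 0 then show ?case using assms by (auto intro: continuous_on_inverse)
next
  case (Suc m)
  note d = Ck_differentiable[OF Suc.prems]
  have IH: "Ck m (\<lambda>x. inverse (g x))" using Suc Ck_decrease by blast
  have D: "(inverse has_real_derivative - (inverse (g x) * inverse (g x))) (at (g x))" for x
    using DERIV_inverse[OF assms, of x UNIV] by (simp add: power2_eq_square)
  show ?case
  proof (rule Ck_SucI[where g="\<lambda>a x. (-1) * (inverse (g x) * inverse (g x)) * partial a g x"])
    show "Ck m (\<lambda>x. (-1) * (inverse (g x) * inverse (g x)) * partial a g x)" for a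
      using Suc.prems by (intro Ck_mult IH Ck_const) auto
    show "(\<lambda>x. inverse (g x)) differentiable at x" for x
      using d assms by (auto intro!: differentiable_inverse)
  qed (simp add: partial_chain_real[OF D d])
qed

lemma smooth_Ck: "smooth f \<Longrightarrow> Ck m f" by (simp add: smooth_def)

lemma smooth_differentiable: "smooth f \<Longrightarrow> f differentiable (at x)"
  using smooth_Ck[of f "Suc 0"] Ck_differentiable by blast

lemma smooth_continuous: "smooth f \<Longrightarrow> continuous_on S f"
  using smooth_Ck[of f 0] Ck_continuous by blast

lemma smooth_partial: "smooth f \<Longrightarrow> smooth (partial a f)"
  unfolding smooth_def by (metis Ck.simps(2))

lemma smooth_const [simp]: "smooth (\<lambda>x. c)" by (simp add: smooth_def)

lemma smooth_bounded_linear: "bounded_linear f \<Longrightarrow> smooth f"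
  by (simp add: smooth_def Ck_bounded_linear)

lemma smooth_nth [simp]: "smooth (\<lambda>x. x $ i)"
  by (intro smooth_bounded_linear bounded_linear_vec_nth)

lemma smooth_add: "smooth f \<Longrightarrow> smooth g \<Longrightarrow> smooth (\<lambda>x. f x + g x)"
  by (simp add: smooth_def Ck_add)

lemma smooth_vector:
  fixes f :: "'m::finite \<Rightarrow> real^'n::finite \<Rightarrow> real"
  shows "(\<And>i. smooth (f i)) \<Longrightarrow> smooth (\<lambda>x. \<chi> i. f i x)"
  unfolding smooth_def by (blast intro: Ck_vector)

lemma smooth_component:
  fixes f :: "real^'n::finite \<Rightarrow> real^'m::finite"
  shows "smooth f \<Longrightarrow> smooth (\<lambda>x. f x $ i)"
  unfolding smooth_def by (blast intro: Ck_component)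

context
  fixes f g :: "real^'n::finite \<Rightarrow> real"
  assumes f: "smooth f" and g: "smooth g"
begin

lemma smooth_mult: "smooth (\<lambda>x. f x * g x)"
  using f g by (simp add: smooth_def Ck_mult)

lemma smooth_diff: "smooth (\<lambda>x. f x - g x)"
proof -
  have "smooth (\<lambda>x. f x + (-1) * g x)"
    using f g unfolding smooth_def by (intro allI Ck_add Ck_mult Ck_const) auto
  then show ?thesis by simp
qed

lemma smooth_divide: "(\<And>x. g x \<noteq> 0) \<Longrightarrow> smooth (\<lambda>x. f x / g x)"
  using f g by (simp add: smooth_def Ck_mult Ck_inverse divide_inverse)

end

lemma smooth_prod:
  fixes f :: "'i \<Rightarrow> real^'n::finite \<Rightarrow> real"
  shows "(\<And>i. i \<in> I \<Longrightarrow> smooth (f i)) \<Longrightarrow> smooth (\<lambda>x. \<Prod>i\<in>I. f i x)"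
  by (simp add: smooth_def Ck_prod)

lemma smooth_compose:
  fixes f :: "real^'m::finite \<Rightarrow> real" and U :: "real^'n::finite \<Rightarrow> real^'m"
  shows "smooth f \<Longrightarrow> smooth U \<Longrightarrow> smooth (\<lambda>x. f (U x))"
  by (simp add: smooth_def Ck_compose)

lemma smooth_real_polynomial_function:
  fixes f :: "real^'n::finite \<Rightarrow> real"
  assumes "real_polynomial_function f" shows "smooth f"
  using assms by induction (auto intro: smooth_bounded_linear smooth_add smooth_mult)

lemma smooth_bounded_on_compact:
  fixes g :: "real^'n::finite \<Rightarrow> real"
  assumes "compact S" "smooth g"
  shows "\<exists>M. \<forall>y\<in>S. \<bar>g y\<bar> \<le> M"
  using compact_imp_bounded[OF compact_continuous_image[OF smooth_continuous[OF assms(2)] assms(1)]]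
  unfolding bounded_iff by auto

section \<open>Smooth steps and bumps\<close>

text \<open>The functions \<open>p (1/t) exp (-1/t)\<close>, extended by zero to \<open>t \<le> 0\<close>, for all polynomials \<open>p\<close> at once:
  this family contains its derivatives, which gives smoothness by \<open>Ck_compose_real\<close>.\<close>

definition flat_exp :: "real poly \<Rightarrow> real \<Rightarrow> real" where
  "flat_exp p t = (if t > 0 then poly p (1 / t) * exp (- (1 / t)) else 0)"

lemma poly_mult_exp_neg_tendsto_0: "((\<lambda>x::real. poly p x * exp (- x)) \<longlongrightarrow> 0) at_top"
proof -
  have "((\<lambda>x::real. \<Sum>i\<le>degree p. coeff p i * (x ^ i / exp x)) \<longlongrightarrow> (\<Sum>i\<le>degree p. coeff p i * 0)) at_top"
    by (intro tendsto_intros tendsto_power_div_exp_0)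
  then show ?thesis
    by (simp add: poly_altdef sum_distrib_right exp_minus divide_inverse mult.assoc)
qed

text \<open>At the origin the difference quotient is again a polynomial in \<open>1/t\<close> times \<open>exp (-1/t)\<close>, and the
  exponential wins.\<close>

lemma flat_exp_has_derivative:
  "(flat_exp p has_real_derivative flat_exp ([:0, 0, 1:] * (p - pderiv p)) t) (at t)"
proof -
  consider "t > 0" | "t < 0" | "t = 0" by linarith
  then show ?thesis
  proof cases
    case 1
    have "((\<lambda>t. poly p (1 / t) * exp (- (1 / t))) has_real_derivative
        flat_exp ([:0, 0, 1:] * (p - pderiv p)) t) (at t)"
      using 1 by (auto intro!: derivative_eq_intros DERIV_chain2[OF poly_DERIV] simp: flat_exp_def field_simps power2_eq_square)
    then show ?thesis
      by (rule has_field_derivative_transform_within_open[of _ _ _ "{0<..}"]) (use 1 in \<open>auto simp: flat_exp_def\<close>)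
  next
    case 2
    have "((\<lambda>t. 0) has_real_derivative flat_exp ([:0, 0, 1:] * (p - pderiv p)) t) (at t)"
      using 2 by (auto simp: flat_exp_def)
    then show ?thesis
      by (rule has_field_derivative_transform_within_open[of _ _ _ "{..<0}"]) (use 2 in \<open>auto simp: flat_exp_def\<close>)
  next
    case 3
    have L: "((\<lambda>h. flat_exp p h / h) \<longlongrightarrow> 0) (at_left 0)"
      by (rule tendsto_eventually) (auto simp: eventually_at_left_field flat_exp_def intro: exI[of _ "-1"])
    have "((\<lambda>h. poly (pCons 0 p) (inverse h) * exp (- inverse h)) \<longlongrightarrow> 0) (at_right (0::real))"
      by (rule filterlim_compose[OF poly_mult_exp_neg_tendsto_0 filterlim_inverse_at_top_right])
    moreover have "\<forall>\<^sub>F h in at_right (0::real). poly (pCons 0 p) (inverse h) * exp (- inverse h) = flat_exp p h / h"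
      by (auto simp: eventually_at_right_field flat_exp_def divide_inverse intro!: exI[of _ 1])
    ultimately have R: "((\<lambda>h. flat_exp p h / h) \<longlongrightarrow> 0) (at_right 0)"
      by (rule Lim_transform_eventually)
    have "((\<lambda>h. (flat_exp p (0 + h) - flat_exp p 0) / h) \<longlongrightarrow> 0) (at 0)"
      using filterlim_split_at[OF L R] by (simp add: flat_exp_def)
    then show ?thesis by (simp add: 3 DERIV_def) (simp add: flat_exp_def)
  qed
qed

lemma smooth_flat_exp:
  fixes g :: "real^'n::finite \<Rightarrow> real"
  assumes "smooth g" shows "smooth (\<lambda>x. flat_exp p (g x))"
  unfolding smooth_def
proof
  fix m
  show "Ck m (\<lambda>x. flat_exp p (g x))"
    by (rule Ck_compose_real[of "range flat_exp"])
       (use flat_exp_has_derivative smooth_Ck[OF assms] in blast)+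
qed

text \<open>The denominator has no zeros because \<open>t\<close> and \<open>1 - t\<close> are not both nonpositive.\<close>

definition step :: "real \<Rightarrow> real" where
  "step t = flat_exp 1 t / (flat_exp 1 t + flat_exp 1 (1 - t))"

definition step' :: "real \<Rightarrow> real" where
  "step' t = (flat_exp [:0, 0, 1:] t * flat_exp 1 (1 - t) + flat_exp 1 t * flat_exp [:0, 0, 1:] (1 - t))
    / (flat_exp 1 t + flat_exp 1 (1 - t))\<^sup>2"

lemma step_denominator_pos: "flat_exp 1 t + flat_exp 1 (1 - t) > 0"
  by (auto simp: flat_exp_def add_pos_pos)

lemma step_has_derivative: "(step has_real_derivative step' t) (at t)"
proof -
  have d: "(flat_exp 1 has_real_derivative flat_exp [:0, 0, 1:] t) (at t)" for t
    using flat_exp_has_derivative[of 1 t] by simp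
  have d': "((\<lambda>t. flat_exp 1 (1 - t)) has_real_derivative - flat_exp [:0, 0, 1:] (1 - t)) (at t)"
  proof -
    have "((\<lambda>t. 1 - t) has_real_derivative - 1) (at t)" by (auto intro!: derivative_eq_intros)
    from DERIV_chain2[where f="flat_exp 1" and g="\<lambda>t. 1 - t", OF d this] show ?thesis by simp
  qed
  show ?thesis
    unfolding step_def[abs_def] step'_def
    by (rule derivative_eq_intros d d' refl | use step_denominator_pos[of t] in \<open>simp add: field_simps power2_eq_square\<close>)+
qed

lemma step_eq_0: "t \<le> 0 \<Longrightarrow> step t = 0"
  and step_eq_1: "t \<ge> 1 \<Longrightarrow> step t = 1"
  and step_nonneg: "step t \<ge> 0"
  and step'_eq_0: "t \<le> 0 \<or> t \<ge> 1 \<Longrightarrow> step' t = 0"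
  and step'_nonneg: "step' t \<ge> 0"
  and step'_half: "step' (1/2) > 0"
  by (auto simp: step_def step'_def flat_exp_def)

lemma smooth_step:
  fixes g :: "real^'n::finite \<Rightarrow> real"
  assumes "smooth g" shows "smooth (\<lambda>x. step (g x))"
  unfolding step_def
  using step_denominator_pos by (intro smooth_divide smooth_add smooth_flat_exp smooth_diff smooth_const assms) (simp add: less_le)

definition plateau :: "real \<Rightarrow> real" where
  "plateau t = step (t + 2) * step (2 - t)"

definition plateau' :: "real \<Rightarrow> real" where
  "plateau' t = step' (t + 2) * step (2 - t) - step (t + 2) * step' (2 - t)"

lemma plateau_has_derivative: "(plateau has_real_derivative plateau' t) (at t)"
  unfolding plateau_def[abs_def] plateau'_def
  by (auto intro!: derivative_eq_intros DERIV_chain2[OF step_has_derivative])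

lemma plateau_eq_1: "\<bar>t\<bar> \<le> 1 \<Longrightarrow> plateau t = 1"
  and plateau_eq_0: "\<bar>t\<bar> \<ge> 2 \<Longrightarrow> plateau t = 0"
  and plateau_nonneg: "plateau t \<ge> 0"
  and plateau'_eq_0: "\<bar>t\<bar> \<le> 1 \<or> \<bar>t\<bar> \<ge> 2 \<Longrightarrow> plateau' t = 0"
  by (auto simp: plateau_def plateau'_def step_eq_1 step_eq_0 step'_eq_0 step_nonneg abs_if split: if_splits)

definition bump :: "real \<Rightarrow> real^'n::finite \<Rightarrow> real" where
  "bump l x = (\<Prod>i\<in>UNIV. plateau (l * x $ i))"

lemma smooth_bump: "smooth (bump l :: real^'n::finite \<Rightarrow> real)"
  unfolding bump_def[abs_def] plateau_def
  by (intro smooth_prod smooth_mult smooth_step smooth_add smooth_diff smooth_const smooth_nth)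

lemma bump_nonneg: "bump l x \<ge> 0"
  by (simp add: bump_def plateau_nonneg prod_nonneg)

lemma bump_eq_0: "\<bar>l * x $ i\<bar> \<ge> 2 \<Longrightarrow> bump l x = 0"
  using plateau_eq_0 by (auto simp: bump_def)

lemma bump_eq_1: "(\<And>i. \<bar>l * x $ i\<bar> \<le> 1) \<Longrightarrow> bump l x = 1"
  by (simp add: bump_def plateau_eq_1)

lemma partial_bump:
  fixes x :: "real^'n::finite"
  shows "partial a (bump l) x = l * plateau' (l * x $ a) * (\<Prod>i\<in>UNIV - {a}. plateau (l * x $ i))"
proof -
  have lin: "(\<lambda>x::real^'n. l * x $ i) differentiable (at x)" for i
    by (intro smooth_differentiable smooth_mult smooth_const smooth_nth)
  have d: "(\<lambda>x::real^'n. plateau (l * x $ i)) differentiable (at x)" for i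
    unfolding plateau_def
    by (intro smooth_differentiable smooth_mult smooth_step smooth_add smooth_diff smooth_const smooth_nth)
  have p: "partial a (\<lambda>x::real^'n. l * x $ i) x = (if i = a then l else 0)" for i
    by (subst partial_bounded_linear)
       (auto simp: axis_def bounded_linear_mult_const intro: bounded_linear_const_mult bounded_linear_vec_nth)
  have "partial a (bump l) x = (\<Sum>i\<in>UNIV. (plateau' (l * x $ i) * (if i = a then l else 0)) *
      (\<Prod>j\<in>UNIV - {i}. plateau (l * x $ j)))"
    unfolding bump_def[abs_def]
    by (subst partial_prod) (auto simp: d partial_chain_real[OF plateau_has_derivative lin] p)
  also have "\<dots> = (\<Sum>i\<in>UNIV. if i = a then l * plateau' (l * x $ a) * (\<Prod>j\<in>UNIV - {a}. plateau (l * x $ j)) else 0)"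
    by (rule sum.cong) auto
  finally show ?thesis by simp
qed

text \<open>The gradient of a bump along a direction lives where that very coordinate has left the plateau.\<close>

lemma partial_bump_nonzero:
  assumes "partial a (bump l) x \<noteq> 0"
  shows "\<bar>l * x $ a\<bar> > 1" and "\<bar>l * x $ i\<bar> < 2"
proof -
  have *: "plateau' (l * x $ a) \<noteq> 0" "(\<Prod>i\<in>UNIV - {a}. plateau (l * x $ i)) \<noteq> 0"
    using assms by (auto simp: partial_bump)
  then show "\<bar>l * x $ a\<bar> > 1" using plateau'_eq_0 not_le by blast
  show "\<bar>l * x $ i\<bar> < 2"
  proof (cases "i = a")
    case True then show ?thesis using *(1) plateau'_eq_0 not_le by blast
  next
    case False then show ?thesis using *(2) plateau_eq_0[of "l * x $ i"] not_le by fastforce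
  qed
qed

lemma test_functionI:
  fixes \<phi> :: "real^'n::finite \<Rightarrow> real"
  assumes "smooth \<phi>" "r < 1" "\<And>x. \<phi> x \<noteq> 0 \<Longrightarrow> norm x \<le> r"
  shows "test_function \<phi>"
proof -
  have *: "closure {x. \<phi> x \<noteq> 0} \<subseteq> cball 0 r"
    by (rule closure_minimal) (use assms in auto)
  then have "bounded (closure {x. \<phi> x \<noteq> 0})"
    using bounded_subset bounded_cball by blast
  moreover have "cball 0 r \<subseteq> (ball 0 1 :: (real^'n) set)" using assms(2) by auto
  ultimately show ?thesis using assms(1) * unfolding test_function_def
    by (auto simp: compact_eq_bounded_closed)
qed

lemma test_function_eq_0: "test_function \<phi> \<Longrightarrow> x \<notin> ball 0 1 \<Longrightarrow> \<phi> x = 0"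
  using closure_subset[of "{x. \<phi> x \<noteq> 0}"] by (auto simp: test_function_def)

lemma partial_eq_0_outside:
  assumes "closed S" and f: "\<And>x. x \<notin> S \<Longrightarrow> f x = 0" and "x \<notin> S"
  shows "partial a f x = 0"
proof -
  have "(f has_derivative (\<lambda>h. 0)) (at x)"
    by (rule has_derivative_transform_within_open[OF has_derivative_const[of 0], where s="- S"]) (use assms in auto)
  then show ?thesis by (rule partial_eqI)
qed

lemma test_function_mult:
  assumes "test_function \<phi>" "smooth g"
  shows "test_function (\<lambda>x. g x * \<phi> x)"
proof -
  have "closure {x. g x * \<phi> x \<noteq> 0} \<subseteq> closure {x. \<phi> x \<noteq> 0}"
    by (rule closure_mono) auto
  moreover from this have "bounded (closure {x. g x * \<phi> x \<noteq> 0})"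
    using assms(1) bounded_subset compact_imp_bounded unfolding test_function_def by blast
  ultimately show ?thesis
    using assms by (auto simp: test_function_def compact_eq_bounded_closed intro!: smooth_mult)
qed

lemma test_function_smooth: "test_function \<phi> \<Longrightarrow> smooth \<phi>"
  by (simp add: test_function_def)

section \<open>Integration by parts\<close>

abbreviation cube :: "real \<Rightarrow> (real^'n::finite) set" where
  "cube r \<equiv> cbox (vec (- r)) (vec r)"

lemma mem_cube: "x \<in> cube r \<longleftrightarrow> (\<forall>i. \<bar>x $ i\<bar> \<le> r)"
  by (auto simp: mem_box_cart abs_le_iff minus_le_iff)

lemma cube_mono: "r \<le> s \<Longrightarrow> cube r \<subseteq> cube s"
  by (rule subsetI, unfold mem_cube) (meson order_trans)

lemma cball_subset_cube: "cball 0 r \<subseteq> cube r"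
  by (auto simp: mem_cube dist_norm intro: order_trans[OF component_le_norm_cart])

lemma has_derivative_along_axis:
  fixes f :: "real^'n::finite \<Rightarrow> real"
  assumes "\<And>x. f differentiable (at x)"
  shows "((\<lambda>t. f (x + t *\<^sub>R axis a 1)) has_real_derivative partial a f (x + s *\<^sub>R axis a 1)) (at s)"
proof -
  have "((\<lambda>t. f (x + t *\<^sub>R axis a 1)) has_derivative
      (\<lambda>h. frechet_derivative f (at (x + s *\<^sub>R axis a 1)) (h *\<^sub>R axis a 1))) (at s)"
    by (rule has_derivative_compose[OF _ has_derivative_frechet_derivative[OF assms]])
       (auto intro!: derivative_eq_intros)
  moreover have "frechet_derivative f (at y) (h *\<^sub>R v) = h * frechet_derivative f (at y) v" for y h v
    using linear_frechet_derivative[OF assms, of y] by (simp add: linear_cmul)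
  ultimately show ?thesis
    unfolding has_field_derivative_def partial_def
    by (simp add: mult.commute[of "frechet_derivative _ _ _", abs_def])
qed

text \<open>Translating a compactly supported function does not change its integral, so the derivative
  of the integral with respect to the translation vanishes.\<close>

lemma has_integral_partial_0:
  fixes f :: "real^'n::finite \<Rightarrow> real"
  assumes f: "smooth f" and supp: "\<And>x. x \<notin> cube 1 \<Longrightarrow> f x = 0"
  shows "(partial a f has_integral 0) (cube 1)"
proof -
  define G where "G t = integral (cube 3) (\<lambda>x. f (x + t *\<^sub>R axis a 1))" for t
  have cont: "continuous_on S f" "continuous_on S (partial a f)" for S
    using f by (auto intro: smooth_continuous smooth_partial)
  obtain I where I: "(f has_integral I) (cube 1)"
    using integrable_continuous[OF cont(1)] by blast
  have const: "G t = I" if t: "\<bar>t\<bar> < 1" for t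
  proof -
    have "((\<lambda>x. f (1 *\<^sub>R x + t *\<^sub>R axis a 1)) has_integral I /\<^sub>R 1 ^ DIM(real^'n))
        (cbox ((vec (- 1) - t *\<^sub>R axis a 1) /\<^sub>R 1) ((vec 1 - t *\<^sub>R axis a 1) /\<^sub>R 1))" (is "(_ has_integral _) ?S")
      by (rule has_integral_affinity'[OF I]) simp
    then have *: "((\<lambda>x. f (x + t *\<^sub>R axis a 1)) has_integral I) ?S" by simp
    have S: "x \<in> ?S \<longleftrightarrow> (\<forall>i. - 1 \<le> x $ i + t * axis a 1 $ i \<and> x $ i + t * axis a 1 $ i \<le> 1)" for x
    proof -
      have "- 1 - c \<le> y \<and> y \<le> 1 - c \<longleftrightarrow> - 1 \<le> y + c \<and> y + c \<le> 1" for y c :: real by linarith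
      then show ?thesis by (simp add: mem_box_cart)
    qed
    from * have "((\<lambda>x. f (x + t *\<^sub>R axis a 1)) has_integral I) (cube 3)"
    proof (rule has_integral_on_superset)
      show "f (x + t *\<^sub>R axis a 1) = 0" if "x \<notin> ?S" for x
        using that[unfolded S] by (intro supp) (simp add: mem_box_cart)
      have "\<bar>x $ i\<bar> \<le> 3" if "x \<in> ?S" for x i
      proof -
        have "\<bar>t * axis a 1 $ i\<bar> \<le> 1" using t by (simp add: axis_def)
        moreover have "- 1 \<le> x $ i + t * axis a 1 $ i \<and> x $ i + t * axis a 1 $ i \<le> 1"
          using that S by blast
        ultimately show ?thesis by linarith
      qed
      then show "?S \<subseteq> cube 3" by (auto simp: mem_cube)
    qed
    then show ?thesis unfolding G_def by (rule integral_unique)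
  qed
  have "(G has_vector_derivative integral (cube 3) (\<lambda>x. partial a f (x + 0 *\<^sub>R axis a 1))) (at 0 within {-1<..<1})"
    unfolding G_def
  proof (rule leibniz_rule_vector_derivative[where f="\<lambda>t x. f (x + t *\<^sub>R axis a 1)"
        and fx="\<lambda>t x. partial a f (x + t *\<^sub>R axis a 1)"])
    show "((\<lambda>t. f (x + t *\<^sub>R axis a 1)) has_vector_derivative partial a f (x + t *\<^sub>R axis a 1)) (at t within {-1<..<1})" for x t
      using has_derivative_along_axis[OF smooth_differentiable[OF f], of x a t]
      unfolding has_real_derivative_iff_has_vector_derivative by (rule has_vector_derivative_at_within)
    show "(\<lambda>x. f (x + t *\<^sub>R axis a 1)) integrable_on cube 3" for t
      by (intro integrable_continuous continuous_on_compose2[OF cont(1)[of UNIV]] continuous_on_add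
          continuous_on_const continuous_on_id) simp
    show "continuous_on ({- 1<..<1} \<times> cube 3) (\<lambda>(t, x). partial a f (x + t *\<^sub>R axis a 1))"
      unfolding split_beta
      by (intro continuous_on_compose2[OF cont(2)[of UNIV]] continuous_on_add continuous_on_scaleR
          continuous_on_const continuous_on_fst continuous_on_snd continuous_on_id) simp
  qed auto
  moreover have "(G has_vector_derivative 0) (at 0 within {-1<..<1})"
    by (rule has_vector_derivative_transform[where f="\<lambda>t. I"]) (auto intro!: const)
  ultimately have 0: "integral (cube 3) (partial a f) = 0"
    using vector_derivative_unique_at[of G _ 0 0] by (simp add: at_within_open[of 0 "{-1<..<1::real}"])
  have z: "partial a f x = 0" if "x \<notin> cube 1" for x
    using partial_eq_0_outside[OF closed_cbox supp that] by simp
  have I1: "(partial a f has_integral integral (cube 1) (partial a f)) (cube 1)"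
    by (intro integrable_integral integrable_continuous cont)
  moreover have "cube 1 \<subseteq> (cube 3 :: (real^'n) set)" by (rule cube_mono) simp
  ultimately have "(partial a f has_integral integral (cube 1) (partial a f)) (cube 3)"
    using has_integral_on_superset z by blast
  then have "integral (cube 1) (partial a f) = 0" using 0 by (simp add: integral_unique)
  then show ?thesis using I1 by simp
qed

text \<open>The second difference is symmetric in the two directions, and two applications of the mean value
  theorem express it by either of the mixed derivatives. This yields the symmetry of second derivatives.\<close>

lemma second_difference_quotient:
  fixes f :: "real^'n::finite \<Rightarrow> real"
  assumes f: "smooth f" and h: "h > 0"
  obtains \<xi> \<zeta> where "0 < \<xi>" "\<xi> < h" "0 < \<zeta>" "\<zeta> < h"
    "f (x + h *\<^sub>R axis a 1 + h *\<^sub>R axis b 1) - f (x + h *\<^sub>R axis a 1) - f (x + h *\<^sub>R axis b 1) + f x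
      = h * h * partial b (partial a f) (x + \<xi> *\<^sub>R axis a 1 + \<zeta> *\<^sub>R axis b 1)"
proof -
  note D = has_derivative_along_axis[OF smooth_differentiable]
  let ?F = "\<lambda>t. f ((x + h *\<^sub>R axis b 1) + t *\<^sub>R axis a 1) - f (x + t *\<^sub>R axis a 1)"
  have "\<exists>\<xi>>0. \<xi> < h \<and> ?F h - ?F 0 = (h - 0) * (partial a f ((x + h *\<^sub>R axis b 1) + \<xi> *\<^sub>R axis a 1) - partial a f (x + \<xi> *\<^sub>R axis a 1))"
    by (intro MVT2 h DERIV_diff D f)
  then obtain \<xi> where \<xi>: "0 < \<xi>" "\<xi> < h"
    "?F h - ?F 0 = h * (partial a f ((x + h *\<^sub>R axis b 1) + \<xi> *\<^sub>R axis a 1) - partial a f (x + \<xi> *\<^sub>R axis a 1))" by auto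
  let ?H = "\<lambda>t. partial a f ((x + \<xi> *\<^sub>R axis a 1) + t *\<^sub>R axis b 1)"
  have "\<exists>\<zeta>>0. \<zeta> < h \<and> ?H h - ?H 0 = (h - 0) * partial b (partial a f) ((x + \<xi> *\<^sub>R axis a 1) + \<zeta> *\<^sub>R axis b 1)"
    by (intro MVT2 h D smooth_partial f)
  then obtain \<zeta> where \<zeta>: "0 < \<zeta>" "\<zeta> < h"
    "?H h - ?H 0 = h * partial b (partial a f) ((x + \<xi> *\<^sub>R axis a 1) + \<zeta> *\<^sub>R axis b 1)" by auto
  show ?thesis
  proof (rule that[OF \<xi>(1,2) \<zeta>(1,2)])
    have "?F h - ?F 0 = h * (?H h - ?H 0)"
      using \<xi>(3) by (simp add: algebra_simps)
    then show "f (x + h *\<^sub>R axis a 1 + h *\<^sub>R axis b 1) - f (x + h *\<^sub>R axis a 1) - f (x + h *\<^sub>R axis b 1) + f x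
      = h * h * partial b (partial a f) (x + \<xi> *\<^sub>R axis a 1 + \<zeta> *\<^sub>R axis b 1)"
      unfolding \<zeta>(3) by (simp add: algebra_simps)
  qed
qed

lemma partial_commute:
  fixes f :: "real^'n::finite \<Rightarrow> real"
  assumes f: "smooth f"
  shows "partial a (partial b f) x = partial b (partial a f) x"
proof (rule ccontr)
  assume ne: "\<not> ?thesis"
  define e where "e = \<bar>partial a (partial b f) x - partial b (partial a f) x\<bar> / 2"
  have e: "e > 0" using ne by (simp add: e_def)
  have "continuous (at x) (partial a (partial b f))" "continuous (at x) (partial b (partial a f))"
    using smooth_continuous[OF smooth_partial[OF smooth_partial[OF f]], of UNIV]
    by (auto simp: continuous_on_eq_continuous_at)
  then obtain d1 d2 where d: "d1 > 0" "d2 > 0"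
    "\<And>y. dist y x < d1 \<Longrightarrow> dist (partial a (partial b f) y) (partial a (partial b f) x) < e"
    "\<And>y. dist y x < d2 \<Longrightarrow> dist (partial b (partial a f) y) (partial b (partial a f) x) < e"
    using e unfolding continuous_at_eps_delta by metis
  define h where "h = min d1 d2 / 2"
  have h: "h > 0" "2 * h \<le> d1" "2 * h \<le> d2" using d by (auto simp: h_def)
  have near: "dist (x + \<xi> *\<^sub>R axis i 1 + \<zeta> *\<^sub>R axis j 1) x < 2 * h"
    if "0 < \<xi>" "\<xi> < h" "0 < \<zeta>" "\<zeta> < h" for \<xi> \<zeta> and i j :: 'n
    using norm_triangle_ineq[of "\<xi> *\<^sub>R axis i (1::real)" "\<zeta> *\<^sub>R axis j 1"] that
    by (simp add: dist_norm add.assoc)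
  obtain \<xi> \<zeta> where 1: "0 < \<xi>" "\<xi> < h" "0 < \<zeta>" "\<zeta> < h"
    "f (x + h *\<^sub>R axis a 1 + h *\<^sub>R axis b 1) - f (x + h *\<^sub>R axis a 1) - f (x + h *\<^sub>R axis b 1) + f x
      = h * h * partial b (partial a f) (x + \<xi> *\<^sub>R axis a 1 + \<zeta> *\<^sub>R axis b 1)"
    using second_difference_quotient[OF f h(1)] by metis
  obtain \<xi>' \<zeta>' where 2: "0 < \<xi>'" "\<xi>' < h" "0 < \<zeta>'" "\<zeta>' < h"
    "f (x + h *\<^sub>R axis b 1 + h *\<^sub>R axis a 1) - f (x + h *\<^sub>R axis b 1) - f (x + h *\<^sub>R axis a 1) + f x
      = h * h * partial a (partial b f) (x + \<xi>' *\<^sub>R axis b 1 + \<zeta>' *\<^sub>R axis a 1)"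
    using second_difference_quotient[OF f h(1)] by metis
  have "h * h * partial b (partial a f) (x + \<xi> *\<^sub>R axis a 1 + \<zeta> *\<^sub>R axis b 1) =
        h * h * partial a (partial b f) (x + \<xi>' *\<^sub>R axis b 1 + \<zeta>' *\<^sub>R axis a 1)"
    unfolding 1(5)[symmetric] 2(5)[symmetric] by (simp add: algebra_simps)
  then have "partial b (partial a f) (x + \<xi> *\<^sub>R axis a 1 + \<zeta> *\<^sub>R axis b 1) =
        partial a (partial b f) (x + \<xi>' *\<^sub>R axis b 1 + \<zeta>' *\<^sub>R axis a 1)" using h(1) by simp
  moreover have "dist (partial a (partial b f) (x + \<xi>' *\<^sub>R axis b 1 + \<zeta>' *\<^sub>R axis a 1)) (partial a (partial b f) x) < e"
    by (rule d(3)) (use near[OF 2(1-4)] h in \<open>auto intro: less_le_trans\<close>)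
  moreover have "dist (partial b (partial a f) (x + \<xi> *\<^sub>R axis a 1 + \<zeta> *\<^sub>R axis b 1)) (partial b (partial a f) x) < e"
    by (rule d(4)) (use near[OF 1(1-4)] h in \<open>auto intro: less_le_trans\<close>)
  moreover have False if "p = q" "\<bar>q - A\<bar> < \<bar>A - C\<bar> / 2" "\<bar>p - C\<bar> < \<bar>A - C\<bar> / 2" for p q A C :: real
    using that by (auto simp: abs_if split: if_splits)
  ultimately show False unfolding e_def dist_real_def by blast
qed

subsection \<open>Minors of the derivative\<close>

text \<open>The functions are given as a family of scalar functions rather than as a map into \<open>\<real>\<^sup>m\<close>, so that a
  single one of them can be exchanged by a function update.\<close>

definition minor :: "nat \<Rightarrow> (nat \<Rightarrow> 'n) \<Rightarrow> (nat \<Rightarrow> real^'n::finite \<Rightarrow> real) \<Rightarrow> real^'n \<Rightarrow> real" where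
  "minor k \<alpha> g x = (\<Sum>\<pi> | \<pi> permutes {..<k}. of_int (sign \<pi>) * (\<Prod>j<k. partial (\<alpha> (\<pi> j)) (g j) x))"

lemma pullback_component_eq_minor:
  assumes "smooth U"
  shows "pullback_component k i \<alpha> U x = minor k \<alpha> (\<lambda>j x. U x $ i j) x"
  by (simp add: pullback_component_def minor_def partial_component smooth_differentiable[OF assms])

lemma minor_cong: "(\<And>j. j < k \<Longrightarrow> f j = g j) \<Longrightarrow> minor k \<alpha> f x = minor k \<alpha> g x"
  by (simp add: minor_def)

lemma minor_update:
  assumes "c < k"
  shows "minor k \<alpha> (g(c := f)) x =
    (\<Sum>\<pi> | \<pi> permutes {..<k}. of_int (sign \<pi>) *
      (partial (\<alpha> (\<pi> c)) f x * (\<Prod>j\<in>{..<k} - {c}. partial (\<alpha> (\<pi> j)) (g j) x)))"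
  unfolding minor_def using assms
  by (intro sum.cong refl) (auto simp: prod.remove[of "{..<k}" c] intro!: prod.cong)

lemma continuous_minor:
  assumes "\<And>j. j < k \<Longrightarrow> smooth (g j)"
  shows "continuous_on S (minor k \<alpha> g)"
  unfolding minor_def[abs_def] using assms
  by (intro continuous_intros smooth_continuous smooth_partial) auto

text \<open>The sign changes under a transposition, so a quantity that does not is cancelled.\<close>

lemma sum_permutations_swap_eq_0:
  fixes F :: "(nat \<Rightarrow> nat) \<Rightarrow> real"
  assumes "c < k" "l < k" "c \<noteq> l"
    and sym: "\<And>\<pi>. \<pi> permutes {..<k} \<Longrightarrow> F (\<pi> \<circ> Transposition.transpose c l) = F \<pi>"
  shows "(\<Sum>\<pi> | \<pi> permutes {..<k}. of_int (sign \<pi>) * F \<pi>) = 0"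
proof -
  have t: "Transposition.transpose c l permutes {..<k}" using assms by (intro permutes_swap_id) auto
  have "(\<Sum>\<pi> | \<pi> permutes {..<k}. of_int (sign \<pi>) * F \<pi>) =
      (\<Sum>\<pi> | \<pi> permutes {..<k}. of_int (sign (\<pi> \<circ> Transposition.transpose c l)) * F (\<pi> \<circ> Transposition.transpose c l))"
    by (rule sum_permutations_compose_right[OF t])
  also have "\<dots> = (\<Sum>\<pi> | \<pi> permutes {..<k}. - (of_int (sign \<pi>) * F \<pi>))"
  proof (intro sum.cong refl)
    fix \<pi> assume "\<pi> \<in> {\<pi>. \<pi> permutes {..<k}}"
    then have p: "\<pi> permutes {..<k}" by simp
    have "sign (\<pi> \<circ> Transposition.transpose c l) = - sign \<pi>"
      using assms(3) by (simp add: sign_compose permutation_permutes[THEN iffD2] sign_swap_id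
          permutes_imp_permutation[OF _ p] permutation_swap_id)
    then show "of_int (sign (\<pi> \<circ> Transposition.transpose c l)) * F (\<pi> \<circ> Transposition.transpose c l) = - (of_int (sign \<pi>) * F \<pi>)"
      by (simp add: sym[OF p])
  qed
  finally show ?thesis by (simp add: sum_negf)
qed

text \<open>The rows of the cofactor matrix of a gradient are divergence free: in the sum, the second
  derivatives of each function come in pairs that differ by a transposition.\<close>

lemma sum_partial_cofactor_eq_0:
  fixes g :: "nat \<Rightarrow> real^'n::finite \<Rightarrow> real"
  assumes c: "c < k" and g: "\<And>j. j < k \<Longrightarrow> smooth (g j)"
  shows "(\<Sum>\<pi> | \<pi> permutes {..<k}. of_int (sign \<pi>) *
    partial (\<alpha> (\<pi> c)) (\<lambda>x. \<Prod>j\<in>{..<k} - {c}. partial (\<alpha> (\<pi> j)) (g j) x) x) = 0"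
proof -
  let ?D = "\<lambda>\<pi> l. partial (\<alpha> (\<pi> c)) (partial (\<alpha> (\<pi> l)) (g l)) x *
      (\<Prod>j\<in>{..<k} - {c} - {l}. partial (\<alpha> (\<pi> j)) (g j) x)"
  have "(\<Sum>\<pi> | \<pi> permutes {..<k}. of_int (sign \<pi>) *
        partial (\<alpha> (\<pi> c)) (\<lambda>x. \<Prod>j\<in>{..<k} - {c}. partial (\<alpha> (\<pi> j)) (g j) x) x) =
      (\<Sum>\<pi> | \<pi> permutes {..<k}. \<Sum>l\<in>{..<k} - {c}. of_int (sign \<pi>) * ?D \<pi> l)"
    by (intro sum.cong refl, subst partial_prod)
       (auto simp: sum_distrib_left intro!: smooth_differentiable smooth_partial g)
  also have "\<dots> = (\<Sum>l\<in>{..<k} - {c}. \<Sum>\<pi> | \<pi> permutes {..<k}. of_int (sign \<pi>) * ?D \<pi> l)"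
    by (rule sum.swap)
  also have "\<dots> = 0"
  proof (rule sum.neutral, rule ballI)
    fix l assume l: "l \<in> {..<k} - {c}"
    show "(\<Sum>\<pi> | \<pi> permutes {..<k}. of_int (sign \<pi>) * ?D \<pi> l) = 0"
    proof (rule sum_permutations_swap_eq_0[where c=c and l=l and F="\<lambda>\<pi>. ?D \<pi> l"])
      fix \<pi> assume "\<pi> permutes {..<k}"
      have "(\<Prod>j\<in>{..<k} - {c} - {l}. partial (\<alpha> ((\<pi> \<circ> Transposition.transpose c l) j)) (g j) x) =
          (\<Prod>j\<in>{..<k} - {c} - {l}. partial (\<alpha> (\<pi> j)) (g j) x)"
        by (intro prod.cong) (auto simp: Transposition.transpose_def)
      then show "?D (\<pi> \<circ> Transposition.transpose c l) l = ?D \<pi> l"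
        using l g by (simp add: partial_commute[of "g l" "\<alpha> (\<pi> l)"])
    qed (use l c in auto)
  qed
  finally show ?thesis .
qed

text \<open>Minors of gradients are null Lagrangians. As the cofactors are divergence free, the sum
  over \<open>\<pi>\<close> of the derivatives of \<open>\<phi> (g c)\<close> times a cofactor has only the two terms in which \<open>\<phi>\<close> or \<open>g c\<close> is
  differentiated, and it integrates to zero.\<close>

lemma integral_minor_by_parts:
  fixes g :: "nat \<Rightarrow> real^'n::finite \<Rightarrow> real"
  assumes c: "c < k" and g: "\<And>j. j < k \<Longrightarrow> smooth (g j)" and \<phi>: "test_function \<phi>"
  shows "integral (cube 1) (\<lambda>x. \<phi> x * minor k \<alpha> g x) =
      - integral (cube 1) (\<lambda>x. g c x * minor k \<alpha> (g(c := \<phi>)) x)"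
proof -
  let ?P = "{\<pi>. \<pi> permutes {..<k}}"
  define R where "R \<pi> x = (\<Prod>j\<in>{..<k} - {c}. partial (\<alpha> (\<pi> j)) (g j) x)" for \<pi> x
  note s\<phi> = test_function_smooth[OF \<phi>]
  have sR: "smooth (R \<pi>)" for \<pi>
    unfolding R_def[abs_def] using g by (intro smooth_prod smooth_partial) auto
  have sg: "smooth (g c)" using g c by simp
  have s: "smooth (\<lambda>x. \<phi> x * (g c x * R \<pi> x))" for \<pi>
    by (intro smooth_mult s\<phi> sg sR)
  have 0: "((\<lambda>x. \<Sum>\<pi>\<in>?P. of_int (sign \<pi>) * partial (\<alpha> (\<pi> c)) (\<lambda>x. \<phi> x * (g c x * R \<pi> x)) x)
      has_integral (\<Sum>\<pi>\<in>?P. of_int (sign \<pi>) * 0)) (cube 1)"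
  proof (intro has_integral_sum has_integral_mult_right has_integral_partial_0 s)
    fix x :: "real^'n" and \<pi> assume "x \<notin> cube 1"
    then have "x \<notin> ball 0 1" using cball_subset_cube[of 1] ball_subset_cball by blast
    then show "\<phi> x * (g c x * R \<pi> x) = 0" using test_function_eq_0[OF \<phi>] by simp
  qed (simp add: finite_permutations)
  have "(\<Sum>\<pi>\<in>?P. of_int (sign \<pi>) * partial (\<alpha> (\<pi> c)) (\<lambda>x. \<phi> x * (g c x * R \<pi> x)) x) =
      \<phi> x * minor k \<alpha> g x + g c x * minor k \<alpha> (g(c := \<phi>)) x" for x
  proof -
    have "partial a (\<lambda>x. \<phi> x * (g c x * R \<pi> x)) x =
        \<phi> x * (partial a (g c) x * R \<pi> x) + g c x * (partial a \<phi> x * R \<pi> x) + \<phi> x * g c x * partial a (R \<pi>) x" for a \<pi>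
      by (subst partial_mult, (intro smooth_differentiable s\<phi> smooth_mult sg sR)+,
          subst partial_mult, (intro smooth_differentiable sg sR)+) (simp add: algebra_simps)
    then have "(\<Sum>\<pi>\<in>?P. of_int (sign \<pi>) * partial (\<alpha> (\<pi> c)) (\<lambda>x. \<phi> x * (g c x * R \<pi> x)) x) =
        \<phi> x * (\<Sum>\<pi>\<in>?P. of_int (sign \<pi>) * (partial (\<alpha> (\<pi> c)) (g c) x * R \<pi> x)) +
        g c x * (\<Sum>\<pi>\<in>?P. of_int (sign \<pi>) * (partial (\<alpha> (\<pi> c)) \<phi> x * R \<pi> x)) +
        \<phi> x * g c x * (\<Sum>\<pi>\<in>?P. of_int (sign \<pi>) * partial (\<alpha> (\<pi> c)) (R \<pi>) x)"
      by (simp add: sum_distrib_left sum.distrib algebra_simps)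
    moreover have "(\<Sum>\<pi>\<in>?P. of_int (sign \<pi>) * partial (\<alpha> (\<pi> c)) (R \<pi>) x) = 0"
      unfolding R_def[abs_def] by (rule sum_partial_cofactor_eq_0[OF c g])
    moreover have "(\<Sum>\<pi>\<in>?P. of_int (sign \<pi>) * (partial (\<alpha> (\<pi> c)) \<phi> x * R \<pi> x)) = minor k \<alpha> (g(c := \<phi>)) x"
      unfolding R_def by (rule minor_update[OF c, symmetric])
    moreover have "(\<Sum>\<pi>\<in>?P. of_int (sign \<pi>) * (partial (\<alpha> (\<pi> c)) (g c) x * R \<pi> x)) = minor k \<alpha> g x"
      using minor_update[OF c, of \<alpha> g "g c" x] by (simp add: R_def)
    ultimately show ?thesis by (simp only: mult_zero_right add_0_right)
  qed
  with 0 have "((\<lambda>x. \<phi> x * minor k \<alpha> g x + g c x * minor k \<alpha> (g(c := \<phi>)) x) has_integral 0) (cube 1)" by simp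
  then have "integral (cube 1) (\<lambda>x. \<phi> x * minor k \<alpha> g x + g c x * minor k \<alpha> (g(c := \<phi>)) x) = 0"
    by (rule integral_unique)
  moreover have "continuous_on (cube 1) (\<lambda>x. \<phi> x * minor k \<alpha> g x)"
    by (intro continuous_on_mult smooth_continuous[OF s\<phi>] continuous_minor g)
  moreover have "continuous_on (cube 1) (\<lambda>x. g c x * minor k \<alpha> (g(c := \<phi>)) x)"
    by (intro continuous_on_mult smooth_continuous[OF sg] continuous_minor) (simp add: s\<phi> g)
  ultimately show ?thesis
    using integral_add[of "\<lambda>x. \<phi> x * minor k \<alpha> g x" "cube 1" "\<lambda>x. g c x * minor k \<alpha> (g(c := \<phi>)) x"]
    by (simp add: integrable_continuous)
qed

subsection \<open>Algebraic properties of minors\<close>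

lemma minor_diff_slot:
  assumes "c < k" "f differentiable (at x)" "h differentiable (at x)"
  shows "minor k \<alpha> (g(c := f)) x - minor k \<alpha> (g(c := h)) x = minor k \<alpha> (g(c := (\<lambda>x. f x - h x))) x"
  using assms by (simp add: minor_update partial_diff sum_subtractf[symmetric] algebra_simps)

text \<open>The intermediate families when the functions \<open>f\<close> are replaced by the functions \<open>g\<close> one slot at a
  time, beginning with slot \<open>0\<close>.\<close>

definition hybrid :: "nat \<Rightarrow> (nat \<Rightarrow> 'a) \<Rightarrow> (nat \<Rightarrow> 'a) \<Rightarrow> nat \<Rightarrow> 'a" where
  "hybrid c f g j = (if j < c then g j else f j)"

lemma minor_telescope:
  assumes f: "\<And>j. j < k \<Longrightarrow> smooth (f j)" and g: "\<And>j. j < k \<Longrightarrow> smooth (g j)"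
  shows "minor k \<alpha> f x - minor k \<alpha> g x = (\<Sum>c<k. minor k \<alpha> ((hybrid c f g)(c := (\<lambda>x. f c x - g c x))) x)"
proof -
  have "minor k \<alpha> (hybrid c f g) x - minor k \<alpha> (hybrid (Suc c) f g) x =
      minor k \<alpha> ((hybrid c f g)(c := (\<lambda>x. f c x - g c x))) x" if "c < k" for c
  proof -
    have "hybrid c f g = (hybrid c f g)(c := f c)" "hybrid (Suc c) f g = (hybrid c f g)(c := g c)"
      by (auto simp: hybrid_def fun_eq_iff)
    then have "minor k \<alpha> (hybrid c f g) x - minor k \<alpha> (hybrid (Suc c) f g) x =
        minor k \<alpha> ((hybrid c f g)(c := f c)) x - minor k \<alpha> ((hybrid c f g)(c := g c)) x" by simp
    also have "\<dots> = minor k \<alpha> ((hybrid c f g)(c := (\<lambda>x. f c x - g c x))) x"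
      using f g that by (intro minor_diff_slot smooth_differentiable) auto
    finally show ?thesis .
  qed
  then have "(\<Sum>c<k. minor k \<alpha> ((hybrid c f g)(c := (\<lambda>x. f c x - g c x))) x) =
      (\<Sum>c<k. minor k \<alpha> (hybrid c f g) x - minor k \<alpha> (hybrid (Suc c) f g) x)"
    by (intro sum.cong) auto
  also have "\<dots> = minor k \<alpha> (hybrid 0 f g) x - minor k \<alpha> (hybrid k f g) x"
    by (rule sum_lessThan_telescope')
  also have "\<dots> = minor k \<alpha> f x - minor k \<alpha> g x"
    by (intro arg_cong2[of _ _ _ _ "(-)"] minor_cong) (auto simp: hybrid_def)
  finally show ?thesis by simp
qed

text \<open>Integration by parts in the slot that is being replaced removes the derivative from the difference of
  the functions; this is what makes differences small in the uniform norm useful.\<close>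

lemma integral_minor_diff:
  fixes f g :: "nat \<Rightarrow> real^'n::finite \<Rightarrow> real"
  assumes f: "\<And>j. j < k \<Longrightarrow> smooth (f j)" and g: "\<And>j. j < k \<Longrightarrow> smooth (g j)" and \<phi>: "test_function \<phi>"
  shows "integral (cube 1) (\<lambda>x. \<phi> x * minor k \<alpha> f x) - integral (cube 1) (\<lambda>x. \<phi> x * minor k \<alpha> g x) =
    - (\<Sum>c<k. integral (cube 1) (\<lambda>x. (f c x - g c x) * minor k \<alpha> ((hybrid c f g)(c := \<phi>)) x))"
proof -
  note s\<phi> = test_function_smooth[OF \<phi>]
  let ?h = "\<lambda>c. (hybrid c f g)(c := (\<lambda>x. f c x - g c x))"
  have h: "smooth (?h c j)" if "c < k" "j < k" for c j
    using that f g by (auto simp: hybrid_def intro!: smooth_diff)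
  have "integral (cube 1) (\<lambda>x. \<phi> x * minor k \<alpha> f x) - integral (cube 1) (\<lambda>x. \<phi> x * minor k \<alpha> g x) =
      integral (cube 1) (\<lambda>x. \<phi> x * minor k \<alpha> f x - \<phi> x * minor k \<alpha> g x)"
    using f g by (intro integral_diff[symmetric] integrable_continuous continuous_on_mult continuous_minor
        smooth_continuous s\<phi>) auto
  also have "\<dots> = integral (cube 1) (\<lambda>x. \<Sum>c<k. \<phi> x * minor k \<alpha> (?h c) x)"
    by (simp add: minor_telescope[OF f g] right_diff_distrib[symmetric] sum_distrib_left)
  also have "\<dots> = (\<Sum>c<k. integral (cube 1) (\<lambda>x. \<phi> x * minor k \<alpha> (?h c) x))"
    using h by (intro integral_sum integrable_continuous continuous_on_mult continuous_minor
        smooth_continuous s\<phi>) auto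
  also have "\<dots> = (\<Sum>c<k. - integral (cube 1) (\<lambda>x. (f c x - g c x) * minor k \<alpha> ((hybrid c f g)(c := \<phi>)) x))"
  proof (intro sum.cong refl)
    fix c assume c: "c \<in> {..<k}"
    show "integral (cube 1) (\<lambda>x. \<phi> x * minor k \<alpha> (?h c) x) =
        - integral (cube 1) (\<lambda>x. (f c x - g c x) * minor k \<alpha> ((hybrid c f g)(c := \<phi>)) x)"
      using integral_minor_by_parts[of c k "?h c" \<phi> \<alpha>] h \<phi> c by simp
  qed
  finally show ?thesis by (simp add: sum_negf)
qed

lemma minor_reindex:
  assumes "\<tau> permutes {..<k}"
  shows "minor k \<alpha> (g \<circ> \<tau>) x = of_int (sign \<tau>) * minor k \<alpha> g x"
proof -
  have pt: "permutation \<tau>" using assms permutation_permutes by blast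
  have "minor k \<alpha> (g \<circ> \<tau>) x =
      (\<Sum>\<pi> | \<pi> permutes {..<k}. of_int (sign (\<pi> \<circ> \<tau>)) * (\<Prod>j<k. partial (\<alpha> ((\<pi> \<circ> \<tau>) j)) ((g \<circ> \<tau>) j) x))"
    unfolding minor_def by (rule sum_permutations_compose_right[OF assms])
  also have "\<dots> = (\<Sum>\<pi> | \<pi> permutes {..<k}. of_int (sign \<tau>) * (of_int (sign \<pi>) * (\<Prod>j<k. partial (\<alpha> (\<pi> j)) (g j) x)))"
  proof (intro sum.cong refl)
    fix \<pi> assume "\<pi> \<in> {\<pi>. \<pi> permutes {..<k}}"
    then have "permutation \<pi>" using permutation_permutes by blast
    moreover have "(\<Prod>j<k. partial (\<alpha> ((\<pi> \<circ> \<tau>) j)) ((g \<circ> \<tau>) j) x) = (\<Prod>j<k. partial (\<alpha> (\<pi> j)) (g j) x)"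
      using prod.permute[OF assms, of "\<lambda>j. partial (\<alpha> (\<pi> j)) (g j) x"] by (simp add: o_def)
    ultimately show "of_int (sign (\<pi> \<circ> \<tau>)) * (\<Prod>j<k. partial (\<alpha> ((\<pi> \<circ> \<tau>) j)) ((g \<circ> \<tau>) j) x) =
        of_int (sign \<tau>) * (of_int (sign \<pi>) * (\<Prod>j<k. partial (\<alpha> (\<pi> j)) (g j) x))"
      by (simp add: sign_compose pt mult_ac)
  qed
  finally show ?thesis by (simp add: minor_def sum_distrib_left)
qed

lemma minor_eq_0:
  assumes "c < k" "l < k" "c \<noteq> l" "g c = g l"
  shows "minor k \<alpha> g x = 0"
proof -
  have "Transposition.transpose c l permutes {..<k}" using assms by (intro permutes_swap_id) auto
  moreover have "g \<circ> Transposition.transpose c l = g" using assms(4) by (auto simp: fun_eq_iff Transposition.transpose_def)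
  ultimately have "minor k \<alpha> g x = - minor k \<alpha> g x"
    using minor_reindex[of "Transposition.transpose c l" k \<alpha> g x] assms(3) by (simp add: sign_swap_id)
  then show ?thesis by simp
qed

text \<open>The Cauchy--Binet formula before sorting: the chain rule for each gradient, multiplied out. Each set of
  \<open>k\<close> indices occurs in the sum with all its rearrangements.\<close>

lemma minor_compose:
  fixes U :: "real^'n::finite \<Rightarrow> real^'m::finite"
  assumes Q: "\<And>j. j < k \<Longrightarrow> smooth (Q j)" and U: "smooth U"
  shows "minor k \<alpha> (\<lambda>j x. Q j (U x)) x =
    (\<Sum>i\<in>{..<k} \<rightarrow>\<^sub>E UNIV. (\<Prod>j<k. partial (i j) (Q j) (U x)) * minor k \<alpha> (\<lambda>j x. U x $ i j) x)"
proof -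
  have "(\<Prod>j<k. partial (\<alpha> (\<pi> j)) (\<lambda>x. Q j (U x)) x) =
      (\<Sum>i\<in>{..<k} \<rightarrow>\<^sub>E UNIV. (\<Prod>j<k. partial (i j) (Q j) (U x)) * (\<Prod>j<k. partial (\<alpha> (\<pi> j)) (\<lambda>x. U x $ i j) x))" for \<pi>
  proof -
    have "(\<Prod>j<k. partial (\<alpha> (\<pi> j)) (\<lambda>x. Q j (U x)) x) =
        (\<Prod>j<k. \<Sum>i\<in>UNIV. partial i (Q j) (U x) * partial (\<alpha> (\<pi> j)) (\<lambda>x. U x $ i) x)"
      using Q U by (intro prod.cong refl partial_chain smooth_differentiable) auto
    also have "\<dots> = (\<Sum>i\<in>{..<k} \<rightarrow>\<^sub>E UNIV. \<Prod>j<k. partial (i j) (Q j) (U x) * partial (\<alpha> (\<pi> j)) (\<lambda>x. U x $ i j) x)"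
      by (rule prod_sum_PiE) auto
    finally show ?thesis by (simp add: prod.distrib)
  qed
  then have "minor k \<alpha> (\<lambda>j x. Q j (U x)) x =
      (\<Sum>\<pi> | \<pi> permutes {..<k}. \<Sum>i\<in>{..<k} \<rightarrow>\<^sub>E UNIV. (\<Prod>j<k. partial (i j) (Q j) (U x)) *
        (of_int (sign \<pi>) * (\<Prod>j<k. partial (\<alpha> (\<pi> j)) (\<lambda>x. U x $ i j) x)))"
    by (simp add: minor_def sum_distrib_left mult.left_commute)
  also have "\<dots> = (\<Sum>i\<in>{..<k} \<rightarrow>\<^sub>E UNIV. \<Sum>\<pi> | \<pi> permutes {..<k}. (\<Prod>j<k. partial (i j) (Q j) (U x)) *
        (of_int (sign \<pi>) * (\<Prod>j<k. partial (\<alpha> (\<pi> j)) (\<lambda>x. U x $ i j) x)))"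
    by (rule sum.swap)
  finally show ?thesis
    by (simp add: minor_def sum_distrib_left)
qed

lemma abs_minor_le:
  assumes "c < k" "\<And>a. \<bar>partial a f x\<bar> \<le> A" "\<And>j a. j < k \<Longrightarrow> \<bar>partial a (g j) x\<bar> \<le> B"
  shows "\<bar>minor k \<alpha> (g(c := f)) x\<bar> \<le> fact k * (A * B ^ (k - 1))"
proof -
  have A: "A \<ge> 0" using assms(2)[of undefined] abs_ge_zero order_trans by blast
  have "\<bar>minor k \<alpha> (g(c := f)) x\<bar> \<le> (\<Sum>\<pi> | \<pi> permutes {..<k}. A * B ^ (k - 1))"
    unfolding minor_update[OF assms(1)]
  proof (intro order_trans[OF sum_abs] sum_mono)
    fix \<pi> :: "nat \<Rightarrow> nat"
    have "(\<Prod>j\<in>{..<k} - {c}. \<bar>partial (\<alpha> (\<pi> j)) (g j) x\<bar>) \<le> (\<Prod>j\<in>{..<k} - {c}. B)"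
      using assms(3) by (intro prod_mono) auto
    then have "(\<Prod>j\<in>{..<k} - {c}. \<bar>partial (\<alpha> (\<pi> j)) (g j) x\<bar>) \<le> B ^ (k - 1)"
      using assms(1) by simp
    then have "\<bar>partial (\<alpha> (\<pi> c)) f x\<bar> * (\<Prod>j\<in>{..<k} - {c}. \<bar>partial (\<alpha> (\<pi> j)) (g j) x\<bar>) \<le> A * B ^ (k - 1)"
      by (intro mult_mono assms(2) A prod_nonneg) auto
    then show "\<bar>of_int (sign \<pi>) * (partial (\<alpha> (\<pi> c)) f x * (\<Prod>j\<in>{..<k} - {c}. partial (\<alpha> (\<pi> j)) (g j) x))\<bar>
        \<le> A * B ^ (k - 1)"
      by (simp add: abs_mult abs_prod sign_def)
  qed
  also have "\<dots> = fact k * (A * B ^ (k - 1))"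
    using card_permutations[of "{..<k}" k] by simp
  finally show ?thesis .
qed

section \<open>Mollification of Hoelder functions\<close>

subsection \<open>Convolution with a smooth kernel\<close>

text \<open>The integral is taken over a fixed box, for any \<open>x\<close>. This makes differentiation under the integral sign
  a matter of continuous functions on compact sets; it is a convolution near those \<open>x\<close> for which the
  support of \<open>K (x - \<cdot>)\<close> is contained in the box.\<close>

lemma has_derivative_convolution:
  fixes K f :: "real^'n::finite \<Rightarrow> real"
  assumes K: "Ck (Suc m) K" and f: "continuous_on UNIV f"
  shows "((\<lambda>x. integral (cbox c d) (\<lambda>y. K (x - y) * f y)) has_derivative
    (\<lambda>h. \<Sum>a\<in>UNIV. h $ a * integral (cbox c d) (\<lambda>y. partial a K (x - y) * f y))) (at x)"
proof -
  define L :: "'n \<Rightarrow> (real^'n) \<Rightarrow>\<^sub>L real" where "L a = Blinfun (\<lambda>h. h $ a)" for a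
  have L: "blinfun_apply (L a) h = h $ a" for a h
    by (simp add: L_def bounded_linear_Blinfun_apply bounded_linear_vec_nth)
  define D where "D x y = (\<Sum>a\<in>UNIV. (partial a K (x - y) * f y) *\<^sub>R L a)" for x y
  have contK: "continuous_on UNIV K" and contP: "continuous_on UNIV (partial a K)" for a
    using K by (auto intro: Ck_continuous differentiable_imp_continuous_on)
  have cont: "continuous_on (cbox c d) (\<lambda>y. partial a K (x - y) * f y)" for x a
    by (intro continuous_on_mult continuous_on_compose2[OF contP] continuous_on_subset[OF f]
        continuous_on_diff continuous_on_const continuous_on_id) auto
  have "((\<lambda>x. integral (cbox c d) (\<lambda>y. K (x - y) * f y)) has_derivative
      blinfun_apply (integral (cbox c d) (D x))) (at x within UNIV)"
  proof (rule leibniz_rule[where f="\<lambda>x y. K (x - y) * f y" and fx=D])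
    fix x y :: "real^'n"
    have "((\<lambda>x. x - y) has_derivative (\<lambda>h. h)) (at x)" by (auto intro!: derivative_eq_intros)
    from has_derivative_compose[where g=K and f="\<lambda>x. x - y",
        OF this has_derivative_frechet_derivative[OF Ck_differentiable[OF K, of "x - y"]]]
    have "((\<lambda>x. K (x - y)) has_derivative frechet_derivative K (at (x - y))) (at x)" .
    then have "((\<lambda>x. K (x - y) * f y) has_derivative (\<lambda>h. frechet_derivative K (at (x - y)) h * f y)) (at x)"
      by (rule has_derivative_mult_left)
    moreover have "frechet_derivative K (at (x - y)) h * f y = blinfun_apply (D x y) h" for h
      by (subst derivative_eq_sum_partial[OF Ck_differentiable[OF K]])
         (simp add: D_def L blinfun.sum_left blinfun.scaleR_left sum_distrib_left mult_ac)
    ultimately show "((\<lambda>x. K (x - y) * f y) has_derivative blinfun_apply (D x y)) (at x within UNIV)"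
      by simp
  next
    show "(\<lambda>y. K (x - y) * f y) integrable_on cbox c d" for x
      by (intro integrable_continuous continuous_on_mult continuous_on_compose2[OF contK] continuous_on_subset[OF f]
        continuous_on_diff continuous_on_const continuous_on_id) auto
    show "continuous_on (UNIV \<times> cbox c d) (\<lambda>(x, y). D x y)"
      unfolding D_def split_beta
      by (intro continuous_on_sum continuous_on_scaleR continuous_on_mult continuous_on_compose2[OF contP]
          continuous_on_compose2[OF f] continuous_on_diff continuous_on_fst continuous_on_snd
          continuous_on_const continuous_on_id) auto
  qed auto
  moreover have "blinfun_apply (integral (cbox c d) (D x)) h =
      (\<Sum>a\<in>UNIV. h $ a * integral (cbox c d) (\<lambda>y. partial a K (x - y) * f y))" for h
  proof -
    have "D x integrable_on cbox c d"
      unfolding D_def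
      by (intro integrable_continuous continuous_on_sum continuous_on_scaleR cont continuous_on_const)
    then have "blinfun_apply (integral (cbox c d) (D x)) h = integral (cbox c d) (\<lambda>y. blinfun_apply (D x y) h)"
      by (rule blinfun_apply_integral)
    also have "\<dots> = integral (cbox c d) (\<lambda>y. \<Sum>a\<in>UNIV. (partial a K (x - y) * f y) * h $ a)"
      by (simp add: D_def L blinfun.sum_left blinfun.scaleR_left)
    also have "\<dots> = (\<Sum>a\<in>UNIV. integral (cbox c d) (\<lambda>y. (partial a K (x - y) * f y) * h $ a))"
      by (intro integral_sum integrable_continuous continuous_on_mult_right cont) auto
    finally show ?thesis by (simp add: mult.commute)
  qed
  ultimately show ?thesis
    by - (erule has_derivative_eq_rhs, rule ext, simp)
qed

lemma partial_convolution:
  fixes K f :: "real^'n::finite \<Rightarrow> real"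
  assumes "Ck (Suc m) K" "continuous_on UNIV f"
  shows "partial a (\<lambda>x. integral (cbox c d) (\<lambda>y. K (x - y) * f y)) x =
    integral (cbox c d) (\<lambda>y. partial a K (x - y) * f y)"
proof -
  have "(\<Sum>i\<in>UNIV. axis a 1 $ i * J i) = J a" for J :: "'n \<Rightarrow> real"
    by (subst sum.remove[of _ a]) (auto simp: axis_def intro!: sum.neutral)
  then show ?thesis by (simp add: partial_eqI[OF has_derivative_convolution[OF assms]])
qed

lemma Ck_convolution:
  fixes K f :: "real^'n::finite \<Rightarrow> real"
  assumes f: "continuous_on UNIV f"
  shows "Ck (Suc m) K \<Longrightarrow> Ck m (\<lambda>x. integral (cbox c d) (\<lambda>y. K (x - y) * f y))"
proof (induction m arbitrary: K)
  case 0
  show ?case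
    using has_derivative_continuous[OF has_derivative_convolution[OF 0 f]]
    by (simp add: continuous_on_eq_continuous_at)
next
  case (Suc m)
  show ?case
  proof (rule Ck_SucI)
    show "(\<lambda>x. integral (cbox c d) (\<lambda>y. K (x - y) * f y)) differentiable at x" for x
      by (rule differentiableI[OF has_derivative_convolution[OF Suc.prems f]])
    show "Ck m (\<lambda>x. integral (cbox c d) (\<lambda>y. partial a K (x - y) * f y))" for a
      using Suc.prems by (intro Suc.IH) (metis Ck.simps(2))
  qed (rule partial_convolution[OF Suc.prems f])
qed

lemma smooth_convolution:
  fixes K f :: "real^'n::finite \<Rightarrow> real"
  assumes "continuous_on UNIV f" "smooth K"
  shows "smooth (\<lambda>x. integral (cbox c d) (\<lambda>y. K (x - y) * f y))"
  using assms by (simp add: smooth_def Ck_convolution del: Ck.simps)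

text \<open>For \<open>x\<close> in \<open>cube 1\<close> the rescaled kernel is supported in \<open>cube 2\<close>, well inside the box of integration, and the
  substitution \<open>y = x - \<epsilon> z\<close> shows at which points \<open>f\<close> is evaluated.\<close>

lemma convolution_rescale:
  fixes K f :: "real^'n::finite \<Rightarrow> real"
  assumes K: "continuous_on UNIV K" "\<And>z. z \<notin> cube 1 \<Longrightarrow> K z = 0" and f: "continuous_on UNIV f"
    and \<epsilon>: "0 < \<epsilon>" "\<epsilon> \<le> 1" and x: "x \<in> cube 1"
  shows "integral (cube 3) (\<lambda>y. K ((1 / \<epsilon>) *\<^sub>R (x - y)) * f y) =
    \<epsilon> ^ CARD('n) * integral (cube 1) (\<lambda>z. K z * f (x - \<epsilon> *\<^sub>R z))"
proof -
  let ?S = "(\<lambda>z. x - \<epsilon> *\<^sub>R z) ` cube 1"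
  have "((\<lambda>z. K z * f (x - \<epsilon> *\<^sub>R z)) has_integral integral (cube 1) (\<lambda>z. K z * f (x - \<epsilon> *\<^sub>R z))) (cube 1)"
    by (intro integrable_integral integrable_continuous continuous_on_mult continuous_on_subset[OF K(1)]
        continuous_on_compose2[OF f] continuous_on_diff continuous_on_scaleR continuous_on_const continuous_on_id) auto
  from has_integral_affinity[OF this, where m="- (1 / \<epsilon>)" and c="(1 / \<epsilon>) *\<^sub>R x"]
  have "((\<lambda>y. K ((1 / \<epsilon>) *\<^sub>R (x - y)) * f y) has_integral
      \<epsilon> ^ CARD('n) * integral (cube 1) (\<lambda>z. K z * f (x - \<epsilon> *\<^sub>R z))) ?S"
    using \<epsilon> by (simp add: algebra_simps power_one_over)
  then have "((\<lambda>y. K ((1 / \<epsilon>) *\<^sub>R (x - y)) * f y) has_integral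
      \<epsilon> ^ CARD('n) * integral (cube 1) (\<lambda>z. K z * f (x - \<epsilon> *\<^sub>R z))) (cube 3)"
  proof (rule has_integral_on_superset)
    fix y assume y: "y \<notin> ?S"
    have "(1 / \<epsilon>) *\<^sub>R (x - y) \<notin> cube 1"
    proof
      assume "(1 / \<epsilon>) *\<^sub>R (x - y) \<in> cube 1"
      then have "x - \<epsilon> *\<^sub>R ((1 / \<epsilon>) *\<^sub>R (x - y)) \<in> ?S" by (rule imageI)
      then show False using y \<epsilon> by simp
    qed
    from K(2)[OF this] show "K ((1 / \<epsilon>) *\<^sub>R (x - y)) * f y = 0" by simp
  next
    have "\<bar>x $ i - \<epsilon> * z $ i\<bar> \<le> 3" if "z \<in> cube 1" for z i
    proof -
      have "\<bar>x $ i\<bar> \<le> 1" "\<bar>z $ i\<bar> \<le> 1" using that x mem_cube by blast+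
      moreover from this have "\<epsilon> * \<bar>z $ i\<bar> \<le> 1 * 1" using \<epsilon> by (intro mult_mono) auto
      ultimately show ?thesis using abs_triangle_ineq4[of "x $ i" "\<epsilon> * z $ i"] \<epsilon> by (simp add: abs_mult)
    qed
    then show "?S \<subseteq> cube 3" by (auto simp only: mem_cube vector_minus_component vector_scaleR_component real_scaleR_def)
  qed
  then show ?thesis by (rule integral_unique)
qed

subsection \<open>Mollification\<close>

abbreviation (input) mollifier :: "real^'n::finite \<Rightarrow> real" where
  "mollifier \<equiv> bump 2"

lemma mollifier_support: "z \<notin> cube 1 \<Longrightarrow> mollifier z = 0"
proof -
  assume "z \<notin> cube 1"
  then obtain i where "1 < \<bar>z $ i\<bar>" unfolding mem_cube by (auto simp: not_le)
  then show ?thesis by (intro bump_eq_0[of 2 z i]) (simp add: abs_mult)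
qed

lemma integral_mollifier_pos: "integral (cube 1) (mollifier :: real^'n::finite \<Rightarrow> real) > 0"
proof -
  have c: "continuous_on (cube 1) (mollifier :: real^'n \<Rightarrow> real)"
    by (rule smooth_continuous[OF smooth_bump])
  have i: "(mollifier has_integral integral (cube 1) (mollifier :: real^'n \<Rightarrow> real)) (cube 1 :: (real^'n) set)"
    by (intro integrable_integral integrable_continuous c)
  have "integral (cube 1) (mollifier :: real^'n \<Rightarrow> real) \<ge> 0"
    by (intro integral_nonneg integrable_continuous c bump_nonneg)
  moreover have "integral (cube 1) (mollifier :: real^'n \<Rightarrow> real) \<noteq> 0"
  proof
    assume "integral (cube 1) (mollifier :: real^'n \<Rightarrow> real) = 0"
    then have "(mollifier has_integral 0) (cube 1 :: (real^'n) set)" using i by simp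
    moreover have "(0 :: real^'n) \<in> box (vec (- 1)) (vec 1)" by (simp add: mem_box_cart)
    ultimately have "mollifier (0 :: real^'n) = 0"
      using has_integral_0_cbox_imp_0[OF c bump_nonneg] box_subset_cbox by blast
    then show False by (simp add: bump_eq_1)
  qed
  ultimately show ?thesis by simp
qed

definition mollify :: "real \<Rightarrow> (real^'n::finite \<Rightarrow> real) \<Rightarrow> real^'n \<Rightarrow> real" where
  "mollify \<epsilon> f x = integral (cube 3) (\<lambda>y. mollifier ((1 / \<epsilon>) *\<^sub>R (x - y)) * f y) /
     (\<epsilon> ^ CARD('n) * integral (cube 1) (mollifier :: real^'n \<Rightarrow> real))"

lemma smooth_bump_scaled: "smooth (\<lambda>z::real^'n::finite. bump l (c *\<^sub>R z))"
  by (intro smooth_compose[OF smooth_bump] smooth_bounded_linear bounded_linear_scaleR_right)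

lemma partial_bump_scaled: "partial a (\<lambda>z::real^'n::finite. bump l (c *\<^sub>R z)) z = c * partial a (bump l) (c *\<^sub>R z)"
proof -
  let ?D = "frechet_derivative (bump l) (at (c *\<^sub>R z))"
  have d: "bump l differentiable at (c *\<^sub>R z)" by (intro smooth_differentiable smooth_bump)
  have "((\<lambda>z. bump l (c *\<^sub>R z)) has_derivative (\<lambda>h. ?D (c *\<^sub>R h))) (at z)"
    by (rule has_derivative_compose[where f="\<lambda>z. c *\<^sub>R z", OF _ has_derivative_frechet_derivative[OF d]])
       (auto intro!: derivative_eq_intros)
  then show ?thesis
    by (subst partial_eqI, assumption) (simp add: partial_def linear_cmul[OF linear_frechet_derivative[OF d]])
qed

lemma
  fixes f :: "real^'n::finite \<Rightarrow> real"
  assumes f: "continuous_on UNIV f"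
  shows smooth_mollify: "smooth (mollify \<epsilon> f)"
    and partial_mollify: "partial a (mollify \<epsilon> f) x =
      integral (cube 3) (\<lambda>y. partial a mollifier ((1 / \<epsilon>) *\<^sub>R (x - y)) * f y) /
      (\<epsilon> ^ Suc (CARD('n)) * integral (cube 1) (mollifier :: real^'n \<Rightarrow> real))"
proof -
  define I where "I = \<epsilon> ^ CARD('n) * integral (cube 1) (mollifier :: real^'n \<Rightarrow> real)"
  let ?c = "\<lambda>x. integral (cube 3) (\<lambda>y. mollifier ((1 / \<epsilon>) *\<^sub>R (x - y)) * f y)"
  have s: "smooth ?c"
    by (rule smooth_convolution[OF f smooth_bump_scaled])
  have eq: "mollify \<epsilon> f = (\<lambda>x. (1 / I) * ?c x)"
    by (simp add: fun_eq_iff mollify_def I_def)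
  show "smooth (mollify \<epsilon> f)"
    unfolding eq by (intro smooth_mult smooth_const s)
  have "partial a (mollify \<epsilon> f) x = (1 / I) * partial a ?c x"
    unfolding eq by (subst partial_mult) (auto intro: smooth_differentiable s)
  also have "partial a ?c x = integral (cube 3) (\<lambda>y. partial a (\<lambda>z. mollifier ((1 / \<epsilon>) *\<^sub>R z)) (x - y) * f y)"
    by (rule partial_convolution[OF smooth_Ck[OF smooth_bump_scaled] f])
  also have "\<dots> = integral (cube 3) (\<lambda>y. (1 / \<epsilon>) * (partial a mollifier ((1 / \<epsilon>) *\<^sub>R (x - y)) * f y))"
    by (simp only: partial_bump_scaled mult.assoc)
  also have "\<dots> = (1 / \<epsilon>) * integral (cube 3) (\<lambda>y. partial a mollifier ((1 / \<epsilon>) *\<^sub>R (x - y)) * f y)"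
    by (rule integral_mult_right)
  finally show "partial a (mollify \<epsilon> f) x =
      integral (cube 3) (\<lambda>y. partial a mollifier ((1 / \<epsilon>) *\<^sub>R (x - y)) * f y) /
      (\<epsilon> ^ Suc (CARD('n)) * integral (cube 1) (mollifier :: real^'n \<Rightarrow> real))"
    by (simp add: I_def)
qed

lemma holder_continuous:
  fixes f :: "'a::metric_space \<Rightarrow> 'b::metric_space"
  assumes f: "\<And>x y. dist (f x) (f y) \<le> C * dist x y powr s" and s: "s > 0"
  shows "continuous_on UNIV f"
proof (unfold continuous_on_def, intro ballI)
  fix x :: 'a
  have "((\<lambda>y. C * dist y x powr s) \<longlongrightarrow> C * dist x x powr s) (at x)"
    using s by (intro tendsto_mult tendsto_const tendsto_powr' tendsto_dist tendsto_ident_at) auto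
  then have "((\<lambda>y. C * dist y x powr s) \<longlongrightarrow> 0) (at x)" by simp
  then have "((\<lambda>y. dist (f y) (f x)) \<longlongrightarrow> 0) (at x)"
    by (rule Lim_null_comparison[rotated]) (simp add: f)
  then show "(f \<longlongrightarrow> f x) (at x within UNIV)" by (rule iffD2[OF tendsto_dist_iff])
qed

text \<open>Mollification at scale \<open>\<epsilon>\<close> only uses values at distance of order \<open>\<epsilon>\<close>; since the kernel has
  integral one and its derivatives have integral zero, only the oscillation of \<open>f\<close> at this scale matters.\<close>

lemma mollify_holder:
  fixes f :: "real^'n::finite \<Rightarrow> real"
  assumes f: "\<And>x y. \<bar>f x - f y\<bar> \<le> C * dist x y powr s" and s: "s > 0"
  obtains A where "\<And>\<epsilon> x. 0 < \<epsilon> \<Longrightarrow> \<epsilon> \<le> 1 \<Longrightarrow> x \<in> cube 1 \<Longrightarrow> \<bar>mollify \<epsilon> f x - f x\<bar> \<le> A * \<epsilon> powr s"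
    "\<And>\<epsilon> x a. 0 < \<epsilon> \<Longrightarrow> \<epsilon> \<le> 1 \<Longrightarrow> x \<in> cube 1 \<Longrightarrow> \<bar>partial a (mollify \<epsilon> f) x\<bar> \<le> A * \<epsilon> powr (s - 1)"
proof -
  let ?\<eta> = "mollifier :: real^'n \<Rightarrow> real"
  have cf: "continuous_on UNIV f" using holder_continuous[of f C s] f s by (simp add: dist_real_def)
  have C: "C \<ge> 0"
    using f[of 0 "axis undefined 1"] by (simp add: dist_norm)
  define I where "I = integral (cube 1) ?\<eta>"
  have I: "I > 0" unfolding I_def by (rule integral_mollifier_pos)
  have "\<forall>g. \<exists>M. smooth g \<longrightarrow> (\<forall>z\<in>cube 1 :: (real^'n) set. \<bar>g z :: real\<bar> \<le> M)"
    using smooth_bounded_on_compact[OF compact_cbox] by blast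
  then obtain N where "\<forall>g. smooth g \<longrightarrow> (\<forall>z\<in>cube 1 :: (real^'n) set. \<bar>g z :: real\<bar> \<le> N g)" by metis
  then have N: "\<bar>g z\<bar> \<le> N g" if "smooth g" "z \<in> cube 1" for g :: "real^'n \<Rightarrow> real" and z using that by blast
  define M where "M = Max (insert (N ?\<eta>) (range (\<lambda>a. N (partial a ?\<eta>))))"
  have "N ?\<eta> \<le> M" "N (partial a ?\<eta>) \<le> M" for a
    unfolding M_def by (rule Max_ge; simp)+
  then have M: "z \<in> cube 1 \<Longrightarrow> \<bar>?\<eta> z\<bar> \<le> M" "z \<in> cube 1 \<Longrightarrow> \<bar>partial a ?\<eta> z\<bar> \<le> M" for z a
    using N[OF smooth_bump] N[OF smooth_partial[OF smooth_bump]] order_trans by blast+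
  have "0 \<in> (cube 1 :: (real^'n) set)" unfolding mem_cube by simp
  then have M0: "M \<ge> 0" using M(1) abs_ge_zero order_trans by blast
  define V where "V = measure lborel (cube 1 :: (real^'n) set)"
  define A where "A = M * (C * real CARD('n) powr s) * V / I"
  have est: "\<bar>integral (cube 1) (\<lambda>z. g z * (f (x - \<epsilon> *\<^sub>R z) - f x))\<bar> \<le> A * I * \<epsilon> powr s"
    if g: "continuous_on (cube 1) g" "\<And>z. z \<in> cube 1 \<Longrightarrow> \<bar>g z\<bar> \<le> M" and \<epsilon>: "0 < \<epsilon>" for g :: "real^'n \<Rightarrow> real" and \<epsilon> x
  proof -
    have "\<bar>integral (cube 1) (\<lambda>z. g z * (f (x - \<epsilon> *\<^sub>R z) - f x))\<bar> \<le> (M * (C * (\<epsilon> * real CARD('n)) powr s)) * V"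
      unfolding V_def real_norm_def[symmetric]
    proof (rule has_integral_bound[OF _ integrable_integral])
      show "(\<lambda>z. g z * (f (x - \<epsilon> *\<^sub>R z) - f x)) integrable_on cube 1"
        by (intro integrable_continuous continuous_on_mult g(1) continuous_on_compose2[OF cf] continuous_on_diff
            continuous_on_scaleR continuous_on_const continuous_on_id) auto
      fix z :: "real^'n" assume z: "z \<in> cube 1"
      have "norm z \<le> (\<Sum>i\<in>UNIV. \<bar>z $ i\<bar>)" by (rule norm_le_l1_cart)
      also have "\<dots> \<le> (\<Sum>i\<in>(UNIV :: 'n set). 1)" using z mem_cube by (intro sum_mono) blast
      finally have "norm z \<le> real CARD('n)" by simp
      then have "dist (x - \<epsilon> *\<^sub>R z) x \<le> \<epsilon> * real CARD('n)" using \<epsilon> by (simp add: dist_norm)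
      then have "C * dist (x - \<epsilon> *\<^sub>R z) x powr s \<le> C * (\<epsilon> * real CARD('n)) powr s"
        using s C by (intro mult_left_mono powr_mono2) auto
      with f[of "x - \<epsilon> *\<^sub>R z" x] have "\<bar>f (x - \<epsilon> *\<^sub>R z) - f x\<bar> \<le> C * (\<epsilon> * real CARD('n)) powr s" by linarith
      then show "norm (g z * (f (x - \<epsilon> *\<^sub>R z) - f x)) \<le> M * (C * (\<epsilon> * real CARD('n)) powr s)"
        using g(2)[OF z] M0 by (simp add: abs_mult mult_mono)
    qed (use M0 C in simp)
    also have "\<dots> = A * I * \<epsilon> powr s" using I \<epsilon> by (simp add: A_def powr_mult)
    finally show ?thesis .
  qed
  have aux: "\<bar>J / I\<bar> \<le> A * e" if "\<bar>J\<bar> \<le> A * I * e" for J e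
    using that I by (simp add: abs_divide pos_divide_le_eq mult_ac)
  have split: "integral (cube 1) (\<lambda>z. g z * (f (x - \<epsilon> *\<^sub>R z) - f x)) =
      integral (cube 1) (\<lambda>z. g z * f (x - \<epsilon> *\<^sub>R z)) - integral (cube 1) g * f x"
    if g: "continuous_on (cube 1) g" for g :: "real^'n \<Rightarrow> real" and \<epsilon> x
  proof -
    have "(\<lambda>z. g z * f (x - \<epsilon> *\<^sub>R z)) integrable_on cube 1" "(\<lambda>z. g z * f x) integrable_on cube 1"
      by (intro integrable_continuous continuous_on_mult g continuous_on_compose2[OF cf] continuous_on_diff
            continuous_on_scaleR continuous_on_const continuous_on_id; simp)+
    then show ?thesis by (simp add: right_diff_distrib integral_diff)
  qed
  have cont: "continuous_on S ?\<eta>" "continuous_on S (partial a ?\<eta>)" for S a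
    by (intro smooth_continuous smooth_partial smooth_bump)+
  have supp: "z \<notin> cube 1 \<Longrightarrow> ?\<eta> z = 0" "z \<notin> cube 1 \<Longrightarrow> partial a ?\<eta> z = 0" for z a
    by (erule mollifier_support, rule partial_eq_0_outside[OF closed_cbox mollifier_support])
  show ?thesis
  proof (rule that[of A])
    fix \<epsilon> :: real and x :: "real^'n" assume \<epsilon>: "0 < \<epsilon>" "\<epsilon> \<le> 1" and x: "x \<in> cube 1"
    have "mollify \<epsilon> f x = integral (cube 1) (\<lambda>z. ?\<eta> z * f (x - \<epsilon> *\<^sub>R z)) / I"
      unfolding mollify_def using \<epsilon> convolution_rescale[OF cont(1) supp(1) cf \<epsilon> x] by (simp add: I_def)
    then have eq: "mollify \<epsilon> f x - f x = integral (cube 1) (\<lambda>z. ?\<eta> z * (f (x - \<epsilon> *\<^sub>R z) - f x)) / I"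
      unfolding split[OF cont(1)] using I by (simp add: I_def diff_divide_distrib)
    show "\<bar>mollify \<epsilon> f x - f x\<bar> \<le> A * \<epsilon> powr s"
      unfolding eq by (rule aux[OF est[OF cont(1) M(1) \<epsilon>(1)]])
  next
    fix \<epsilon> :: real and x :: "real^'n" and a assume \<epsilon>: "0 < \<epsilon>" "\<epsilon> \<le> 1" and x: "x \<in> cube 1"
    have "partial a (mollify \<epsilon> f) x = integral (cube 1) (\<lambda>z. partial a ?\<eta> z * f (x - \<epsilon> *\<^sub>R z)) / (\<epsilon> * I)"
      unfolding partial_mollify[OF cf] using \<epsilon> convolution_rescale[OF cont(2) supp(2) cf \<epsilon> x, of a] by (simp add: I_def)
    also have "integral (cube 1) (\<lambda>z. partial a ?\<eta> z * f (x - \<epsilon> *\<^sub>R z)) =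
        integral (cube 1) (\<lambda>z. partial a ?\<eta> z * (f (x - \<epsilon> *\<^sub>R z) - f x))"
    proof -
      have "integral (cube 1) (partial a ?\<eta>) = 0"
        by (intro integral_unique has_integral_partial_0 smooth_bump mollifier_support)
      then show ?thesis unfolding split[OF cont(2)] by simp
    qed
    finally have "\<bar>partial a (mollify \<epsilon> f) x\<bar> =
        \<bar>integral (cube 1) (\<lambda>z. partial a ?\<eta> z * (f (x - \<epsilon> *\<^sub>R z) - f x)) / I\<bar> / \<epsilon>"
      using \<epsilon> by (simp add: abs_divide abs_mult mult.commute)
    also have "\<dots> \<le> A * \<epsilon> powr s / \<epsilon>"
      by (intro divide_right_mono aux est cont M) (use \<epsilon> in auto)
    finally show "\<bar>partial a (mollify \<epsilon> f) x\<bar> \<le> A * \<epsilon> powr (s - 1)"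
      using \<epsilon> by (simp add: powr_diff)
  qed
qed

text \<open>The scalar mollification, applied to each component.\<close>

lemma holder_smooth_approximation:
  fixes w :: "real^'n::finite \<Rightarrow> real^'m::finite"
  assumes w: "\<And>x y. dist (w x) (w y) \<le> C * dist x y powr s" and s: "s > 0"
  obtains U A where "\<And>\<epsilon>. smooth (U \<epsilon>)"
    "\<And>\<epsilon> x. 0 < \<epsilon> \<Longrightarrow> \<epsilon> \<le> 1 \<Longrightarrow> x \<in> cube 1 \<Longrightarrow> norm (U \<epsilon> x - w x) \<le> A * \<epsilon> powr s"
    "\<And>\<epsilon> x a i. 0 < \<epsilon> \<Longrightarrow> \<epsilon> \<le> 1 \<Longrightarrow> x \<in> cube 1 \<Longrightarrow> \<bar>partial a (\<lambda>x. U \<epsilon> x $ i) x\<bar> \<le> A * \<epsilon> powr (s - 1)"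
    "A > 0"
proof -
  have wi: "\<bar>w x $ i - w y $ i\<bar> \<le> C * dist x y powr s" for x y i
    using component_le_norm_cart[of "w x - w y" i] w[of x y] by (simp add: dist_norm)
  have "\<exists>A. (\<forall>\<epsilon> x. 0 < \<epsilon> \<longrightarrow> \<epsilon> \<le> 1 \<longrightarrow> x \<in> cube 1 \<longrightarrow> \<bar>mollify \<epsilon> (\<lambda>x. w x $ i) x - w x $ i\<bar> \<le> A * \<epsilon> powr s) \<and>
    (\<forall>\<epsilon> x a. 0 < \<epsilon> \<longrightarrow> \<epsilon> \<le> 1 \<longrightarrow> x \<in> cube 1 \<longrightarrow> \<bar>partial a (mollify \<epsilon> (\<lambda>x. w x $ i)) x\<bar> \<le> A * \<epsilon> powr (s - 1))" for i
    using mollify_holder[OF wi s] by metis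
  then obtain A where A:
    "\<And>i \<epsilon> x. 0 < \<epsilon> \<Longrightarrow> \<epsilon> \<le> 1 \<Longrightarrow> x \<in> cube 1 \<Longrightarrow> \<bar>mollify \<epsilon> (\<lambda>x. w x $ i) x - w x $ i\<bar> \<le> A i * \<epsilon> powr s"
    "\<And>i \<epsilon> x a. 0 < \<epsilon> \<Longrightarrow> \<epsilon> \<le> 1 \<Longrightarrow> x \<in> cube 1 \<Longrightarrow> \<bar>partial a (mollify \<epsilon> (\<lambda>x. w x $ i)) x\<bar> \<le> A i * \<epsilon> powr (s - 1)"
    by metis
  define B where "B = 1 + (\<Sum>i\<in>UNIV. \<bar>A i\<bar>)"
  have AB: "A i \<le> B" for i
    using member_le_sum[of i UNIV "\<lambda>i. \<bar>A i\<bar>"] by (simp add: B_def)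
  have cw: "continuous_on UNIV (\<lambda>x. w x $ i)" for i
    using holder_continuous[OF w s] by (intro continuous_intros)
  show ?thesis
  proof (rule that[of "\<lambda>\<epsilon> x. \<chi> i. mollify \<epsilon> (\<lambda>x. w x $ i) x" B])
    show "smooth (\<lambda>x. \<chi> i. mollify \<epsilon> (\<lambda>x. w x $ i) x)" for \<epsilon>
      by (intro smooth_vector smooth_mollify cw)
    fix \<epsilon> :: real and x :: "real^'n" assume \<epsilon>: "0 < \<epsilon>" "\<epsilon> \<le> 1" "x \<in> cube 1"
    have "norm ((\<chi> i. mollify \<epsilon> (\<lambda>x. w x $ i) x) - w x) \<le> (\<Sum>i\<in>UNIV. \<bar>mollify \<epsilon> (\<lambda>x. w x $ i) x - w x $ i\<bar>)"
      using norm_le_l1_cart[of "(\<chi> i. mollify \<epsilon> (\<lambda>x. w x $ i) x) - w x"] by simp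
    also have "\<dots> \<le> (\<Sum>i\<in>UNIV. \<bar>A i\<bar> * \<epsilon> powr s)"
      by (intro sum_mono order_trans[OF A(1)[OF \<epsilon>]] mult_right_mono) auto
    also have "\<dots> \<le> B * \<epsilon> powr s" by (simp add: B_def sum_distrib_right[symmetric] distrib_right)
    finally show "norm ((\<chi> i. mollify \<epsilon> (\<lambda>x. w x $ i) x) - w x) \<le> B * \<epsilon> powr s" .
    show "\<bar>partial a (\<lambda>x. (\<chi> i. mollify \<epsilon> (\<lambda>x. w x $ i) x) $ i) x\<bar> \<le> B * \<epsilon> powr (s - 1)" for a i
      using A(2)[OF \<epsilon>, of a i] mult_right_mono[OF AB[of i], of "\<epsilon> powr (s - 1)"] by simp
  next
    show "B > 0" by (simp add: B_def add_pos_nonneg sum_nonneg)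
  qed
qed

text \<open>A Hoelder function on the ball extends continuously to the closed ball with the same estimate, and
  composition with the nearest point projection, which is a contraction, extends it to the whole space.\<close>

lemma holder_extension:
  fixes u :: "real^'n::finite \<Rightarrow> real^'m::finite"
  assumes u: "holder_on s (ball 0 1) u" and s: "s > 0"
  obtains w C where "\<And>x y. dist (w x) (w y) \<le> C * dist x y powr s" "\<And>x. x \<in> ball 0 1 \<Longrightarrow> w x = u x"
proof -
  obtain C0 where C0: "\<And>x y. x \<in> ball 0 1 \<Longrightarrow> y \<in> ball 0 1 \<Longrightarrow> dist (u x) (u y) \<le> C0 * dist x y powr s"
    using u unfolding holder_on_def by blast
  define C where "C = max C0 1"
  have C: "dist (u x) (u y) \<le> C * dist x y powr s" if "x \<in> ball 0 1" "y \<in> ball 0 1" for x y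
    using C0[OF that] mult_right_mono[of C0 C "dist x y powr s"] by (simp add: C_def)
  have C1: "C > 0" by (simp add: C_def)
  have "uniformly_continuous_on (ball 0 1) u"
    unfolding uniformly_continuous_on_def
  proof (intro allI impI)
    fix e :: real assume e: "e > 0"
    define d where "d = (e / (2 * C)) powr (1 / s)"
    have d: "d > 0" using e C1 by (simp add: d_def)
    have "dist (u x') (u x) < e" if "x \<in> ball 0 1" "x' \<in> ball 0 1" "dist x' x < d" for x x'
    proof -
      have "dist x' x powr s \<le> d powr s" using that s by (intro powr_mono2) auto
      also have "d powr s = e / (2 * C)" using e C1 s by (simp add: d_def powr_powr)
      finally have "C * dist x' x powr s \<le> C * (e / (2 * C))" using C1 by (intro mult_left_mono) auto
      also have "\<dots> < e" using C1 e by simp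
      finally show ?thesis using C[OF that(2,1)] by linarith
    qed
    then show "\<exists>d>0. \<forall>x\<in>ball 0 1. \<forall>x'\<in>ball 0 1. dist x' x < d \<longrightarrow> dist (u x') (u x) < e" using d by blast
  qed
  then obtain g where g: "uniformly_continuous_on (closure (ball 0 1)) g" "\<And>x. x \<in> ball 0 1 \<Longrightarrow> u x = g x"
    using uniformly_continuous_on_extension_on_closure by metis
  have cg: "continuous_on (cball 0 1) g"
    using uniformly_continuous_imp_continuous[OF g(1)] by simp
  have gC: "dist (g x) (g y) \<le> C * dist x y powr s" if xy: "x \<in> cball 0 1" "y \<in> cball 0 1" for x y
  proof (rule LIMSEQ_le)
    \<comment> \<open>shrinking the points towards the centre moves them into the open ball\<close>
    define t where "t n = 1 - 1 / real (Suc (Suc n))" for n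
    have t01: "0 \<le> t n" "t n < 1" for n by (auto simp: t_def)
    have "t \<longlonglongrightarrow> 1 - 0"
      unfolding t_def[abs_def] by (intro tendsto_diff tendsto_const LIMSEQ_Suc lim_1_over_n)
    then have lim: "(\<lambda>n. t n *\<^sub>R z) \<longlonglongrightarrow> z" for z :: "real^'n"
      using tendsto_scaleR[OF _ tendsto_const, of t 1 sequentially z] by simp
    have tb: "t n *\<^sub>R z \<in> ball 0 1" if "z \<in> cball 0 1" for n and z :: "real^'n"
    proof -
      have "t n * norm z \<le> t n * 1" using t01 that by (intro mult_left_mono) auto
      then show ?thesis using t01[of n] by simp
    qed
    have lg: "(\<lambda>n. g (t n *\<^sub>R z)) \<longlonglongrightarrow> g z" if z: "z \<in> cball 0 1" for z
      using continuous_on_tendsto_compose[OF cg lim z] tb[OF z] by (auto simp: less_imp_le)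
    show "(\<lambda>n. dist (g (t n *\<^sub>R x)) (g (t n *\<^sub>R y))) \<longlonglongrightarrow> dist (g x) (g y)"
      by (intro tendsto_dist lg xy)
    show "(\<lambda>n. C * dist (t n *\<^sub>R x) (t n *\<^sub>R y) powr s) \<longlonglongrightarrow> C * dist x y powr s"
      using s by (intro tendsto_mult tendsto_const tendsto_powr' tendsto_dist lim) auto
    show "\<exists>N. \<forall>n\<ge>N. dist (g (t n *\<^sub>R x)) (g (t n *\<^sub>R y)) \<le> C * dist (t n *\<^sub>R x) (t n *\<^sub>R y) powr s"
      using C[OF tb[OF xy(1)] tb[OF xy(2)]] g(2)[OF tb[OF xy(1)]] g(2)[OF tb[OF xy(2)]] by auto
  qed
  let ?p = "closest_point (cball (0 :: real^'n) 1)"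
  show ?thesis
  proof (rule that[of "\<lambda>x. g (?p x)" C])
    fix x y
    have "dist (?p x) (?p y) \<le> dist x y" by (intro closest_point_lipschitz) auto
    then have "C * dist (?p x) (?p y) powr s \<le> C * dist x y powr s"
      using C1 s by (intro mult_left_mono powr_mono2) auto
    moreover have "?p z \<in> cball 0 1" for z by (intro closest_point_in_set) auto
    ultimately show "dist (g (?p x)) (g (?p y)) \<le> C * dist x y powr s" using gC order_trans by blast
  qed (use g(2) in \<open>simp add: closest_point_self less_imp_le\<close>)
qed

section \<open>Convergence of mollifications in fractional Sobolev spaces\<close>

lemma ennroot_mono:
  assumes "a \<le> ennreal b" "b \<ge> 0" "p > 0"
  shows "ennroot p a \<le> ennreal (b powr (1 / p))"
proof -
  have "a \<noteq> \<infinity>" using assms(1) by (auto simp: top_unique)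
  moreover have "enn2real a powr (1 / p) \<le> b powr (1 / p)"
    using assms by (intro powr_mono2 enn2real_leI) auto
  ultimately show ?thesis by (simp add: ennroot_def ennreal_leI)
qed

lemma dyadic_annulus:
  assumes "0 < r" "r \<le> (2::real)"
  obtains j :: nat where "(1/2) ^ j < r" "r \<le> 2 * (1/2) ^ j"
proof -
  have ex: "\<exists>j. (1/2) ^ j < r" using assms real_arch_pow_inv[of r "1/2"] by auto
  define j where "j = (LEAST j. (1/2) ^ j < r)"
  have j: "(1/2) ^ j < r" unfolding j_def by (rule LeastI_ex[OF ex])
  have "r \<le> 2 * (1/2) ^ j"
  proof (cases j)
    case 0 then show ?thesis using assms by simp
  next
    case (Suc i)
    then have "\<not> (1/2) ^ i < r" using not_less_Least[of i "\<lambda>j. (1/2) ^ j < r"] by (simp add: j_def[symmetric])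
    then show ?thesis using Suc by simp
  qed
  with j show ?thesis by (rule that)
qed

text \<open>The kernel \<open>\<bar>x - y\<bar>\<^bsup>\<delta> - n\<^esup>\<close> has a bounded integral over the ball: on the dyadic
  annulus of radius \<open>2\<^bsup>-j\<^esup>\<close> the integral is of order \<open>2\<^bsup>-j\<delta>\<^esup>\<close>.\<close>

lemma riesz_kernel_bounded:
  assumes \<delta>: "\<delta> > 0"
  obtains K where "K \<ge> 0" "\<And>y :: real^'n::finite. y \<in> ball 0 1 \<Longrightarrow>
    (\<integral>\<^sup>+x. ennreal (norm (x - y) powr \<delta> / norm (x - y) ^ CARD('n)) \<partial>lebesgue_on (ball 0 1)) \<le> ennreal K"
proof -
  let ?n = "CARD('n)"
  \<comment> \<open>\<open>c j\<close> bounds the kernel on the annulus \<open>2\<^bsup>-j\<^esup> < \<bar>x - y\<bar> \<le> 2\<^bsup>1-j\<^esup>\<close>, whatever the sign of \<open>\<delta> - n\<close>\<close>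
  define c where "c j = (2 * (1/2) ^ j) powr \<delta> / ((1/2) ^ j) ^ ?n" for j :: nat
  define v where "v = unit_ball_vol (real ?n)"
  define q where "q = (1/2) powr \<delta>"
  have q: "0 \<le> q" "q < 1"
    using powr_less_mono2[of \<delta> "1/2" 1] \<delta> by (auto simp: q_def)
  define K where "K = v * 2 ^ ?n * 2 powr \<delta> * (1 / (1 - q))"
  have "K \<ge> 0" using q by (simp add: K_def v_def)
  have c0: "c j \<ge> 0" for j by (simp add: c_def)
  have "(\<integral>\<^sup>+x. ennreal (norm (x - y) powr \<delta> / norm (x - y) ^ ?n) \<partial>lebesgue_on (ball 0 1)) \<le> ennreal K"
    if y: "y \<in> ball 0 1" for y :: "real^'n"
  proof -
    have pw: "ennreal (norm (x - y) powr \<delta> / norm (x - y) ^ ?n) * indicator (ball 0 1) x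
        \<le> (\<Sum>j. ennreal (c j) * indicator (cball y (2 * (1/2) ^ j)) x)" for x
    proof (cases "x \<in> ball 0 1 \<and> x \<noteq> y")
      case True
      have "norm (x - y) \<le> 2" using norm_triangle_ineq4[of x y] y True by auto
      with True obtain j where j: "(1/2) ^ j < norm (x - y)" "norm (x - y) \<le> 2 * (1/2) ^ j"
        using dyadic_annulus[of "norm (x - y)"] by auto
      have "norm (x - y) powr \<delta> / norm (x - y) ^ ?n \<le> c j"
        unfolding c_def using j \<delta> by (intro frac_le powr_mono2 power_mono) auto
      then have "ennreal (norm (x - y) powr \<delta> / norm (x - y) ^ ?n) * indicator (ball 0 1) x \<le>
          ennreal (c j) * indicator (cball y (2 * (1/2) ^ j)) x"
        using True j by (simp add: dist_norm norm_minus_commute ennreal_leI)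
      also have "\<dots> \<le> (\<Sum>j. ennreal (c j) * indicator (cball y (2 * (1/2) ^ j)) x)"
      proof -
        have "F j \<le> suminf F" for F :: "nat \<Rightarrow> ennreal" using sum_le_suminf[of F "{j}"] by simp
        then show ?thesis .
      qed
      finally show ?thesis .
    qed auto
    have "(\<integral>\<^sup>+x. ennreal (norm (x - y) powr \<delta> / norm (x - y) ^ ?n) \<partial>lebesgue_on (ball 0 1)) =
        (\<integral>\<^sup>+x. ennreal (norm (x - y) powr \<delta> / norm (x - y) ^ ?n) * indicator (ball 0 1) x \<partial>lebesgue)"
      by (rule nn_integral_restrict_space) simp
    also have "\<dots> \<le> (\<integral>\<^sup>+x. (\<Sum>j. ennreal (c j) * indicator (cball y (2 * (1/2) ^ j)) x) \<partial>lebesgue)"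
      by (intro nn_integral_mono pw)
    also have "\<dots> = (\<Sum>j. \<integral>\<^sup>+x. ennreal (c j) * indicator (cball y (2 * (1/2) ^ j)) x \<partial>lebesgue)"
      by (intro nn_integral_suminf borel_measurable_times_ennreal borel_measurable_indicator) auto
    also have "\<dots> = (\<Sum>j. ennreal (c j) * emeasure lebesgue (cball y (2 * (1/2) ^ j)))"
      by (intro suminf_cong nn_integral_cmult_indicator) simp
    also have "\<dots> = (\<Sum>j. ennreal (v * 2 ^ ?n * 2 powr \<delta> * q ^ j))"
    proof (rule suminf_cong)
      fix j :: nat
      have "((1/2::real) ^ j) powr \<delta> = q ^ j"
        by (simp add: q_def powr_realpow[symmetric] powr_powr mult.commute)
      then have eq: "c j * (v * (2 * (1/2) ^ j) ^ ?n) = v * 2 ^ ?n * 2 powr \<delta> * q ^ j"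
        by (simp add: c_def powr_mult power_mult_distrib)
      have "emeasure lebesgue (cball y (2 * (1/2) ^ j)) = ennreal (v * (2 * (1/2) ^ j) ^ ?n)"
        by (simp add: emeasure_cball v_def)
      then show "ennreal (c j) * emeasure lebesgue (cball y (2 * (1/2) ^ j)) = ennreal (v * 2 ^ ?n * 2 powr \<delta> * q ^ j)"
        by (simp only: ennreal_mult'[OF c0, symmetric] eq)
    qed
    also have "\<dots> = ennreal K"
      unfolding K_def using q
      by (intro suminf_ennreal_eq sums_mult geometric_sums) (auto simp: v_def)
    finally show ?thesis .
  qed
  with \<open>K \<ge> 0\<close> show ?thesis by (rule that)
qed

lemma lipschitz_of_partial_bound:
  fixes f :: "real^'n::finite \<Rightarrow> real"
  assumes f: "smooth f" and S: "convex S" "x \<in> S" "y \<in> S"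
    and L: "\<And>z a. z \<in> S \<Longrightarrow> \<bar>partial a f z\<bar> \<le> L"
  shows "\<bar>f x - f y\<bar> \<le> real CARD('n) * L * norm (x - y)"
proof -
  have "norm (f x - f y) \<le> real CARD('n) * L * norm (x - y)"
  proof (rule differentiable_bound[OF S(1) _ _ S(2,3)])
    fix z assume z: "z \<in> S"
    show "(f has_derivative frechet_derivative f (at z)) (at z within S)"
      by (rule has_derivative_at_withinI[OF has_derivative_frechet_derivative[OF smooth_differentiable[OF f]]])
    show "onorm (frechet_derivative f (at z)) \<le> real CARD('n) * L"
    proof (rule onorm_le)
      fix h
      have "norm (frechet_derivative f (at z) h) \<le> (\<Sum>i\<in>UNIV. \<bar>h $ i\<bar> * \<bar>partial i f z\<bar>)"
        unfolding derivative_eq_sum_partial[OF smooth_differentiable[OF f]]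
        by (intro order_trans[OF norm_sum]) (simp add: abs_mult)
      also have "\<dots> \<le> (\<Sum>i\<in>(UNIV::'n set). norm h * L)"
        using L[OF z] by (intro sum_mono mult_mono component_le_norm_cart) auto
      finally show "norm (frechet_derivative f (at z) h) \<le> real CARD('n) * L * norm h" by (simp add: mult_ac)
    qed
  qed
  then show ?thesis by simp
qed

text \<open>Interpolation: an approximation at scale \<open>\<epsilon>\<close> that is uniformly Hoelder continuous of exponent
  \<open>s\<close> converges in every weaker Hoelder norm. At distances \<open>r \<ge> \<epsilon>\<close> the uniform estimate is used, at distances
  \<open>r < \<epsilon>\<close> the gradient bound; both give the order \<open>(min \<epsilon> r)\<^bsup>s\<^esup> \<le> \<epsilon>\<^bsup>s-\<theta>\<^esup> r\<^bsup>\<theta>\<^esup>\<close>.\<close>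

lemma approximation_error_holder:
  fixes U :: "real \<Rightarrow> real^'n::finite \<Rightarrow> real^'m::finite"
  assumes w: "\<And>x y. dist (w x) (w y) \<le> C * dist x y powr s"
    and U: "\<And>\<epsilon>. smooth (U \<epsilon>)"
      "\<And>\<epsilon> x. 0 < \<epsilon> \<Longrightarrow> \<epsilon> \<le> 1 \<Longrightarrow> x \<in> cube 1 \<Longrightarrow> norm (U \<epsilon> x - w x) \<le> A * \<epsilon> powr s"
      "\<And>\<epsilon> x a i. 0 < \<epsilon> \<Longrightarrow> \<epsilon> \<le> 1 \<Longrightarrow> x \<in> cube 1 \<Longrightarrow> \<bar>partial a (\<lambda>x. U \<epsilon> x $ i) x\<bar> \<le> A * \<epsilon> powr (s - 1)"
    and s: "0 < \<theta>" "\<theta> < s" "s < 1"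
  obtains B where "B > 0" "\<And>\<epsilon> x y. 0 < \<epsilon> \<Longrightarrow> \<epsilon> \<le> 1 \<Longrightarrow> x \<in> cube 1 \<Longrightarrow> y \<in> cube 1 \<Longrightarrow>
    norm ((U \<epsilon> x - w x) - (U \<epsilon> y - w y)) \<le> B * \<epsilon> powr (s - \<theta>) * norm (x - y) powr \<theta>"
proof -
  have C: "C \<ge> 0"
    using order_trans[OF zero_le_dist w[of "axis undefined 1" 0]] by (simp add: dist_norm)
  have "0 \<le> A * 1 powr s" using order_trans[OF norm_ge_zero U(2)[of 1 0]] unfolding mem_cube by simp
  then have A: "A \<ge> 0" by simp
  define n where "n = real CARD('n)"
  define m where "m = real CARD('m)"
  have nm: "n \<ge> 0" "m \<ge> 0" by (simp_all add: n_def m_def)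
  define B where "B = 2 * A + m * n * A + C + 1"
  have B: "B > 0" using A C nm by (simp add: B_def add_nonneg_pos)
  have "norm ((U \<epsilon> x - w x) - (U \<epsilon> y - w y)) \<le> B * \<epsilon> powr (s - \<theta>) * norm (x - y) powr \<theta>"
    if \<epsilon>: "0 < \<epsilon>" "\<epsilon> \<le> 1" and xy: "x \<in> cube 1" "y \<in> cube 1" for \<epsilon> x y
  proof (cases "x = y")
    case True then show ?thesis by simp
  next
    case False
    define r where "r = norm (x - y)"
    have r: "r > 0" using False by (simp add: r_def)
    show ?thesis
    proof (cases "\<epsilon> \<le> r")
      case True
      have "norm ((U \<epsilon> x - w x) - (U \<epsilon> y - w y)) \<le> A * \<epsilon> powr s + A * \<epsilon> powr s"
        by (intro order_trans[OF norm_triangle_ineq4] add_mono U(2) \<epsilon> xy)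
      also have "\<dots> \<le> B * \<epsilon> powr s"
      proof -
        have "(2 * A) * \<epsilon> powr s \<le> B * \<epsilon> powr s" using A C nm by (intro mult_right_mono) (auto simp: B_def)
        then show ?thesis by simp
      qed
      also have "\<epsilon> powr s = \<epsilon> powr (s - \<theta>) * \<epsilon> powr \<theta>" by (simp add: powr_add[symmetric])
      also have "B * (\<epsilon> powr (s - \<theta>) * \<epsilon> powr \<theta>) \<le> B * (\<epsilon> powr (s - \<theta>) * r powr \<theta>)"
        using True \<epsilon> s B by (intro mult_left_mono powr_mono2) auto
      finally show ?thesis by (simp add: r_def mult.assoc)
    next
      case False
      have "norm (U \<epsilon> x - U \<epsilon> y) \<le> (\<Sum>i\<in>UNIV. \<bar>U \<epsilon> x $ i - U \<epsilon> y $ i\<bar>)"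
        using norm_le_l1_cart[of "U \<epsilon> x - U \<epsilon> y"] by simp
      also have "\<dots> \<le> (\<Sum>i\<in>(UNIV :: 'm set). n * (A * \<epsilon> powr (s - 1)) * r)"
        unfolding n_def r_def
        by (intro sum_mono lipschitz_of_partial_bound[OF smooth_component[OF U(1)] _ xy] U(3) \<epsilon>) auto
      also have "\<dots> = m * n * A * (\<epsilon> powr (s - 1) * r)" by (simp add: m_def)
      also have "\<dots> \<le> m * n * A * (r powr (s - 1) * r)"
        using False r \<epsilon> s nm A by (intro mult_left_mono mult_right_mono powr_mono2') auto
      also have "r powr (s - 1) * r = r powr s" using r by (simp add: powr_diff)
      finally have "norm (U \<epsilon> x - U \<epsilon> y) \<le> m * n * A * r powr s" .
      moreover have "norm (w x - w y) \<le> C * r powr s" using w[of x y] by (simp add: dist_norm r_def)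
      ultimately have "norm ((U \<epsilon> x - U \<epsilon> y) - (w x - w y)) \<le> m * n * A * r powr s + C * r powr s"
        by (rule order_trans[OF norm_triangle_ineq4 add_mono])
      also have "\<dots> \<le> B * r powr s"
      proof -
        have "(m * n * A + C) * r powr s \<le> B * r powr s" using A by (intro mult_right_mono) (auto simp: B_def)
        then show ?thesis by (simp add: distrib_right)
      qed
      also have "r powr s = r powr (s - \<theta>) * r powr \<theta>" by (simp add: powr_add[symmetric])
      also have "B * (r powr (s - \<theta>) * r powr \<theta>) \<le> B * (\<epsilon> powr (s - \<theta>) * r powr \<theta>)"
        using False r s B by (intro mult_left_mono mult_right_mono powr_mono2) auto
      finally show ?thesis by (simp add: r_def mult.assoc algebra_simps)
    qed
  qed
  with B show ?thesis by (rule that)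
qed

text \<open>A Hoelder estimate of exponent \<open>\<theta> > \<sigma>\<close> leaves the integrable kernel \<open>\<bar>x - y\<bar>\<^bsup>(\<theta>-\<sigma>)p-n\<^esup>\<close> in the
  Gagliardo seminorm.\<close>

lemma sobolev_norm_tendsto_0:
  fixes d :: "real \<Rightarrow> real^'n::finite \<Rightarrow> real^'m::finite"
  assumes d0: "\<And>\<epsilon> x. 0 < \<epsilon> \<Longrightarrow> \<epsilon> \<le> 1 \<Longrightarrow> x \<in> ball 0 1 \<Longrightarrow> norm (d \<epsilon> x) \<le> A * \<epsilon> powr s"
    and d1: "\<And>\<epsilon> x y. 0 < \<epsilon> \<Longrightarrow> \<epsilon> \<le> 1 \<Longrightarrow> x \<in> ball 0 1 \<Longrightarrow> y \<in> ball 0 1 \<Longrightarrow>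
      norm (d \<epsilon> x - d \<epsilon> y) \<le> B * \<epsilon> powr t * norm (x - y) powr \<theta>"
    and pos: "A > 0" "B > 0" "s > 0" "t > 0" "p > 0" "\<sigma> < \<theta>"
  shows "((\<lambda>\<epsilon>. sobolev_norm \<sigma> p (d \<epsilon>)) \<longlongrightarrow> 0) (at_right 0)"
proof -
  let ?M = "lebesgue_on (ball (0::real^'n) 1)"
  define V where "V = measure lebesgue (ball (0::real^'n) 1)"
  have V: "emeasure ?M (space ?M) = ennreal V"
    by (simp add: emeasure_restrict_space V_def emeasure_eq_measure2 lmeasurable_ball)
  have V0: "V \<ge> 0" by (simp add: V_def)
  define \<delta> where "\<delta> = (\<theta> - \<sigma>) * p"
  have "\<delta> > 0" using pos by (simp add: \<delta>_def)
  then obtain K where K: "K \<ge> 0" "\<And>y :: real^'n. y \<in> ball 0 1 \<Longrightarrow>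
      (\<integral>\<^sup>+x. ennreal (norm (x - y) powr \<delta> / norm (x - y) ^ CARD('n)) \<partial>?M) \<le> ennreal K"
    using riesz_kernel_bounded by blast
  define h where "h \<epsilon> = (A * V powr (1 / p)) * \<epsilon> powr s + (B * (K * V) powr (1 / p)) * \<epsilon> powr t" for \<epsilon>
  have root: "((a * e) powr p * c) powr (1 / p) = (a * c powr (1 / p)) * e"
    if "a \<ge> 0" "e \<ge> 0" "c \<ge> 0" for a e c :: real
    using that pos by (simp add: powr_mult powr_powr mult_ac)
  have bound: "sobolev_norm \<sigma> p (d \<epsilon>) \<le> ennreal (h \<epsilon>)" if \<epsilon>: "0 < \<epsilon>" "\<epsilon> \<le> 1" for \<epsilon>
  proof -
    have "(\<integral>\<^sup>+x. ennreal (norm (d \<epsilon> x) powr p) \<partial>?M) \<le> (\<integral>\<^sup>+x. ennreal ((A * \<epsilon> powr s) powr p) \<partial>?M)"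
      using d0[OF \<epsilon>] pos by (intro nn_integral_mono ennreal_leI powr_mono2) auto
    also have "\<dots> = ennreal ((A * \<epsilon> powr s) powr p * V)"
      using V by (simp add: ennreal_mult')
    finally have "Lp_norm p (d \<epsilon>) \<le> ennreal (((A * \<epsilon> powr s) powr p * V) powr (1 / p))"
      unfolding Lp_norm_def using pos V0 by (intro ennroot_mono) auto
    also have "\<dots> = ennreal ((A * V powr (1 / p)) * \<epsilon> powr s)"
      using pos V0 by (subst root) auto
    finally have 1: "Lp_norm p (d \<epsilon>) \<le> ennreal ((A * V powr (1 / p)) * \<epsilon> powr s)" .
    let ?c = "(B * \<epsilon> powr t) powr p"
    have "(\<integral>\<^sup>+x. ennreal (norm (d \<epsilon> x - d \<epsilon> y) powr p / norm (x - y) powr (real CARD('n) + \<sigma> * p)) \<partial>?M)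
        \<le> ennreal (?c * K)" if y: "y \<in> ball 0 1" for y
    proof -
      have "(\<integral>\<^sup>+x. ennreal (norm (d \<epsilon> x - d \<epsilon> y) powr p / norm (x - y) powr (real CARD('n) + \<sigma> * p)) \<partial>?M)
          \<le> (\<integral>\<^sup>+x. ennreal ?c * ennreal (norm (x - y) powr \<delta> / norm (x - y) ^ CARD('n)) \<partial>?M)"
      proof (rule nn_integral_mono)
        fix x assume "x \<in> space ?M"
        then have x: "x \<in> ball 0 1" by simp
        show "ennreal (norm (d \<epsilon> x - d \<epsilon> y) powr p / norm (x - y) powr (real CARD('n) + \<sigma> * p))
          \<le> ennreal ?c * ennreal (norm (x - y) powr \<delta> / norm (x - y) ^ CARD('n))"
        proof (cases "x = y")
          case False
          define r where "r = norm (x - y)"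
          have r: "r > 0" using False by (simp add: r_def)
          have "norm (d \<epsilon> x - d \<epsilon> y) powr p \<le> (B * \<epsilon> powr t * r powr \<theta>) powr p"
            using d1[OF \<epsilon> x y] pos by (intro powr_mono2) (auto simp: r_def)
          also have "\<dots> = ?c * r powr (\<theta> * p)" using pos by (simp add: powr_mult powr_powr)
          finally have "norm (d \<epsilon> x - d \<epsilon> y) powr p / r powr (real CARD('n) + \<sigma> * p) \<le>
              ?c * r powr (\<theta> * p) / r powr (real CARD('n) + \<sigma> * p)"
            by (rule divide_right_mono) simp
          also have "\<dots> = ?c * (r powr \<delta> / r ^ CARD('n))"
          proof -
            have "r powr (\<theta> * p) = r powr \<delta> * r powr (\<sigma> * p)"
              by (simp add: powr_add[symmetric] \<delta>_def algebra_simps)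
            then show ?thesis using r by (simp add: powr_add powr_realpow)
          qed
          finally show ?thesis
            unfolding r_def[symmetric] by (simp add: ennreal_mult'[symmetric] ennreal_leI)
        qed simp
      qed
      also have "\<dots> = ennreal ?c * (\<integral>\<^sup>+x. ennreal (norm (x - y) powr \<delta> / norm (x - y) ^ CARD('n)) \<partial>?M)"
        by (rule nn_integral_cmult) (intro measurable_restrict_space1 measurable_completion; simp)
      also have "\<dots> \<le> ennreal ?c * ennreal K" by (intro mult_left_mono K y) simp
      finally show ?thesis by (simp add: ennreal_mult')
    qed
    then have "(\<integral>\<^sup>+y. (\<integral>\<^sup>+x. ennreal (norm (d \<epsilon> x - d \<epsilon> y) powr p / norm (x - y) powr (real CARD('n) + \<sigma> * p)) \<partial>?M) \<partial>?M)
        \<le> (\<integral>\<^sup>+y. ennreal (?c * K) \<partial>?M)"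
      by (intro nn_integral_mono) simp
    also have "\<dots> = ennreal (?c * (K * V))"
      using V K(1) V0 by (simp add: ennreal_mult'' ennreal_mult' mult.assoc)
    finally have "gagliardo_seminorm \<sigma> p (d \<epsilon>) \<le> ennreal ((?c * (K * V)) powr (1 / p))"
      unfolding gagliardo_seminorm_def using pos V0 K(1) by (intro ennroot_mono) auto
    also have "\<dots> = ennreal ((B * (K * V) powr (1 / p)) * \<epsilon> powr t)"
      using pos V0 K(1) by (subst root) auto
    finally have 2: "gagliardo_seminorm \<sigma> p (d \<epsilon>) \<le> ennreal ((B * (K * V) powr (1 / p)) * \<epsilon> powr t)" .
    show ?thesis
      unfolding sobolev_norm_def h_def
      using add_mono[OF 1 2] pos by (simp add: ennreal_plus[symmetric] del: ennreal_plus)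
  qed
  have "(h \<longlongrightarrow> (A * V powr (1 / p)) * 0 powr s + (B * (K * V) powr (1 / p)) * 0 powr t) (at_right 0)"
    unfolding h_def[abs_def] using pos
    by (intro tendsto_add tendsto_mult tendsto_const tendsto_powr' tendsto_ident_at)
       (auto simp: eventually_at_right_field intro!: exI[of _ 1])
  then have "((\<lambda>\<epsilon>. ennreal (h \<epsilon>)) \<longlongrightarrow> ennreal 0) (at_right 0)"
    by (intro tendsto_ennrealI) (simp add: pos)
  then have "((\<lambda>\<epsilon>. ennreal (h \<epsilon>)) \<longlongrightarrow> 0) (at_right 0)" by simp
  then show ?thesis
    by (rule tendsto_sandwich[OF _ _ tendsto_const, rotated 2])
       (auto simp: eventually_at_right_field intro!: exI[of _ 1] bound)
qed

lemma LINT_ball_eq_integral_cube: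
  fixes f :: "real^'n::finite \<Rightarrow> real"
  assumes f: "continuous_on UNIV f" "\<And>x. x \<notin> ball 0 1 \<Longrightarrow> f x = 0"
  shows "(LINT x|lebesgue_on (ball 0 1). f x) = integral (cube 1) f"
proof -
  have sub: "ball 0 1 \<subseteq> (cube 1 :: (real^'n) set)" using ball_subset_cball cball_subset_cube by blast
  have "integrable (lebesgue_on (cube 1)) f"
    by (rule continuous_imp_integrable[OF continuous_on_subset[OF f(1)]]) simp
  then have "integrable lebesgue (\<lambda>x. indicator (cube 1) x *\<^sub>R f x)"
    by (simp add: integrable_restrict_space)
  also have "(\<lambda>x. indicator (cube 1) x *\<^sub>R f x) = (\<lambda>x. indicator (ball 0 1) x *\<^sub>R f x)"
    using f(2) sub by (intro ext) (auto simp: indicator_def)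
  finally have i: "integrable (lebesgue_on (ball 0 1)) f"
    by (simp add: integrable_restrict_space)
  have "(LINT x|lebesgue_on (ball 0 1). f x) = integral (ball 0 1) f"
    by (rule lebesgue_integral_eq_integral[OF i]) simp
  moreover have "(f has_integral integral (ball 0 1) f) (ball 0 1)"
    using integrable_on_lebesgue_on[OF i] by (auto simp: integrable_integral)
  then have "(f has_integral integral (ball 0 1) f) (cube 1)"
    by (rule has_integral_on_superset[OF _ f(2) sub])
  ultimately show ?thesis by (simp add: integral_unique)
qed

section \<open>Passing to the limit with Hoelder continuous test functions\<close>

text \<open>Since \<open>f\<close> tends to zero, \<open>f m\<close> is the sum of the differences \<open>f j - f (j + 1)\<close> over \<open>j \<ge> m\<close>.\<close>

lemma abs_le_geometric_tail:
  fixes f :: "nat \<Rightarrow> real"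
  assumes f: "f \<longlonglongrightarrow> 0" and q: "0 \<le> q" "q < 1"
    and step: "\<And>j. j \<ge> m \<Longrightarrow> \<bar>f j - f (Suc j)\<bar> \<le> K * q ^ j"
  shows "\<bar>f m\<bar> \<le> K * q ^ m / (1 - q)"
proof -
  have K: "K * q ^ m \<ge> 0" using step[of m] abs_ge_zero order_trans by blast
  have "\<bar>f m\<bar> \<le> \<bar>f J\<bar> + K * (q ^ m - q ^ J) / (1 - q)" if "J \<ge> m" for J
    using that
  proof (induction J rule: dec_induct)
    case (step J)
    have "K * q ^ J = K * (q ^ J - q ^ Suc J) / (1 - q)" using q by (simp add: field_simps)
    then have "\<bar>f J - f (Suc J)\<bar> \<le> K * (q ^ J - q ^ Suc J) / (1 - q)"
      using assms(4)[of J] step.hyps by simp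
    moreover have "K * (q ^ m - q ^ J) / (1 - q) + K * (q ^ J - q ^ Suc J) / (1 - q) = K * (q ^ m - q ^ Suc J) / (1 - q)"
      by (simp add: add_divide_distrib[symmetric] algebra_simps)
    ultimately show ?case using step.IH by linarith
  qed simp
  then have ev: "\<forall>\<^sub>F J in sequentially. \<bar>f m\<bar> \<le> \<bar>f J\<bar> + K * (q ^ m - q ^ J) / (1 - q)"
    using eventually_sequentially by blast
  have "(\<lambda>J. \<bar>f J\<bar> + K * (q ^ m - q ^ J) / (1 - q)) \<longlonglongrightarrow> \<bar>0\<bar> + K * (q ^ m - 0) / (1 - q)"
    using q by (intro tendsto_add tendsto_rabs f tendsto_divide tendsto_mult tendsto_diff tendsto_const LIMSEQ_realpow_zero) auto
  then have "\<bar>f m\<bar> \<le> \<bar>0\<bar> + K * (q ^ m - 0) / (1 - q)"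
    by (rule tendsto_lowerbound[OF _ ev]) simp
  then show ?thesis by simp
qed

text \<open>The key estimate. The test function \<open>\<psi> \<circ> V m\<close> has gradient of order \<open>h\<^bsup>s-1\<^esup>\<close> at the scale
  \<open>h = 2\<^bsup>-m\<^esup>\<close>. For a fixed test function, passing from scale \<open>2\<^bsup>-j\<^esup>\<close> to scale \<open>2\<^bsup>-j-1\<^esup>\<close> costs, after
  integration by parts, the factor \<open>2\<^bsup>-js\<^esup>\<close> from the difference and \<open>2\<^bsup>-j(s-1)\<^esup>\<close> from each of the other
  \<open>k - 1\<close> gradients. Since the pairing with a fixed test function vanishes in the limit, summation over
  \<open>j \<ge> m\<close> leaves the order \<open>h\<^bsup>s-1\<^esup> h\<^bsup>s+(k-1)(s-1)\<^esup> = h\<^bsup>(k+1)s-k\<^esup>\<close>.\<close>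

lemma minor_pairing_tendsto_0:
  fixes V :: "nat \<Rightarrow> real^'n::finite \<Rightarrow> real^'m::finite"
  assumes V: "\<And>j. smooth (V j)"
    and diff: "\<And>j x i. x \<in> cube 1 \<Longrightarrow> \<bar>V j x $ i - V (Suc j) x $ i\<bar> \<le> A * ((1/2) ^ j) powr s"
    and grad: "\<And>j x i a. x \<in> cube 1 \<Longrightarrow> \<bar>partial a (\<lambda>x. V j x $ i) x\<bar> \<le> A * ((1/2) ^ j) powr (s - 1)"
    and bdd: "\<And>j x. x \<in> cube 1 \<Longrightarrow> norm (V j x) \<le> R"
    and lim: "\<And>\<phi>. test_function \<phi> \<Longrightarrow>
      (\<lambda>j. integral (cube 1) (\<lambda>x. \<phi> x * minor k \<alpha> (\<lambda>l x. V j x $ i l) x)) \<longlonglongrightarrow> 0"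
    and A: "A > 0" and s: "real k / (real k + 1) < s" "s < 1" and k: "k \<ge> 1"
    and \<psi>: "smooth \<psi>" and \<phi>: "test_function \<phi>"
  shows "(\<lambda>m. integral (cube 1) (\<lambda>x. (\<psi> (V m x) * \<phi> x) * minor k \<alpha> (\<lambda>l x. V m x $ i l) x)) \<longlonglongrightarrow> 0"
proof -
  define h :: "nat \<Rightarrow> real" where "h j = (1/2) ^ j" for j
  have h: "h j > 0" "h j \<le> 1" "h (Suc j) = h j / 2" for j
    by (auto simp: h_def power_le_one)
  have h1: "h j powr (s - 1) \<ge> 1" for j
    using powr_mono2'[of "s - 1" "h j" 1] h[of j] s by simp
  note s\<phi> = test_function_smooth[OF \<phi>]
  define T where "T m x = \<psi> (V m x) * \<phi> x" for m x
  have sT: "smooth (T m)" for m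
    unfolding T_def[abs_def] by (rule smooth_mult[OF smooth_compose[OF \<psi> V] s\<phi>])
  have tT: "test_function (T m)" for m
    unfolding T_def[abs_def] by (rule test_function_mult[OF \<phi> smooth_compose[OF \<psi> V]])
  note bd = smooth_bounded_on_compact
  obtain P0 where P0: "\<And>y. y \<in> cball 0 R \<Longrightarrow> \<bar>\<psi> y\<bar> \<le> P0" using bd[OF compact_cball \<psi>] by blast
  have "\<forall>l. \<exists>M. \<forall>y\<in>cball 0 R. \<bar>partial l \<psi> y\<bar> \<le> M" using bd[OF compact_cball smooth_partial[OF \<psi>]] by blast
  then obtain P1 where P1: "\<And>l y. y \<in> cball 0 R \<Longrightarrow> \<bar>partial l \<psi> y\<bar> \<le> P1 l" by metis
  obtain M0 where M0: "\<And>x. x \<in> cube 1 \<Longrightarrow> \<bar>\<phi> x\<bar> \<le> M0" using bd[OF compact_cbox s\<phi>] by blast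
  have "\<forall>a. \<exists>M. \<forall>y\<in>cube 1. \<bar>partial a \<phi> y\<bar> \<le> M" using bd[OF compact_cbox smooth_partial[OF s\<phi>]] by blast
  then obtain M1 where M1: "\<And>a x. x \<in> cube 1 \<Longrightarrow> \<bar>partial a \<phi> x\<bar> \<le> M1 a" by metis
  have z: "(0 :: real^'n) \<in> cube 1" unfolding mem_cube by simp
  have R: "R \<ge> 0" using bdd[OF z] norm_ge_zero order_trans by blast
  then have z': "(0 :: real^'m) \<in> cball 0 R" by simp
  have nn: "P0 \<ge> 0" "P1 l \<ge> 0" "M0 \<ge> 0" "M1 a \<ge> 0" for l a
    using P0[OF z'] P1[OF z'] M0[OF z] M1[OF z] abs_ge_zero order_trans by blast+
  \<comment> \<open>chain and product rule; \<open>h m\<^bsup>s-1\<^esup> \<ge> 1\<close> absorbs the term in which \<open>\<phi>\<close> is differentiated\<close>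
  define D where "D = P0 * (\<Sum>a\<in>UNIV. M1 a) + (\<Sum>l\<in>UNIV. P1 l * A) * M0"
  have D: "D \<ge> 0" using nn A by (auto simp: D_def intro!: add_nonneg_nonneg mult_nonneg_nonneg sum_nonneg)
  have gradT: "\<bar>partial a (T m) x\<bar> \<le> D * h m powr (s - 1)" if x: "x \<in> cube 1" for a m x
  proof -
    have Vx: "V m x \<in> cball 0 R" using bdd[OF x] by simp
    have "\<bar>partial a (\<lambda>x. \<psi> (V m x)) x\<bar> \<le> (\<Sum>l\<in>UNIV. \<bar>partial l \<psi> (V m x)\<bar> * \<bar>partial a (\<lambda>x. V m x $ l) x\<bar>)"
      by (subst partial_chain[OF smooth_differentiable[OF \<psi>] smooth_differentiable[OF V]])
         (intro order_trans[OF sum_abs], simp add: abs_mult)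
    also have "\<dots> \<le> (\<Sum>l\<in>UNIV. P1 l * (A * h m powr (s - 1)))"
      unfolding h_def by (intro sum_mono mult_mono P1[OF Vx] grad[OF x] nn) auto
    also have "\<dots> = (\<Sum>l\<in>UNIV. P1 l * A) * h m powr (s - 1)" by (simp add: sum_distrib_right mult.assoc)
    finally have 1: "\<bar>partial a (\<lambda>x. \<psi> (V m x)) x\<bar> \<le> (\<Sum>l\<in>UNIV. P1 l * A) * h m powr (s - 1)" .
    have "partial a (T m) x = \<psi> (V m x) * partial a \<phi> x + partial a (\<lambda>x. \<psi> (V m x)) x * \<phi> x"
      unfolding T_def[abs_def]
      by (rule partial_mult[OF smooth_differentiable[OF smooth_compose[OF \<psi> V]] smooth_differentiable[OF s\<phi>]])
    then have "\<bar>partial a (T m) x\<bar> \<le> \<bar>\<psi> (V m x)\<bar> * \<bar>partial a \<phi> x\<bar> + \<bar>partial a (\<lambda>x. \<psi> (V m x)) x\<bar> * \<bar>\<phi> x\<bar>"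
      using abs_triangle_ineq by (simp add: abs_mult[symmetric])
    also have "\<dots> \<le> P0 * M1 a + ((\<Sum>l\<in>UNIV. P1 l * A) * h m powr (s - 1)) * M0"
      by (intro add_mono mult_mono P0[OF Vx] M1[OF x] 1 M0[OF x] nn mult_nonneg_nonneg sum_nonneg) (use A nn in auto)
    also have "\<dots> \<le> (P0 * (\<Sum>a\<in>UNIV. M1 a)) * h m powr (s - 1) + ((\<Sum>l\<in>UNIV. P1 l * A) * h m powr (s - 1)) * M0"
    proof (rule add_right_mono)
      have "M1 a \<le> (\<Sum>a\<in>UNIV. M1 a)" using nn by (intro member_le_sum) auto
      then have "P0 * M1 a * 1 \<le> P0 * (\<Sum>a\<in>UNIV. M1 a) * h m powr (s - 1)"
        using nn h1 by (intro mult_mono mult_left_mono mult_nonneg_nonneg sum_nonneg) auto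
      then show "P0 * M1 a \<le> P0 * (\<Sum>a\<in>UNIV. M1 a) * h m powr (s - 1)" by simp
    qed
    also have "\<dots> = D * h m powr (s - 1)" by (simp add: D_def algebra_simps)
    finally show ?thesis .
  qed
  define L where "L m j = integral (cube 1) (\<lambda>x. T m x * minor k \<alpha> (\<lambda>l x. V j x $ i l) x)" for m j
  \<comment> \<open>the exponent \<open>\<beta>\<close> collects one factor \<open>h j\<^sup>s\<close> and \<open>k - 1\<close> factors \<open>h j\<^bsup>s-1\<^esup>\<close>; then \<open>s - 1 + \<beta> = (k + 1) s - k\<close>\<close>
  define \<beta> where "\<beta> = s + (s - 1) * (real k - 1)"
  define vol where "vol = measure lborel (cube 1 :: (real^'n) set)"
  define E where "E = real k * (A * fact k * D * A ^ (k - 1) * 2 powr ((1 - s) * (real k - 1)) * vol)"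
  have "s * (real k + 1) > real k" using s k by (simp add: field_simps)
  then have \<gamma>: "s - 1 + \<beta> > 0" by (simp add: \<beta>_def algebra_simps)
  then have \<beta>: "\<beta> > 0" using s by simp
  have step: "\<bar>L m j - L m (Suc j)\<bar> \<le> (E * h m powr (s - 1)) * ((1/2) powr \<beta>) ^ j" for m j
  proof -
    define B where "B = A * h (Suc j) powr (s - 1)"
    let ?f = "\<lambda>l x. V j x $ i l" and ?g = "\<lambda>l x. V (Suc j) x $ i l"
    let ?b = "A * h j powr s * (fact k * ((D * h m powr (s - 1)) * B ^ (k - 1)))"
    have sm: "smooth (?f l)" "smooth (?g l)" for l by (intro smooth_component V)+
    have "h j powr (s - 1) \<le> h (Suc j) powr (s - 1)"
      using h[of j] s by (intro powr_mono2') auto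
    then have B: "\<bar>partial a (?f l) x\<bar> \<le> B" "\<bar>partial a (?g l) x\<bar> \<le> B" if "x \<in> cube 1" for a l x
      using grad[OF that, of a j "i l"] grad[OF that, of a "Suc j" "i l"] A mult_left_mono[of "h j powr (s - 1)" _ A]
      unfolding B_def h_def[symmetric] by (auto intro: order_trans)
    have "\<bar>integral (cube 1) (\<lambda>x. (?f c x - ?g c x) * minor k \<alpha> ((hybrid c ?f ?g)(c := T m)) x)\<bar> \<le> ?b * vol"
      if c: "c < k" for c
      unfolding vol_def real_norm_def[symmetric]
    proof (rule has_integral_bound[OF _ integrable_integral])
      have "smooth (hybrid c ?f ?g l)" for l using sm by (auto simp: hybrid_def)
      then have "continuous_on (cube 1) (minor k \<alpha> ((hybrid c ?f ?g)(c := T m)))"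
        by (intro continuous_minor) (simp add: sT)
      then show "(\<lambda>x. (?f c x - ?g c x) * minor k \<alpha> ((hybrid c ?f ?g)(c := T m)) x) integrable_on cube 1"
        by (intro integrable_continuous continuous_on_mult smooth_continuous[OF smooth_diff[OF sm]])
      fix x :: "real^'n" assume x: "x \<in> cube 1"
      have "\<bar>minor k \<alpha> ((hybrid c ?f ?g)(c := T m)) x\<bar> \<le> fact k * ((D * h m powr (s - 1)) * B ^ (k - 1))"
        by (rule abs_minor_le[OF c gradT[OF x]]) (auto simp: hybrid_def B[OF x])
      then show "norm ((?f c x - ?g c x) * minor k \<alpha> ((hybrid c ?f ?g)(c := T m)) x) \<le> ?b"
        using diff[OF x, of j "i c"] A unfolding h_def[symmetric] real_norm_def abs_mult
        by (intro mult_mono) auto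
    qed (use A D B_def in \<open>auto intro!: mult_nonneg_nonneg\<close>)
    then have "(\<Sum>c<k. \<bar>integral (cube 1) (\<lambda>x. (?f c x - ?g c x) * minor k \<alpha> ((hybrid c ?f ?g)(c := T m)) x)\<bar>)
        \<le> (\<Sum>c<k. ?b * vol)"
      by (intro sum_mono) auto
    moreover have "\<bar>L m j - L m (Suc j)\<bar> \<le>
        (\<Sum>c<k. \<bar>integral (cube 1) (\<lambda>x. (?f c x - ?g c x) * minor k \<alpha> ((hybrid c ?f ?g)(c := T m)) x)\<bar>)"
      unfolding L_def integral_minor_diff[OF sm(1) sm(2) tT] abs_minus_cancel by (rule sum_abs)
    ultimately have "\<bar>L m j - L m (Suc j)\<bar> \<le> real k * (?b * vol)" by simp
    also have "B ^ (k - 1) = A ^ (k - 1) * (2 powr ((1 - s) * (real k - 1)) * h j powr ((s - 1) * (real k - 1)))"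
    proof -
      have "h (Suc j) powr (s - 1) = 2 powr (1 - s) * h j powr (s - 1)"
        using powr_minus_divide[of 2 "s - 1"] by (simp add: h_def powr_divide)
      then have "(h (Suc j) powr (s - 1)) ^ (k - 1) = (2 powr (1 - s)) ^ (k - 1) * (h j powr (s - 1)) ^ (k - 1)"
        by (simp add: power_mult_distrib)
      also have "\<dots> = 2 powr ((1 - s) * (real k - 1)) * h j powr ((s - 1) * (real k - 1))"
        using h[of j] k by (simp add: powr_realpow[symmetric] powr_powr of_nat_diff)
      finally show ?thesis by (simp add: B_def power_mult_distrib)
    qed
    also have "real k * (A * h j powr s * (fact k * ((D * h m powr (s - 1)) *
        (A ^ (k - 1) * (2 powr ((1 - s) * (real k - 1)) * h j powr ((s - 1) * (real k - 1)))))) * vol) =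
        (E * h m powr (s - 1)) * (h j powr s * h j powr ((s - 1) * (real k - 1)))"
      by (simp add: E_def mult_ac)
    also have "h j powr s * h j powr ((s - 1) * (real k - 1)) = ((1/2) powr \<beta>) ^ j"
      unfolding powr_add[symmetric] \<beta>_def[symmetric]
      by (simp add: h_def powr_realpow[symmetric] powr_powr mult.commute)
    finally show ?thesis .
  qed
  define q where "q = (1/2 :: real) powr \<beta>"
  have q: "0 \<le> q" "q < 1" using powr_less_mono2[of \<beta> "1/2" 1] \<beta> by (auto simp: q_def)
  define G where "G = E / (1 - q)"
  have diag: "\<bar>L m m\<bar> \<le> G * ((1/2) powr (s - 1 + \<beta>)) ^ m" for m
  proof -
    have "\<bar>L m m\<bar> \<le> (E * h m powr (s - 1)) * q ^ m / (1 - q)"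
    proof (rule abs_le_geometric_tail[where f="L m"])
      show "L m \<longlonglongrightarrow> 0" unfolding L_def[abs_def] by (rule lim[OF tT])
    qed (use q step in \<open>auto simp: q_def\<close>)
    also have "h m powr (s - 1) = ((1/2) powr (s - 1)) ^ m"
      by (simp add: h_def powr_realpow[symmetric] powr_powr mult.commute)
    finally show ?thesis by (simp add: G_def q_def powr_add power_mult_distrib mult_ac)
  qed
  have "(\<lambda>m. G * ((1/2) powr (s - 1 + \<beta>)) ^ m) \<longlonglongrightarrow> G * 0"
    using powr_less_mono2[of "s - 1 + \<beta>" "1/2" 1] \<gamma>
    by (intro tendsto_mult tendsto_const LIMSEQ_realpow_zero) auto
  then have "(\<lambda>m. G * ((1/2) powr (s - 1 + \<beta>)) ^ m) \<longlonglongrightarrow> 0" by simp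
  then have "(\<lambda>m. L m m) \<longlonglongrightarrow> 0"
    by (rule Lim_null_comparison[rotated]) (simp add: diag)
  then show ?thesis by (simp add: L_def T_def)
qed

section \<open>Smooth approximations of a map of small rank\<close>

text \<open>By antisymmetry, the minors for increasing indices determine those for arbitrary ones. This is
  needed since the expansion of a minor of a composition runs over all indices.\<close>

lemma inj_eq_strict_mono_permutation:
  fixes i :: "nat \<Rightarrow> 'm::{finite,linorder}"
  assumes "inj_on i {..<k}"
  obtains i' \<tau> where "strict_mono_on {..<k} i'" "\<tau> permutes {..<k}" "\<And>j. j < k \<Longrightarrow> i j = i' (\<tau> j)"
proof -
  define xs where "xs = sorted_list_of_set (i ` {..<k})"
  define i' where "i' j = xs ! j" for j
  have len: "length xs = k" using card_image[OF assms] by (simp add: xs_def)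
  have st: "sorted_wrt (<) xs" by (simp add: xs_def strict_sorted_iff)
  have mono: "strict_mono_on {..<k} i'"
    using st len by (auto simp: strict_mono_on_def i'_def sorted_wrt_iff_nth_less)
  have inj': "inj_on i' {..<k}"
    using mono by (rule strict_mono_on_imp_inj_on)
  have im: "i' ` {..<k} = i ` {..<k}"
  proof -
    have "i' ` {..<k} = set xs" using len by (auto simp: i'_def set_conv_nth)
    then show ?thesis by (simp add: xs_def)
  qed
  define \<tau> where "\<tau> j = (if j < k then inv_into {..<k} i' (i j) else j)" for j
  have \<tau>: "\<tau> j < k" "i' (\<tau> j) = i j" if "j < k" for j
    using that im inv_into_into[of "i j" i' "{..<k}"] f_inv_into_f[of "i j" i' "{..<k}"] by (auto simp: \<tau>_def)
  have "bij_betw \<tau> {..<k} {..<k}"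
  proof (rule bij_betwI')
    show "\<tau> x = \<tau> y \<longleftrightarrow> x = y" if "x \<in> {..<k}" "y \<in> {..<k}" for x y
      using that \<tau>(2) assms by (metis inj_onD lessThan_iff)
    show "\<exists>x\<in>{..<k}. y = \<tau> x" if y: "y \<in> {..<k}" for y
    proof -
      obtain x where "x < k" "i x = i' y" using im y by (metis imageE imageI lessThan_iff)
      then have "\<tau> x = y" using \<tau>[of x] inj' y by (metis inj_onD lessThan_iff)
      then show ?thesis using \<open>x < k\<close> by auto
    qed
  qed (use \<tau>(1) in auto)
  then have "\<tau> permutes {..<k}" by (rule bij_imp_permutes) (simp add: \<tau>_def)
  with mono show ?thesis using \<tau>(2) that by metis
qed

text \<open>From here on, the rank condition is only used through one family of mollifications. The Hoelder
  extension \<open>w\<close> makes the estimates available on \<open>cube 1\<close>, which contains the ball.\<close>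

lemma rank_less_holder_approximation:
  fixes u :: "real^'n::{finite,wellorder} \<Rightarrow> real^'m::{finite,wellorder}"
  assumes u: "holder_on s (ball 0 1) u" and s: "s < 1" and k: "k \<ge> 1"
    and rank: "rank_less_holder s k u"
  obtains U w A where
    "\<And>\<epsilon>. smooth (U \<epsilon>)"
    "continuous_on UNIV w" "\<And>x. x \<in> ball 0 1 \<Longrightarrow> w x = u x"
    "\<And>\<epsilon> x. 0 < \<epsilon> \<Longrightarrow> \<epsilon> \<le> 1 \<Longrightarrow> x \<in> cube 1 \<Longrightarrow> norm (U \<epsilon> x - w x) \<le> A * \<epsilon> powr s"
    "\<And>\<epsilon> x a i. 0 < \<epsilon> \<Longrightarrow> \<epsilon> \<le> 1 \<Longrightarrow> x \<in> cube 1 \<Longrightarrow> \<bar>partial a (\<lambda>x. U \<epsilon> x $ i) x\<bar> \<le> A * \<epsilon> powr (s - 1)"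
    "A > 0"
    "\<And>\<phi> \<alpha> i. test_function \<phi> \<Longrightarrow> strict_mono_on {..<k} \<alpha> \<Longrightarrow>
      ((\<lambda>\<epsilon>. integral (cube 1) (\<lambda>x. \<phi> x * minor k \<alpha> (\<lambda>l x. U \<epsilon> x $ i l) x)) \<longlongrightarrow> 0) (at_right 0)"
proof -
  obtain \<sigma> p where \<sigma>: "1 - 1 / real k < \<sigma>" "\<sigma> < s" and p: "real k < p" and rs: "rank_less_sobolev \<sigma> p k u"
    using rank unfolding rank_less_holder_def by blast
  have \<sigma>0: "\<sigma> > 0" using \<sigma>(1) k by (smt (verit) divide_le_eq_1 of_nat_1 of_nat_le_iff of_nat_0_less_iff)
  have p0: "p > 0" using p by simp
  have s0: "s > 0" using \<sigma> \<sigma>0 by simp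
  obtain w C where w: "\<And>x y. dist (w x) (w y) \<le> C * dist x y powr s" "\<And>x. x \<in> ball 0 1 \<Longrightarrow> w x = u x"
    using holder_extension[OF u s0] by blast
  obtain U A where U: "\<And>\<epsilon>. smooth (U \<epsilon>)"
    "\<And>\<epsilon> x. 0 < \<epsilon> \<Longrightarrow> \<epsilon> \<le> 1 \<Longrightarrow> x \<in> cube 1 \<Longrightarrow> norm (U \<epsilon> x - w x) \<le> A * \<epsilon> powr s"
    "\<And>\<epsilon> x a i. 0 < \<epsilon> \<Longrightarrow> \<epsilon> \<le> 1 \<Longrightarrow> x \<in> cube 1 \<Longrightarrow> \<bar>partial a (\<lambda>x. U \<epsilon> x $ i) x\<bar> \<le> A * \<epsilon> powr (s - 1)"
    "A > 0"
    using holder_smooth_approximation[OF w(1) s0] by blast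
  define \<theta> where "\<theta> = (\<sigma> + s) / 2"
  have \<theta>: "\<sigma> < \<theta>" "0 < \<theta>" "\<theta> < s" using \<sigma> \<sigma>0 by (auto simp: \<theta>_def)
  obtain B where B: "B > 0" "\<And>\<epsilon> x y. 0 < \<epsilon> \<Longrightarrow> \<epsilon> \<le> 1 \<Longrightarrow> x \<in> cube 1 \<Longrightarrow> y \<in> cube 1 \<Longrightarrow>
    norm ((U \<epsilon> x - w x) - (U \<epsilon> y - w y)) \<le> B * \<epsilon> powr (s - \<theta>) * norm (x - y) powr \<theta>"
    using approximation_error_holder[OF w(1) U(1-3) \<theta>(2,3) s] by blast
  have sub: "x \<in> cube 1" if "x \<in> ball 0 1" for x :: "real^'n::_"
    using that ball_subset_cball cball_subset_cube by blast
  have conv: "((\<lambda>\<epsilon>. sobolev_norm \<sigma> p (\<lambda>x. U \<epsilon> x - u x)) \<longlongrightarrow> 0) (at_right 0)"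
  proof (rule sobolev_norm_tendsto_0[where A=A and s=s and B=B and t="s - \<theta>" and \<theta>=\<theta>])
    fix \<epsilon> :: real and x :: "real^'n::_" assume "0 < \<epsilon>" "\<epsilon> \<le> 1" "x \<in> ball 0 1"
    then show "norm (U \<epsilon> x - u x) \<le> A * \<epsilon> powr s" using U(2)[of \<epsilon> x] w(2)[of x] sub by simp
  next
    fix \<epsilon> :: real and x y :: "real^'n::_" assume "0 < \<epsilon>" "\<epsilon> \<le> 1" "x \<in> ball 0 1" "y \<in> ball 0 1"
    then show "norm ((U \<epsilon> x - u x) - (U \<epsilon> y - u y)) \<le> B * \<epsilon> powr (s - \<theta>) * norm (x - y) powr \<theta>"
      using B(2)[of \<epsilon> x y] w(2)[of x] w(2)[of y] sub by simp
  qed (use U(4) B(1) s0 \<theta> p0 in auto)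
  have mono: "((\<lambda>\<epsilon>. integral (cube 1) (\<lambda>x. \<phi> x * minor k \<alpha> (\<lambda>l x. U \<epsilon> x $ i l) x)) \<longlongrightarrow> 0) (at_right 0)"
    if \<phi>: "test_function \<phi>" and \<alpha>: "strict_mono_on {..<k} \<alpha>" and i: "strict_mono_on {..<k} i" for \<phi> \<alpha> i
  proof -
    have "pullback_vanishes \<sigma> p k i u" using rs i unfolding rank_less_sobolev_def by blast
    moreover have "smooth_on_cball (U \<epsilon>)" for \<epsilon> using U(1) unfolding smooth_on_cball_def by blast
    ultimately have "((\<lambda>\<epsilon>. LINT x|lebesgue_on (ball 0 1). pullback_component k i \<alpha> (U \<epsilon>) x * \<phi> x) \<longlongrightarrow> 0) (at_right 0)"
      using \<phi> \<alpha> conv unfolding pullback_vanishes_def by blast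
    moreover have "(LINT x|lebesgue_on (ball 0 1). pullback_component k i \<alpha> (U \<epsilon>) x * \<phi> x) =
        integral (cube 1) (\<lambda>x. \<phi> x * minor k \<alpha> (\<lambda>l x. U \<epsilon> x $ i l) x)" for \<epsilon>
    proof -
      have "(LINT x|lebesgue_on (ball 0 1). \<phi> x * minor k \<alpha> (\<lambda>l x. U \<epsilon> x $ i l) x) =
          integral (cube 1) (\<lambda>x. \<phi> x * minor k \<alpha> (\<lambda>l x. U \<epsilon> x $ i l) x)"
        by (intro LINT_ball_eq_integral_cube continuous_on_mult continuous_minor smooth_component U(1)
            smooth_continuous[OF test_function_smooth[OF \<phi>]]) (simp add: test_function_eq_0[OF \<phi>])
      then show ?thesis by (simp add: pullback_component_eq_minor[OF U(1)] mult.commute)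
    qed
    ultimately show ?thesis by simp
  qed
  have "((\<lambda>\<epsilon>. integral (cube 1) (\<lambda>x. \<phi> x * minor k \<alpha> (\<lambda>l x. U \<epsilon> x $ i l) x)) \<longlongrightarrow> 0) (at_right 0)"
    if \<phi>: "test_function \<phi>" and \<alpha>: "strict_mono_on {..<k} \<alpha>" for \<phi> \<alpha> and i :: "nat \<Rightarrow> 'm"
  proof (cases "inj_on i {..<k}")
    case True
    then obtain i' \<tau> where i': "strict_mono_on {..<k} i'" and \<tau>: "\<tau> permutes {..<k}" "\<And>j. j < k \<Longrightarrow> i j = i' (\<tau> j)"
      using inj_eq_strict_mono_permutation by blast
    have "minor k \<alpha> (\<lambda>l x. U \<epsilon> x $ i l) x = of_int (sign \<tau>) * minor k \<alpha> (\<lambda>l x. U \<epsilon> x $ i' l) x" for \<epsilon> x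
      unfolding minor_reindex[OF \<tau>(1), symmetric] by (rule minor_cong) (simp add: \<tau>(2))
    then have "integral (cube 1) (\<lambda>x. \<phi> x * minor k \<alpha> (\<lambda>l x. U \<epsilon> x $ i l) x) =
        of_int (sign \<tau>) * integral (cube 1) (\<lambda>x. \<phi> x * minor k \<alpha> (\<lambda>l x. U \<epsilon> x $ i' l) x)" for \<epsilon>
      by (subst integral_mult_right[symmetric]) (simp add: mult.left_commute)
    then show ?thesis using tendsto_mult_right_zero[OF mono[OF \<phi> \<alpha> i']] by simp
  next
    case False
    then obtain c l where "c < k" "l < k" "c \<noteq> l" "i c = i l" by (auto simp: inj_on_def)
    then have "minor k \<alpha> (\<lambda>l x. U \<epsilon> x $ i l) x = 0" for \<epsilon> x
      by (intro minor_eq_0[of c k l]) auto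
    then show ?thesis by simp
  qed
  then show ?thesis
    using that[OF U(1) holder_continuous[OF w(1) s0] w(2) U(2-4)] by blast
qed

section \<open>Maps with a continuous left inverse\<close>

text \<open>With the slope \<open>l\<close>, the transition from \<open>0\<close> to \<open>1\<close> takes place for \<open>\<bar>g x\<bar> < 1 / (2 l)\<close>.\<close>

lemma partial_step:
  fixes g :: "real^'n::finite \<Rightarrow> real"
  assumes "smooth g"
  shows "partial a (\<lambda>x. step (l * g x + 1/2)) x = l * step' (l * g x + 1/2) * partial a g x"
proof -
  have d: "(\<lambda>x. l * g x + 1/2) differentiable (at x)"
    by (rule smooth_differentiable[OF smooth_add[OF smooth_mult[OF smooth_const assms] smooth_const]])
  have "partial a (\<lambda>x. l * g x + 1/2) x = l * partial a g x"
    by (subst partial_add) (auto simp: partial_mult smooth_differentiable assms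
        intro!: smooth_differentiable smooth_mult)
  then show ?thesis
    by (subst partial_chain_real[OF step_has_derivative d]) simp
qed

lemma smooth_step_affine: "smooth g \<Longrightarrow> smooth (\<lambda>x. step (l * g x + 1/2))"
  by (rule smooth_step[OF smooth_add[OF smooth_mult[OF smooth_const] smooth_const]])

lemma partial_nth: "partial a (\<lambda>x. x $ i) x = (if a = i then 1 else 0)"
  by (subst partial_bounded_linear) (auto simp: axis_def)

lemma minor_diagonal:
  assumes "\<And>a b. a < k \<Longrightarrow> b < k \<Longrightarrow> a \<noteq> b \<Longrightarrow> partial (\<alpha> a) (g b) x = 0"
  shows "minor k \<alpha> g x = (\<Prod>b<k. partial (\<alpha> b) (g b) x)"
proof -
  have "minor k \<alpha> g x = (\<Sum>\<pi>\<in>{id}. of_int (sign \<pi>) * (\<Prod>j<k. partial (\<alpha> (\<pi> j)) (g j) x))"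
    unfolding minor_def
  proof (rule sum.mono_neutral_right)
    show "\<forall>\<pi>\<in>{\<pi>. \<pi> permutes {..<k}} - {id}. of_int (sign \<pi>) * (\<Prod>j<k. partial (\<alpha> (\<pi> j)) (g j) x) = 0"
    proof
      fix \<pi> assume \<pi>: "\<pi> \<in> {\<pi>. \<pi> permutes {..<k}} - {id}"
      then obtain b where b: "\<pi> b \<noteq> b" by (auto simp: fun_eq_iff)
      have "b < k" using \<pi> b permutes_not_in[of \<pi> "{..<k}" b] by auto
      moreover from this have "\<pi> b < k" using \<pi> permutes_in_image[of \<pi> "{..<k}" b] by auto
      ultimately have "partial (\<alpha> (\<pi> b)) (g b) x = 0" using b by (intro assms) auto
      then have "(\<Prod>j<k. partial (\<alpha> (\<pi> j)) (g j) x) = 0" using \<open>b < k\<close> by (intro prod_zero) auto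
      then show "of_int (sign \<pi>) * (\<Prod>j<k. partial (\<alpha> (\<pi> j)) (g j) x) = 0" by simp
    qed
  qed (auto simp: finite_permutations permutes_id)
  then show ?thesis by simp
qed

text \<open>The Jacobian matrix of the coordinate steps is diagonal, so the pairing integrates a product of
  nonnegative functions which is positive at the origin.\<close>

lemma integral_minor_coordinates_pos:
  fixes \<alpha> :: "nat \<Rightarrow> 'n::finite"
  assumes \<alpha>: "inj_on \<alpha> {..<k}" and l: "l > 0"
  shows "integral (cube 1) (\<lambda>x. bump l x * minor k \<alpha> (\<lambda>b x. step (l * x $ \<alpha> b + 1/2)) x) > 0"
proof -
  let ?f = "\<lambda>x :: real^'n. bump l x * minor k \<alpha> (\<lambda>b x. step (l * x $ \<alpha> b + 1/2)) x"
  have m: "minor k \<alpha> (\<lambda>b x. step (l * x $ \<alpha> b + 1/2)) x = (\<Prod>b<k. l * step' (l * x $ \<alpha> b + 1/2))" for x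
    by (subst minor_diagonal) (auto simp: partial_step partial_nth inj_onD[OF \<alpha>])
  have c: "continuous_on (cube 1) ?f"
    by (intro continuous_on_mult smooth_continuous[OF smooth_bump] continuous_minor smooth_step_affine smooth_nth)
  have nn: "?f x \<ge> 0" for x
    unfolding m using l by (intro mult_nonneg_nonneg bump_nonneg prod_nonneg) (auto simp: step'_nonneg)
  have "integral (cube 1) ?f \<ge> 0"
    by (intro integral_nonneg integrable_continuous c nn)
  moreover have "integral (cube 1) ?f \<noteq> 0"
  proof
    assume "integral (cube 1) ?f = 0"
    then have "(?f has_integral 0) (cube 1)" using integrable_integral[OF integrable_continuous[OF c]] by simp
    moreover have "(0 :: real^'n) \<in> box (vec (- 1)) (vec 1)" by (simp add: mem_box_cart)
    ultimately have "?f 0 = 0"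
      using has_integral_0_cbox_imp_0[OF c nn] box_subset_cbox by blast
    then show False using l step'_half by (simp add: m bump_eq_1)
  qed
  ultimately show ?thesis by simp
qed

text \<open>On the support of the bump, the steps of \<open>g b\<close> and of the coordinate \<open>\<alpha> b\<close> are locally constant and
  equal where this coordinate is large enough. After integration by parts, the difference of the two in the slot \<open>c\<close> lives where the
  coordinate \<open>\<alpha> c\<close> is small, the gradient in each other slot \<open>b\<close> lives where the coordinate \<open>\<alpha> b\<close> is
  small, and where all these coordinates are small, the bump has no derivative in their directions.\<close>

lemma integral_minor_eq_coordinates:
  fixes g :: "nat \<Rightarrow> real^'n::finite \<Rightarrow> real"
  assumes g: "\<And>b. b < k \<Longrightarrow> smooth (g b)" and test: "test_function (bump l :: real^'n \<Rightarrow> real)" and l: "l > 0"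
    and near: "\<And>b x. b < k \<Longrightarrow> (\<And>i. \<bar>l * x $ i\<bar> < 2) \<Longrightarrow> \<bar>l * g b x - l * x $ \<alpha> b\<bar> \<le> 1/2"
  shows "integral (cube 1) (\<lambda>x. bump l x * minor k \<alpha> (\<lambda>b x. step (l * g b x + 1/2)) x) =
    integral (cube 1) (\<lambda>x. bump l x * minor k \<alpha> (\<lambda>b x. step (l * x $ \<alpha> b + 1/2)) x)"
proof -
  let ?z = "\<lambda>b x. step (l * g b x + 1/2)" and ?y = "\<lambda>b x. step (l * x $ \<alpha> b + 1/2)"
  have sz: "b < k \<Longrightarrow> smooth (?z b)" "smooth (?y b)" for b
    using g by (auto intro!: smooth_step_affine)
  have zero: "(?z c x - ?y c x) * minor k \<alpha> ((hybrid c ?z ?y)(c := bump l)) x = 0" if c: "c < k" for c x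
  proof (rule ccontr)
    assume ne: "\<not> ?thesis"
    then have "minor k \<alpha> ((hybrid c ?z ?y)(c := bump l)) x \<noteq> 0" by simp
    then obtain \<pi> where \<pi>: "\<pi> permutes {..<k}"
      "partial (\<alpha> (\<pi> c)) (bump l) x * (\<Prod>j\<in>{..<k} - {c}. partial (\<alpha> (\<pi> j)) (hybrid c ?z ?y j) x) \<noteq> 0"
      unfolding minor_update[OF c] by (metis (mono_tags, lifting) sum.not_neutral_contains_not_neutral mult_zero_right mem_Collect_eq)
    define d where "d = \<pi> c"
    have d: "d < k" using \<pi>(1) c permutes_in_image[of \<pi> "{..<k}" c] by (simp add: d_def)
    have b0: "partial (\<alpha> d) (bump l) x \<noteq> 0" using \<pi>(2) by (auto simp: d_def)
    \<comment> \<open>beyond the plateau of the bump, \<open>near\<close> puts \<open>g d x\<close> and \<open>x $ \<alpha> d\<close> on the same side of the transition\<close>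
    have far: "\<bar>l * x $ \<alpha> d\<bar> > 1" and small: "\<And>i. \<bar>l * x $ i\<bar> < 2"
      using partial_bump_nonzero[OF b0] by blast+
    have nr: "\<bar>l * g d x - l * x $ \<alpha> d\<bar> \<le> 1/2" by (rule near[OF d small])
    have out: "(l * g d x + 1/2 \<le> 0 \<and> l * x $ \<alpha> d + 1/2 \<le> 0) \<or> (l * g d x + 1/2 \<ge> 1 \<and> l * x $ \<alpha> d + 1/2 \<ge> 1)"
      using far nr by linarith
    show False
    proof (cases "d = c")
      case True
      then have "?z c x = ?y c x" using out step_eq_0 step_eq_1 by metis
      then show False using ne by simp
    next
      case False
      then have "partial (\<alpha> (\<pi> d)) (hybrid c ?z ?y d) x \<noteq> 0"
        using \<pi>(2) d by (auto simp: prod_zero_iff)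
      moreover have "step' (l * g d x + 1/2) = 0" "step' (l * x $ \<alpha> d + 1/2) = 0"
        using out step'_eq_0 by blast+
      ultimately show False
        using g[OF d] by (auto simp: hybrid_def partial_step split: if_splits)
    qed
  qed
  have "(\<Sum>c<k. integral (cube 1) (\<lambda>x. (?z c x - ?y c x) * minor k \<alpha> ((hybrid c ?z ?y)(c := bump l)) x)) = 0"
  proof (rule sum.neutral, rule ballI)
    fix c assume "c \<in> {..<k}"
    then have c: "c < k" by simp
    show "integral (cube 1) (\<lambda>x. (?z c x - ?y c x) * minor k \<alpha> ((hybrid c ?z ?y)(c := bump l)) x) = 0"
      unfolding zero[OF c] by simp
  qed
  moreover have "integral (cube 1) (\<lambda>x. bump l x * minor k \<alpha> ?z x) - integral (cube 1) (\<lambda>x. bump l x * minor k \<alpha> ?y x) =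
      - (\<Sum>c<k. integral (cube 1) (\<lambda>x. (?z c x - ?y c x) * minor k \<alpha> ((hybrid c ?z ?y)(c := bump l)) x))"
    by (rule integral_minor_diff[OF sz(1) sz(2) test])
  ultimately show ?thesis by linarith
qed

lemma exists_strict_mono_index:
  assumes "k \<le> CARD('n::{finite,linorder})"
  obtains \<alpha> :: "nat \<Rightarrow> 'n::{finite,linorder}" where "strict_mono_on {..<k} \<alpha>"
proof -
  define xs where "xs = sorted_list_of_set (UNIV :: 'n set)"
  have "sorted_wrt (<) xs" "length xs = CARD('n)" by (simp_all add: xs_def strict_sorted_iff)
  then have "strict_mono_on {..<k} ((!) xs)"
    using assms by (auto simp: strict_mono_on_def sorted_wrt_iff_nth_less)
  then show ?thesis by (rule that)
qed

text \<open>By the Stone--Weierstrass theorem on the image; polynomials provide smoothness on the whole target,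
  where the approximations of \<open>u\<close> take their values.\<close>

lemma polynomial_left_inverse:
  fixes u :: "'a::topological_space \<Rightarrow> 'b::euclidean_space" and v :: "'b \<Rightarrow> real^'n::finite"
  assumes S: "compact (u ` S)" and v: "continuous_on (u ` S) v" and e: "e > 0"
  obtains P where "\<And>c. real_polynomial_function (P c)" "\<And>c x. x \<in> S \<Longrightarrow> \<bar>P c (u x) - v (u x) $ c\<bar> < e"
proof -
  have "\<exists>P. real_polynomial_function P \<and> (\<forall>y\<in>u ` S. \<bar>v y $ c - P y\<bar> < e)" for c
  proof -
    have "continuous_on (u ` S) (\<lambda>y. v y $ c)" by (intro continuous_intros v)
    then obtain P where "polynomial_function P" "\<And>y. y \<in> u ` S \<Longrightarrow> norm (v y $ c - P y) < e"
      using Stone_Weierstrass_polynomial_function[OF S _ e] by metis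
    then show ?thesis by (auto simp: real_polynomial_function_eq)
  qed
  then obtain P where "\<And>c. real_polynomial_function (P c)" "\<And>c y. y \<in> u ` S \<Longrightarrow> \<bar>v y $ c - P c y\<bar> < e" by metis
  then show ?thesis using that by (metis abs_minus_commute imageI)
qed

text \<open>The result for an arbitrary target dimension. The proof takes minors in \<open>k\<close> fixed coordinate
  directions of the ball; the other coordinates are parameters.\<close>

theorem holder_small_rank_no_left_inverse:
  fixes u :: "real^'n::{finite,wellorder} \<Rightarrow> real^'m::{finite,wellorder}"
  assumes u: "holder_on s (ball 0 1) u" and rank: "rank_less_holder s k u"
    and k: "1 \<le> k" "k \<le> CARD('n)" and s: "real k / (real k + 1) < s" "s < 1"
    and v: "continuous_on (u ` ball 0 1) v" "\<And>x. x \<in> ball 0 1 \<Longrightarrow> v (u x) = x"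
  shows False
proof -
  obtain U w A where U: "\<And>\<epsilon>. smooth (U \<epsilon>)"
    and w: "continuous_on UNIV w" "\<And>x. x \<in> ball 0 1 \<Longrightarrow> w x = u x"
    and approx: "\<And>\<epsilon> x. 0 < \<epsilon> \<Longrightarrow> \<epsilon> \<le> 1 \<Longrightarrow> x \<in> cube 1 \<Longrightarrow> norm (U \<epsilon> x - w x) \<le> A * \<epsilon> powr s"
    and grad: "\<And>\<epsilon> x a i. 0 < \<epsilon> \<Longrightarrow> \<epsilon> \<le> 1 \<Longrightarrow> x \<in> cube 1 \<Longrightarrow> \<bar>partial a (\<lambda>x. U \<epsilon> x $ i) x\<bar> \<le> A * \<epsilon> powr (s - 1)"
    and A: "A > 0"
    and lim: "\<And>\<phi> \<alpha> i. test_function \<phi> \<Longrightarrow> strict_mono_on {..<k} \<alpha> \<Longrightarrow>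
      ((\<lambda>\<epsilon>. integral (cube 1) (\<lambda>x. \<phi> x * minor k \<alpha> (\<lambda>l x. U \<epsilon> x $ i l) x)) \<longlongrightarrow> 0) (at_right 0)"
    using rank_less_holder_approximation[OF u s(2) k(1) rank] by blast
  have "0 \<le> real k / (real k + 1)" by simp
  then have s0: "s > 0" using s(1) by linarith
  obtain \<alpha> :: "nat \<Rightarrow> 'n" where \<alpha>: "strict_mono_on {..<k} \<alpha>" using exists_strict_mono_index[OF k(2)] by blast
  define h :: "nat \<Rightarrow> real" where "h j = (1/2) ^ j" for j
  have h: "0 < h j" "h j \<le> 1" "h (Suc j) \<le> h j" for j by (auto simp: h_def power_le_one)
  have h0: "h \<longlonglongrightarrow> 0" unfolding h_def[abs_def] by (intro LIMSEQ_realpow_zero) auto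
  have hr: "filterlim h (at_right 0) sequentially"
    by (rule tendsto_imp_filterlim_at_right[OF h0]) (simp add: h(1))
  define V where "V j = U (h j)" for j
  have Vw: "norm (V j x - w x) \<le> A * h j powr s" if "x \<in> cube 1" for j x
    unfolding V_def by (rule approx[OF h(1,2) that])
  have "compact (w ` cube 1)"
    by (intro compact_continuous_image continuous_on_subset[OF w(1)] compact_cbox) auto
  then have "\<exists>R0. \<forall>y\<in>w ` cube 1. norm y \<le> R0"
    using compact_imp_bounded bounded_iff by blast
  then obtain R0 where R0: "\<And>x. x \<in> cube 1 \<Longrightarrow> norm (w x) \<le> R0" by blast
  define R where "R = R0 + A"
  have bdd: "norm (V j x) \<le> R" "norm (w x) \<le> R" if x: "x \<in> cube 1" for j x
  proof -
    have "h j powr s \<le> 1" using h[of j] s0 powr_mono2[of s "h j" 1] by simp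
    then have "A * h j powr s \<le> A * 1" using A by (intro mult_left_mono) auto
    then have "norm (V j x - w x) \<le> A" using Vw[OF x, of j] by simp
    then show "norm (V j x) \<le> R" using R0[OF x] norm_triangle_ineq2[of "V j x" "w x"] by (simp add: R_def)
    show "norm (w x) \<le> R" using R0[OF x] A by (simp add: R_def)
  qed
  have pairing: "(\<lambda>m. integral (cube 1) (\<lambda>x. (\<psi> (V m x) * \<phi> x) * minor k \<alpha> (\<lambda>l x. V m x $ i l) x)) \<longlonglongrightarrow> 0"
    if \<psi>: "smooth \<psi>" and \<phi>: "test_function \<phi>" for \<psi> \<phi> and i :: "nat \<Rightarrow> 'm"
  proof (rule minor_pairing_tendsto_0[where A="2 * A" and s=s and R=R])
    show "smooth (V j)" for j unfolding V_def by (rule U)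
    fix j :: nat and x :: "real^'n::_" and l assume x: "x \<in> cube 1"
    have "h (Suc j) powr s \<le> h j powr s" using h(3)[of j] h(1)[of "Suc j"] s0 by (intro powr_mono2) auto
    then have "A * h (Suc j) powr s \<le> A * h j powr s" using A by (intro mult_left_mono) auto
    then have "norm (V j x - V (Suc j) x) \<le> 2 * A * h j powr s"
      using Vw[OF x, of j] Vw[OF x, of "Suc j"] norm_triangle_ineq4[of "V j x - w x" "V (Suc j) x - w x"] by simp
    then show "\<bar>V j x $ l - V (Suc j) x $ l\<bar> \<le> 2 * A * ((1/2) ^ j) powr s"
      using component_le_norm_cart[of "V j x - V (Suc j) x" l] by (simp add: h_def)
  next
    fix j :: nat and x :: "real^'n::_" and l a assume x: "x \<in> cube 1"
    have "\<bar>partial a (\<lambda>x. V j x $ l) x\<bar> \<le> A * h j powr (s - 1)" unfolding V_def by (rule grad[OF h(1,2) x])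
    also have "\<dots> \<le> 2 * A * h j powr (s - 1)" using A by (intro mult_right_mono) auto
    finally show "\<bar>partial a (\<lambda>x. V j x $ l) x\<bar> \<le> 2 * A * ((1/2) ^ j) powr (s - 1)" by (simp add: h_def)
  next
    fix \<phi>' :: "real^'n::_ \<Rightarrow> real" assume "test_function \<phi>'"
    from filterlim_compose[OF lim[OF this \<alpha>] hr]
    show "(\<lambda>j. integral (cube 1) (\<lambda>x. \<phi>' x * minor k \<alpha> (\<lambda>l x. V j x $ i l) x)) \<longlonglongrightarrow> 0"
      by (simp add: V_def)
  qed (use bdd A s k \<psi> \<phi> in auto)
  \<comment> \<open>the support of \<open>bump l\<close> is the cube of half-width \<open>2 / l\<close>, which lies in the ball of radius \<open>1/2\<close>\<close>
  define l where "l = 4 * real CARD('n)"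
  have l: "l > 0" by (simp add: l_def)
  have half: "norm x \<le> 1/2" if "\<And>i. \<bar>l * x $ i\<bar> \<le> 2" for x :: "real^'n::_"
  proof -
    have "norm x \<le> (\<Sum>i\<in>UNIV. \<bar>x $ i\<bar>)" by (rule norm_le_l1_cart)
    also have "\<dots> \<le> (\<Sum>i\<in>(UNIV::'n set). 2 / l)"
      using that l by (intro sum_mono) (simp add: abs_mult field_simps)
    finally show ?thesis by (simp add: l_def)
  qed
  have test: "test_function (bump l :: real^'n::_ \<Rightarrow> real)"
  proof (rule test_functionI[OF smooth_bump, where r="1/2"])
    fix x :: "real^'n::_" assume "bump l x \<noteq> 0"
    then have "\<bar>l * x $ i\<bar> \<le> 2" for i using bump_eq_0[of l x i] by linarith
    then show "norm x \<le> 1/2" by (rule half)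
  qed simp
  have sub: "cball 0 (1/2) \<subseteq> ball (0 :: real^'n::_) 1" "cball (0 :: real^'n::_) (1/2) \<subseteq> cube 1"
    by (force, rule order_trans[OF subset_cball cball_subset_cube]) simp
  \<comment> \<open>precision \<open>1 / (4 l)\<close> for the left inverse and again for the mollification: half the width of the
    transition zone in total, as \<open>integral_minor_eq_coordinates\<close> demands\<close>
  have "continuous_on (cball 0 (1/2)) u"
    using continuous_on_eq[OF continuous_on_subset[OF w(1)]] w(2) sub(1) by blast
  then have "compact (u ` cball 0 (1/2))" by (intro compact_continuous_image compact_cball)
  moreover have "continuous_on (u ` cball 0 (1/2)) v"
    using sub(1) by (intro continuous_on_subset[OF v(1)]) auto
  moreover have "1 / (4 * l) > 0" using l by simp
  ultimately obtain P where P: "\<And>c. real_polynomial_function (P c)"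
    "\<And>c x. x \<in> cball 0 (1/2) \<Longrightarrow> \<bar>P c (u x) - v (u x) $ c\<bar> < 1 / (4 * l)"
    by (rule polynomial_left_inverse) blast
  have sP: "smooth (P c)" for c by (rule smooth_real_polynomial_function[OF P(1)])
  have Pw: "\<bar>P c (w x) - x $ c\<bar> < 1 / (4 * l)" if x: "x \<in> cball 0 (1/2)" for c x
  proof -
    have "x \<in> ball 0 1" using x sub by blast
    then show ?thesis using P(2)[OF x, of c] v(2)[of x] w(2)[of x] by simp
  qed
  have "\<forall>\<^sub>F m in sequentially. \<forall>x\<in>cube 1. \<bar>P c (V m x) - P c (w x)\<bar> < 1 / (4 * l)" for c
  proof -
    have "uniformly_continuous_on (cball 0 R) (P c)"
      by (intro compact_uniformly_continuous smooth_continuous[OF sP] compact_cball)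
    then obtain d where d: "d > 0" "\<And>y y'. y \<in> cball 0 R \<Longrightarrow> y' \<in> cball 0 R \<Longrightarrow> dist y' y < d \<Longrightarrow> dist (P c y') (P c y) < 1 / (4 * l)"
      using \<open>1 / (4 * l) > 0\<close> unfolding uniformly_continuous_on_def by metis
    have "(\<lambda>m. A * h m powr s) \<longlonglongrightarrow> A * 0 powr s"
      using s0 h(1) by (intro tendsto_mult tendsto_const tendsto_powr' h0) (simp add: less_imp_le)
    then have "\<forall>\<^sub>F m in sequentially. A * h m powr s < d"
      by (rule order_tendstoD(2)) (simp add: d(1))
    then show ?thesis
    proof eventually_elim
      case (elim m)
      show ?case
      proof
        fix x :: "real^'n::_" assume x: "x \<in> cube 1"
        have "dist (V m x) (w x) < d" using Vw[OF x, of m] elim by (simp add: dist_norm)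
        then show "\<bar>P c (V m x) - P c (w x)\<bar> < 1 / (4 * l)"
          using d(2)[of "w x" "V m x"] bdd[OF x] by (simp add: dist_real_def)
      qed
    qed
  qed
  then have ev: "\<forall>\<^sub>F m in sequentially. \<forall>c. \<forall>x\<in>cube 1. \<bar>P c (V m x) - P c (w x)\<bar> < 1 / (4 * l)"
    by (simp add: eventually_all_finite)
  \<comment> \<open>the same pairing is eventually a positive constant by comparison with the coordinates, and tends
    to zero by the rank condition\<close>
  define Q where "Q b y = step (l * P (\<alpha> b) y + 1/2)" for b y
  have sQ: "smooth (Q b)" for b unfolding Q_def[abs_def] by (rule smooth_step_affine[OF sP])
  define c0 where "c0 = integral (cube 1) (\<lambda>x. bump l x * minor k \<alpha> (\<lambda>b x. step (l * x $ \<alpha> b + 1/2)) x)"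
  have c0: "c0 > 0"
    unfolding c0_def by (rule integral_minor_coordinates_pos[OF strict_mono_on_imp_inj_on[OF \<alpha>] l])
  have "\<forall>\<^sub>F m in sequentially. integral (cube 1) (\<lambda>x. bump l x * minor k \<alpha> (\<lambda>b x. Q b (V m x)) x) = c0"
    using ev
  proof eventually_elim
    case (elim m)
    show ?case
      unfolding Q_def c0_def
    proof (rule integral_minor_eq_coordinates[OF _ test l])
      show "smooth (\<lambda>x. P (\<alpha> b) (V m x))" for b
        unfolding V_def by (rule smooth_compose[OF sP U])
      fix b and x :: "real^'n::_" assume x: "\<And>i. \<bar>l * x $ i\<bar> < 2"
      have xb: "x \<in> cball 0 (1/2)" using half[OF less_imp_le[OF x]] by simp
      then have "\<bar>P (\<alpha> b) (V m x) - P (\<alpha> b) (w x)\<bar> < 1 / (4 * l)" using elim sub(2) by blast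
      then have "\<bar>P (\<alpha> b) (V m x) - x $ \<alpha> b\<bar> \<le> 1 / (4 * l) + 1 / (4 * l)" using Pw[OF xb, of "\<alpha> b"] by linarith
      then have "l * \<bar>P (\<alpha> b) (V m x) - x $ \<alpha> b\<bar> \<le> l * (1 / (4 * l) + 1 / (4 * l))" using l by (intro mult_left_mono) auto
      then show "\<bar>l * P (\<alpha> b) (V m x) - l * x $ \<alpha> b\<bar> \<le> 1/2"
        using l by (simp add: right_diff_distrib[symmetric] abs_mult)
    qed
  qed
  then have "(\<lambda>m. integral (cube 1) (\<lambda>x. bump l x * minor k \<alpha> (\<lambda>b x. Q b (V m x)) x)) \<longlonglongrightarrow> c0"
    by (rule tendsto_eventually)
  moreover have "(\<lambda>m. integral (cube 1) (\<lambda>x. bump l x * minor k \<alpha> (\<lambda>b x. Q b (V m x)) x)) \<longlonglongrightarrow> 0"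
  proof -
    let ?I = "{..<k} \<rightarrow>\<^sub>E (UNIV :: 'm set)"
    let ?\<psi> = "\<lambda>i y. \<Prod>j<k. partial (i j) (Q j) y"
    have s\<psi>: "smooth (?\<psi> i)" for i by (intro smooth_prod smooth_partial sQ)
    have sV: "smooth (V m)" for m unfolding V_def by (rule U)
    have "integral (cube 1) (\<lambda>x. bump l x * minor k \<alpha> (\<lambda>b x. Q b (V m x)) x) =
        (\<Sum>i\<in>?I. integral (cube 1) (\<lambda>x. (?\<psi> i (V m x) * bump l x) * minor k \<alpha> (\<lambda>l x. V m x $ i l) x))" for m
    proof -
      have "integral (cube 1) (\<lambda>x. bump l x * minor k \<alpha> (\<lambda>b x. Q b (V m x)) x) =
          integral (cube 1) (\<lambda>x. \<Sum>i\<in>?I. (?\<psi> i (V m x) * bump l x) * minor k \<alpha> (\<lambda>l x. V m x $ i l) x)"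
        by (simp add: minor_compose[OF sQ sV] sum_distrib_left mult_ac)
      also have "\<dots> = (\<Sum>i\<in>?I. integral (cube 1) (\<lambda>x. (?\<psi> i (V m x) * bump l x) * minor k \<alpha> (\<lambda>l x. V m x $ i l) x))"
        by (intro integral_sum integrable_continuous continuous_on_mult continuous_minor smooth_component sV
            smooth_continuous[OF smooth_bump] smooth_continuous[OF smooth_compose[OF s\<psi> sV]] finite_PiE) auto
      finally show ?thesis .
    qed
    moreover have "(\<lambda>m. \<Sum>i\<in>?I. integral (cube 1) (\<lambda>x. (?\<psi> i (V m x) * bump l x) * minor k \<alpha> (\<lambda>l x. V m x $ i l) x)) \<longlonglongrightarrow> (\<Sum>i\<in>?I. 0)"
      by (intro tendsto_sum pairing s\<psi> test)
    ultimately show ?thesis by simp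
  qed
  ultimately have "c0 = 0" by (rule LIMSEQ_unique)
  with c0 show False by simp
qed

theorem corollary1p3:
  fixes k :: nat and s :: real
  assumes "2 \<le> CARD('n::{finite,wellorder})"
    and "2 \<le> k" and "k \<le> CARD('n)"
    and "0 < s" and "s < 1" and "s > real k / (real k + 1)"
  shows "\<not> (\<exists>u :: real^'n::_ \<Rightarrow> real^'n::_.
      holder_on s (ball 0 1) u \<and>
      (\<exists>v. homeomorphism (ball 0 1) (u ` ball 0 1) u v) \<and>
      integrable_weak_gradient u \<and>
      rank_less_holder s k u)"
proof
  assume "\<exists>u :: real^'n::_ \<Rightarrow> real^'n::_.
      holder_on s (ball 0 1) u \<and>
      (\<exists>v. homeomorphism (ball 0 1) (u ` ball 0 1) u v) \<and>
      integrable_weak_gradient u \<and>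
      rank_less_holder s k u"
  then obtain u v :: "real^'n::_ \<Rightarrow> real^'n::_" where u: "holder_on s (ball 0 1) u" "rank_less_holder s k u"
    and v: "homeomorphism (ball 0 1) (u ` ball 0 1) u v" by blast
  show False
  proof (rule holder_small_rank_no_left_inverse[OF u _ assms(3) assms(6) assms(5)])
    show "1 \<le> k" using assms(2) by simp
    show "continuous_on (u ` ball 0 1) v" "\<And>x. x \<in> ball 0 1 \<Longrightarrow> v (u x) = x"
      using v by (auto simp: homeomorphism_def)
  qed
qed

end
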